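(* Let $n=4$ or $n=5$. For any (globally) convex curve $\gamma:\mathbb{S}^1\to\mathbb{R}P^{n-1}$ (respectively $\gamma: I\to\mathbb{R}P^{n-1}$, where $I\subseteq\mathbb{R}$ is an interval), one has $$\sharp_\gamma=\frac{n^3-n}{6}.$$
   Context: Curves are smooth and intervals are non-degenerate. A curve $\gamma$ in $\mathbb{R}P^{n-1}$ (defined on $\mathbb{S}^1$ or on an interval) is locally convex if for every hyperplane $H\subset\mathbb{R}P^{n-1}$ the local multiplicity of the intersection of $\gamma$ with $H$ at each intersection point is at most $n-1$; equivalently, for local lifts of $\gamma$ to $\mathbb{R}^n\setminus\{0\}$ the vectors $\gamma(t),\gamma'(t),\dots,\gamma^{(n-1)}(t)$ are linearly independent for every $t$. It is globally convex (or simply convex) if for every hyperplane $H$ the sum of all local multiplicities of intersection of $\gamma$ with $H$ is at most $n-1$. Here the local multiplicity at parameter $t_0$ is the order of vanishing at $t_0$ of $\ell(\tilde\gamma(t))$, where $\tilde\gamma$ is a local lift of $\gamma$ and $\ell$ is a linear form defining $H$. $\mathrm{Fl}_n$ is the space of complete real flags in $\mathbb{R}^n$. Two complete flags $f_1,f_2$ are transversal if for every $1\le i\le n-1$ the $i$-dimensional subspace of $f_1$ and the $(n-i)$-dimensional subspace of $f_2$ intersect only at the origin; otherwise they are non-transversal. For a locally convex curve $\gamma$, its osculating flag curve $\gamma_{\mathcal F}$ takes $t$ to the complete flag whose $i$-dimensional subspace is spanned by $\tilde\gamma(t),\tilde\gamma'(t),\dots,\tilde\gamma^{(i-1)}(t)$.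 For $f\in\mathrm{Fl}_n$, $\sharp_{\gamma,f}$ is the number of parameters $t$ for which $\gamma_{\mathcal F}(t)$ and $f$ are non-transversal, and $\sharp_\gamma=\sup_{f\in\mathrm{Fl}_n}\sharp_{\gamma,f}$. *)

theory Defs
  imports "HOL-Analysis.Analysis"
begin

text \<open>
  A curve is given by a map \<open>c\<close> from a non-degenerate real interval \<open>J\<close> to
  real projective space; derivatives are taken within \<open>J\<close>, hence are one-sided at endpoints
  belonging to \<open>J\<close>. A second parameter set \<open>T \<subseteq> J\<close> contains the parameters to be counted.
  A curve on an interval \<open>I\<close> has \<open>J = T = I\<close>. A curve \<open>\<gamma>\<close> on the unit circle is
  \<open>c = \<gamma> \<circ> cis\<close> with \<open>J = UNIV\<close>, and \<open>T = {0..<2 * pi}\<close>, which \<open>cis\<close> maps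
  bijectively onto the circle.
\<close>

definition projective_space :: "(real ^ 'n) set set" where
  "projective_space = {L. subspace L \<and> dim L = 1}"

definition nderiv :: "real set \<Rightarrow> nat \<Rightarrow> (real \<Rightarrow> 'a::real_normed_vector) \<Rightarrow> real \<Rightarrow> 'a" where
  "nderiv J k v = ((\<lambda>g t. vector_derivative g (at t within J)) ^^ k) v"

text \<open>In the next definition \<open>U\<close> is open, so that at points of \<open>J \<inter> U\<close> derivatives within
  \<open>J\<close> depend only on the restriction of \<open>v\<close> to \<open>J \<inter> U\<close>.\<close>

definition local_lift ::
    "real set \<Rightarrow> (real \<Rightarrow> (real ^ 'n) set) \<Rightarrow> real \<Rightarrow> (real \<Rightarrow> real ^ 'n) \<Rightarrow> bool" where
  "local_lift J c t v \<longleftrightarrow>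
     (\<exists>U. open U \<and> t \<in> U \<and>
        (\<forall>k. \<forall>s \<in> J \<inter> U. nderiv J k v differentiable (at s within J)) \<and>
        (\<forall>s \<in> J \<inter> U. v s \<noteq> 0 \<and> c s = span {v s}))"

definition smooth_curve :: "real set \<Rightarrow> (real \<Rightarrow> (real ^ 'n) set) \<Rightarrow> bool" where
  "smooth_curve J c \<longleftrightarrow> c \<in> J \<rightarrow> projective_space \<and> (\<forall>t \<in> J. \<exists>v. local_lift J c t v)"

text \<open>Two local lifts differ near \<open>t\<close> by a nowhere vanishing smooth factor, so multiplicities
  and osculating flags do not depend on the lift chosen here.\<close>

definition lift_at :: "real set \<Rightarrow> (real \<Rightarrow> (real ^ 'n) set) \<Rightarrow> real \<Rightarrow> real \<Rightarrow> real ^ 'n" where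
  "lift_at J c t = (SOME v. local_lift J c t v)"

definition vanishing_order :: "real set \<Rightarrow> (real \<Rightarrow> real) \<Rightarrow> real \<Rightarrow> enat" where
  "vanishing_order J g t =
     (if \<exists>k. nderiv J k g t \<noteq> 0 then enat (LEAST k. nderiv J k g t \<noteq> 0) else \<infinity>)"

text \<open>Hyperplanes are represented by the nonzero linear forms \<open>l\<close> defining them. The
  multiplicity is 0 precisely at the parameters where the curve does not meet the hyperplane.\<close>

definition local_multiplicity ::
    "real set \<Rightarrow> (real \<Rightarrow> (real ^ 'n) set) \<Rightarrow> (real ^ 'n \<Rightarrow> real) \<Rightarrow> real \<Rightarrow> enat" where
  "local_multiplicity J c l t = vanishing_order J (\<lambda>s. l (lift_at J c t s)) t"

text \<open>Every family in \<open>enat\<close> is summable, so the infinite sum used for convexity never falls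
  back to the default value 0.\<close>

lemma infsum_enat: "infsum f T = (SUP F \<in> {F. finite F \<and> F \<subseteq> T}. sum f F)"
  for f :: "'a \<Rightarrow> enat"
  by (rule nonneg_infsum_complete) simp

definition convex_curve ::
    "real set \<Rightarrow> real set \<Rightarrow> (real \<Rightarrow> (real ^ 'n) set) \<Rightarrow> bool" where
  "convex_curve J T c \<longleftrightarrow>
     smooth_curve J c \<and>
     (\<forall>l. linear l \<and> l \<noteq> (\<lambda>_. 0) \<longrightarrow>
        (\<Sum>\<^sub>\<infinity>t\<in>T. local_multiplicity J c l t) \<le> enat (CARD('n) - 1))"

text \<open>A flag is indexed by \<open>nat\<close>, being constantly the whole space from index \<open>CARD('n)\<close> on;
  \<open>osculating_flag\<close> below follows the same convention.\<close>

definition complete_flags :: "(nat \<Rightarrow> (real ^ 'n) set) set" where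
  "complete_flags =
     {f. mono f \<and> (\<forall>i. subspace (f i) \<and> dim (f i) = min i CARD('n))}"

definition transversal ::
    "(nat \<Rightarrow> (real ^ 'n) set) \<Rightarrow> (nat \<Rightarrow> (real ^ 'n) set) \<Rightarrow> bool" where
  "transversal f1 f2 \<longleftrightarrow> (\<forall>i \<in> {1..CARD('n) - 1}. f1 i \<inter> f2 (CARD('n) - i) = {0})"

definition osculating_flag ::
    "real set \<Rightarrow> (real \<Rightarrow> (real ^ 'n) set) \<Rightarrow> real \<Rightarrow> nat \<Rightarrow> (real ^ 'n) set" where
  "osculating_flag J c t i = span {nderiv J j (lift_at J c t) t | j. j < i}"

definition ecard :: "'a set \<Rightarrow> enat" where
  "ecard A = (if finite A then enat (card A) else \<infinity>)"

definition nontransversal_count ::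
    "real set \<Rightarrow> real set \<Rightarrow> (real \<Rightarrow> (real ^ 'n) set) \<Rightarrow> (nat \<Rightarrow> (real ^ 'n) set) \<Rightarrow> enat" where
  "nontransversal_count J T c f = ecard {t \<in> T. \<not> transversal (osculating_flag J c t) f}"

definition sharp :: "real set \<Rightarrow> real set \<Rightarrow> (real \<Rightarrow> (real ^ 'n) set) \<Rightarrow> enat" where
  "sharp J T c = (SUP f \<in> complete_flags. nontransversal_count J T c f)"

definition convex_on_circle :: "(complex \<Rightarrow> (real ^ 'n) set) \<Rightarrow> bool" where
  "convex_on_circle \<gamma> \<longleftrightarrow> convex_curve UNIV {0..<2 * pi} (\<gamma> \<circ> cis)"

definition sharp_on_circle :: "(complex \<Rightarrow> (real ^ 'n) set) \<Rightarrow> enat" where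
  "sharp_on_circle \<gamma> = sharp UNIV {0..<2 * pi} (\<gamma> \<circ> cis)"

definition convex_on_interval :: "real set \<Rightarrow> (real \<Rightarrow> (real ^ 'n) set) \<Rightarrow> bool" where
  "convex_on_interval I \<gamma> \<longleftrightarrow> convex_curve I I \<gamma>"

definition sharp_on_interval :: "real set \<Rightarrow> (real \<Rightarrow> (real ^ 'n) set) \<Rightarrow> enat" where
  "sharp_on_interval I \<gamma> = sharp I I \<gamma>"

definition nondegenerate_interval :: "real set \<Rightarrow> bool" where
  "nondegenerate_interval I \<longleftrightarrow> is_interval I \<and> (\<exists>a \<in> I. \<exists>b \<in> I. a < b)"

end

theory Submission
  imports Defs
begin

text \<open>
  Let \<open>n = CARD('n)\<close> and let \<open>f\<close> be a complete flag. Transversality fails at \<open>t\<close> if for some \<open>k\<close> the osculating space of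
  dimension \<open>k\<close> at \<open>t\<close> meets the space of dimension \<open>n - k\<close> of \<open>f\<close> nontrivially. For each \<open>k\<close> there are at most
  \<open>k * (n - k)\<close> such parameters, and these numbers add up to \<open>(n ^ 3 - n) / 6\<close>. For a suitable flag they are all attained, at
  pairwise different parameters.

  Upper bound. Fix \<open>k\<close>, and let \<open>b\<close> be the last parameter of this kind. Convexity makes the osculating flags at \<open>t < b\<close> and
  at \<open>b\<close> transversal, so that their spaces of dimensions \<open>j + 1\<close> and \<open>n - j\<close> meet in a line. Normalised vectors \<open>frame j t\<close> on
  these lines form a chain, that is, they satisfy \<open>frame j' = speed j * frame (j + 1)\<close> with nowhere vanishing speeds, and the
  last one is constant (\<open>chain_frame\<close>). Coordinates of fixed vectors with respect to this frame form a
  chain as well (\<open>chain_dual\<close>). If \<open>n\<close> is 4 or 5, then \<open>k\<close> or \<open>n - k\<close> is 1 or 2. If one of them is 1, the parameters in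
  question are zeros of the first function of a real chain, and Rolle's theorem bounds their number
  (\<open>card_chain_zeros_le\<close>). If one of them is 2, they are zeros of the determinant of \<open>x 0\<close> and \<open>x 1\<close> for a chain \<open>x\<close> in
  the plane, and the problem is to bound their number (\<open>card_planar_zeros_le\<close>).

  For this one considers the polygon with vertices \<open>x 0 t, \<dots>, x m t\<close>. As \<open>t\<close> grows, each vertex moves
  towards its successor if the speeds are positive, which a change of signs achieves. To
  the turns of the polygon, seen from the origin, one attaches an integer cost that such moves do not increase and
  whose parity tells whether the first and the last turn have the same sense. The last turn keeps its sense, and the sense of
  the first is the sign of the determinant. Hence every change of this sign lowers the cost (\<open>turn_cost_drop\<close>). A zero without
  change of sign yields two changes after a small perturbation. The condition at \<open>b\<close> makes the last two vertices parallel, which bounds the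
  initial cost (\<open>turning_exists_le\<close>).

  Lower bound. Under magnification at a point \<open>a\<close>, every chain looks like a polynomial and its derivatives
  (\<open>scaled_chain_tendsto\<close>). So one can prescribe polynomials \<open>p\<close>, \<open>p'\<close> for two linear forms and \<open>g\<close>, \<open>g'\<close> for two vectors. For
  the flag made of the vectors and of the kernels of the forms, the incidences with the osculating flag near
  \<open>a\<close> then correspond to sign changes of \<open>p\<close>, of the Wronskian of \<open>p\<close> and \<open>p'\<close> (if \<open>n = 5\<close>), of the Wronskian
  of \<open>g\<close> and \<open>g'\<close>, and of \<open>g\<close> (\<open>length_le_sharp\<close>). The vectors must lie in the
  kernels, which is a bilinear condition on the polynomials. Explicit polynomials satisfy it and have 10 zeros for \<open>n = 4\<close>
  and 20 for \<open>n = 5\<close> in total, all simple and different.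
\<close>

section \<open>Costs of turn lists\<close>

text \<open>
  The charge for a maximal run of turns in the same sense, of total angle \<open>pi * x\<close>. It is odd, so that the
  parity of a sum of charges is the parity of the number of runs.
\<close>
definition run_cost :: "real \<Rightarrow> int" where
  "run_cost x = 2 * max 1 \<lceil>x\<rceil> - 1"

text \<open>
  A turn consists of a sense, \<open>True\<close> being counterclockwise, and of an angle in multiples of \<open>pi\<close>. The
  accumulators \<open>s\<close> and \<open>x\<close> hold the sense and the total angle of the run in progress.
\<close>
fun runs_cost :: "bool \<Rightarrow> real \<Rightarrow> (bool \<times> real) list \<Rightarrow> int" where
  "runs_cost s x [] = run_cost x"
| "runs_cost s x ((t, y) # ds) =
     (if s = t then runs_cost s (x + y) ds else run_cost x + runs_cost t y ds)"

definition turn_cost :: "(bool \<times> real) list \<Rightarrow> int" where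
  "turn_cost ds = runs_cost (fst (hd ds)) 0 ds"

lemma run_cost_mono: "x \<le> y \<Longrightarrow> run_cost x \<le> run_cost y"
  unfolding run_cost_def using ceiling_mono[of x y] by linarith

lemma run_cost_ge_1: "1 \<le> run_cost x"
  unfolding run_cost_def by simp

lemma run_cost_le_1: "x \<le> 1 \<Longrightarrow> run_cost x = 1"
  unfolding run_cost_def using ceiling_le_one[of x] by simp

lemma run_cost_add: "0 \<le> x \<Longrightarrow> 0 \<le> y \<Longrightarrow> run_cost (x + y) \<le> run_cost x + run_cost y + 1"
  unfolding run_cost_def using ceiling_add_le[of x y] by linarith

lemma run_cost_split:
  assumes "0 \<le> x" "0 \<le> y" "1 < e"
  shows "run_cost x + 1 + run_cost y \<le> run_cost (x + y + e)"
proof -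
  have "\<lceil>x\<rceil> + \<lceil>y\<rceil> \<le> \<lceil>x + y + e\<rceil>" "\<lceil>x\<rceil> + 1 \<le> \<lceil>x + y + e\<rceil>" "\<lceil>y\<rceil> + 1 \<le> \<lceil>x + y + e\<rceil>" "2 \<le> \<lceil>x + y + e\<rceil>"
    using assms by linarith+
  then show ?thesis
    unfolding run_cost_def by linarith
qed

lemma run_cost_add_1: "0 \<le> x \<Longrightarrow> d \<le> 1 \<Longrightarrow> run_cost (x + d) \<le> run_cost x + 2"
  unfolding run_cost_def using ceiling_mono[of "x + d" "x + 1"] by (simp add: max_def split: if_splits)

lemma run_cost_add_gt_1: "0 \<le> x \<Longrightarrow> 1 < e \<Longrightarrow> run_cost x + 2 \<le> run_cost (x + e)"
  using run_cost_split[of x 0 e] run_cost_le_1[of 0] by simp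

text \<open>
  The turns of the list that continue the run in progress have total angle \<open>K\<close>; everything after that run
  contributes a constant \<open>C\<close>.
\<close>
lemma runs_cost_shape:
  assumes "\<forall>d \<in> set ds. 0 \<le> snd d"
  shows "\<exists>K\<ge>0. \<exists>C. \<forall>x. runs_cost s x ds = run_cost (x + K) + C"
  using assms
proof (induction ds)
  case Nil
  then show ?case by (auto intro: exI[of _ 0])
next
  case (Cons d ds)
  obtain t y where d: "d = (t, y)" by force
  obtain K C where K: "K \<ge> 0" "\<And>x. runs_cost s x ds = run_cost (x + K) + C"
    using Cons by auto
  show ?case
  proof (cases "s = t")
    case True
    show ?thesis
      using K Cons.prems d True by (auto intro!: exI[of _ "y + K"] exI[of _ C] simp: add.assoc)
  next
    case False
    show ?thesis
      using d False by (auto intro!: exI[of _ "0::real"] exI[of _ "runs_cost t y ds"])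
  qed
qed

text \<open>
  The product of two rotations, written again with an angle of at most \<open>pi\<close>. Two turns in the same sense
  whose angles exceed \<open>pi\<close> together compose to a turn in the opposite sense.
\<close>
fun compose_turns :: "bool \<times> real \<Rightarrow> bool \<times> real \<Rightarrow> bool \<times> real" where
  "compose_turns (s, x) (t, y) =
     (if s = t then if x + y \<le> 1 then (s, x + y) else (\<not> s, 2 - x - y)
      else if y \<le> x then (s, x - y) else (t, y - x))"

text \<open>
  When a vector rotates towards its successor by the angle \<open>x\<close>, that angle passes from the turn \<open>(s2, x2)\<close>
  behind it to the turn \<open>(s1, x1)\<close> in front of it. The dangerous case is a reversal of the sense of the
  front turn, which may cut a run into three; the total angle of the run then drops by \<open>x1 + x > 1\<close>, and
  this pays for the new runs.
\<close>
lemma runs_cost_compose_turns: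
  assumes "0 \<le> x0" "0 \<le> x1" "x1 \<le> 1" "0 \<le> x" "x \<le> x2" "x2 \<le> 1"
    and "\<forall>d \<in> set ds. 0 \<le> snd d"
  shows "runs_cost s0 x0 (compose_turns (s1, x1) (s2, x) # (s2, x2 - x) # ds)
     \<le> runs_cost s0 x0 ((s1, x1) # (s2, x2) # ds)"
proof -
  obtain K C where K: "K \<ge> 0" "\<And>x. runs_cost s2 x ds = run_cost (x + K) + C"
    using runs_cost_shape[OF assms(7)] by blast
  have c1: "run_cost x1 = 1" "run_cost (x1 - x) = 1"
    using assms by (auto intro!: run_cost_le_1)
  have c2: "run_cost (2 - x1 - x) = 1" if "x1 + x > 1"
    using that by (auto intro!: run_cost_le_1)
  consider "s1 = s2" "x1 + x \<le> 1" | "s1 = s2" "x1 + x > 1" "s0 = s1" | "s1 = s2" "x1 + x > 1" "s0 \<noteq> s1"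
    | "s1 \<noteq> s2" "x \<le> x1" | "s1 \<noteq> s2" "x > x1" "s0 = s1" | "s1 \<noteq> s2" "x > x1" "s0 \<noteq> s1"
    by linarith
  then show ?thesis
  proof cases
    case 1
    then show ?thesis by (auto simp: add_ac)
  next
    case 2
    have "run_cost x0 + 1 + run_cost (x2 - x + K) \<le> run_cost (x0 + (x2 - x + K) + (x1 + x))"
      using assms K(1) 2 by (intro run_cost_split) auto
    then show ?thesis
      using 2 K c1 c2 by (simp add: add_ac)
  next
    case 3
    have "run_cost (x0 + (2 - x1 - x)) \<le> run_cost x0 + 2"
      using assms 3 by (intro run_cost_add_1) auto
    moreover have "run_cost (x2 - x + K) + 2 \<le> run_cost (x2 - x + K + (x1 + x))"
      using assms K(1) 3 by (intro run_cost_add_gt_1) auto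
    moreover have "s0 = (\<not> s1)" using 3 by simp
    ultimately show ?thesis
      using 3 K c1 c2 by (simp add: algebra_simps)
  next
    case 4
    have "run_cost (x0 + (x1 - x)) \<le> run_cost (x0 + x1)" "run_cost (x2 - x + K) \<le> run_cost (x2 + K)"
      using assms by (auto intro!: run_cost_mono)
    then show ?thesis
      using 4 K c1 by auto
  next
    case 5
    have "run_cost x0 \<le> run_cost (x0 + x1)" "run_cost (x2 - x1 + K) \<le> run_cost (x2 + K)"
      using assms by (auto intro!: run_cost_mono)
    then show ?thesis
      using 5 K by (auto simp: algebra_simps)
  next
    case 6
    have "run_cost (x0 + (x2 - x1 + K)) \<le> run_cost (x0 + (x2 + K))"
      using assms by (auto intro!: run_cost_mono)
    also have "\<dots> \<le> run_cost x0 + run_cost (x2 + K) + 1"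
      using assms K by (intro run_cost_add) auto
    finally have "run_cost (x0 + (x2 - x1 + K)) \<le> run_cost x0 + run_cost (x2 + K) + 1" .
    moreover have "s0 = s2" using 6 by simp
    ultimately show ?thesis
      using 6 K assms run_cost_le_1[of x1] by (auto simp: algebra_simps)
  qed
qed

lemma runs_cost_mono:
  assumes "\<forall>d \<in> set ds. 0 \<le> snd d" "x \<le> y"
  shows "runs_cost s x ds \<le> runs_cost s y ds"
  using runs_cost_shape[OF assms(1), of s] run_cost_mono assms(2) by (metis add_le_cancel_right)

lemma turn_cost_le_runs_cost: "turn_cost ds \<le> runs_cost s 0 ds"
  unfolding turn_cost_def using run_cost_ge_1[of 0] by (cases ds) auto

lemma turn_cost_mono:
  assumes "ds \<noteq> []" "\<And>s. runs_cost s 0 ds' \<le> runs_cost s 0 ds"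
  shows "turn_cost ds' \<le> turn_cost ds"
  using turn_cost_le_runs_cost[of ds' "fst (hd ds)"] assms(2)[of "fst (hd ds)"]
  unfolding turn_cost_def by simp

text \<open>
  Every run has odd cost, and the senses of the first and of the last run agree if and only if the number
  of runs is odd.
\<close>
lemma runs_cost_parity:
  assumes "ds \<noteq> []"
  shows "even (runs_cost s x ds) \<longleftrightarrow> s \<noteq> fst (last ds)"
  using assms
proof (induction ds arbitrary: s x)
  case (Cons d ds)
  obtain t y where d: "d = (t, y)" by force
  have odd: "odd (run_cost x)" for x unfolding run_cost_def by simp
  show ?case
    using Cons.IH odd d by (cases "ds = []") auto
qed simp

lemma turn_cost_parity:
  "ds \<noteq> [] \<Longrightarrow> even (turn_cost ds) \<longleftrightarrow> fst (hd ds) \<noteq> fst (last ds)"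
  unfolding turn_cost_def by (rule runs_cost_parity)

lemma runs_cost_le:
  assumes "\<forall>d \<in> set ds. snd d \<le> 1" "1 \<le> k" "x \<le> of_int k"
  shows "runs_cost s x ds \<le> 2 * (k + int (length ds)) - (if \<exists>d \<in> set ds. fst d \<noteq> s then 2 else 1)"
  using assms
proof (induction ds arbitrary: s x k)
  case Nil
  then have "\<lceil>x\<rceil> \<le> k" by (simp add: ceiling_le_iff)
  then show ?case using Nil by (simp add: run_cost_def)
next
  case (Cons d ds)
  obtain t y where d: "d = (t, y)" by force
  have y: "y \<le> 1" using Cons.prems d by simp
  show ?case
  proof (cases "s = t")
    case True
    then show ?thesis
      using Cons.IH[of "k + 1" "x + y" s] Cons.prems d by auto
  next
    case False
    have "run_cost x \<le> 2 * k - 1"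
      unfolding run_cost_def using Cons.prems ceiling_mono[of x "of_int k"] by simp
    moreover have "runs_cost t y ds \<le> 2 * (1 + int (length ds)) - 1"
      using Cons.IH[of 1 y t] Cons.prems y by (auto split: if_splits)
    ultimately show ?thesis
      using False d by simp
  qed
qed

text \<open>
  A single run of \<open>k\<close> turns costs at most \<open>2 * k - 1\<close>, so each further run saves one.
\<close>
lemma turn_cost_le:
  assumes "\<forall>d \<in> set ds. snd d \<le> 1" "d \<in> set ds" "fst d \<noteq> fst (hd ds)"
  shows "turn_cost ds \<le> 2 * int (length ds) - 2"
proof (cases ds)
  case (Cons e es)
  then have "\<exists>d \<in> set es. fst d \<noteq> fst e" using assms by auto
  then have "runs_cost (fst e) (snd e) es \<le> 2 * (1 + int (length es)) - 2"
    using assms runs_cost_le[of es 1 "snd e" "fst e"] Cons by auto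
  then show ?thesis
    using Cons unfolding turn_cost_def by (cases e) auto
qed (use assms in simp)

lemma turn_cost_ge_1: "1 \<le> turn_cost ds"
proof -
  have "1 \<le> runs_cost s x ds" for s x
  proof (induction ds arbitrary: s x)
    case Nil
    then show ?case by (simp add: run_cost_ge_1)
  next
    case (Cons d ds)
    have "0 \<le> run_cost x" using run_cost_ge_1[of x] by linarith
    then show ?case using Cons[of s] Cons[of "fst d" "snd d"] by (cases d) (auto intro: add_increasing)
  qed
  then show ?thesis unfolding turn_cost_def .
qed

section \<open>Turns of planar polygons\<close>

definition rot :: "bool \<Rightarrow> real \<Rightarrow> complex" where
  "rot s x = cis (if s then pi * x else - (pi * x))"

lemma norm_rot [simp]: "norm (rot s x) = 1"
  unfolding rot_def by simp

lemma rot_compose_turns: "rot (fst (compose_turns (s, x) (t, y))) (snd (compose_turns (s, x) (t, y))) = rot s x * rot t y"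
proof -
  have "cis (2 * pi - a) = cis (- a)" "cis (a - 2 * pi) = cis a" for a
    by (simp_all add: complex_eq_iff cos_diff sin_diff)
  from this(1)[of "pi * x + pi * y"] this(2)[of "pi * x + pi * y"] show ?thesis
    by (auto simp: rot_def cis_mult algebra_simps)
qed

text \<open>
  The sum lies in the convex cone spanned by 1 and \<open>rot s x\<close>.
\<close>
lemma cone_rotation:
  assumes "0 \<le> r" "0 \<le> q" "0 \<le> x" "x \<le> 1"
  shows "\<exists>y. 0 \<le> y \<and> y \<le> x \<and> of_real r + of_real q * rot s x = of_real (norm (of_real r + of_real q * rot s x)) * rot s y"
proof -
  have True: "\<exists>y. 0 \<le> y \<and> y \<le> x \<and> of_real r + of_real q * cis (pi * x) = of_real (norm (of_real r + of_real q * cis (pi * x))) * cis (pi * y)"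
  proof -
    define z where "z = of_real r + of_real q * cis (pi * x)"
    have x: "0 \<le> pi * x" "pi * x \<le> pi" using assms by (auto simp: mult_left_le)
    have Im: "Im z = q * sin (pi * x)" "0 \<le> Im z"
      using assms x by (auto simp: z_def sin_ge_zero)
    have A: "0 \<le> Arg z" "Arg z \<le> pi" and zA: "z = of_real (norm z) * cis (Arg z)"
      using Im(2) Arg_bounded[of z] Arg_less_0[of z] by (auto simp: rcis_cmod_Arg[unfolded rcis_def])
    consider "z = 0" | "r = 0" | "x = 0" | "x = 1" | "z \<noteq> 0" "r > 0" "0 < x" "x < 1" using assms by linarith
    then have "\<exists>y. 0 \<le> y \<and> y \<le> x \<and> z = of_real (norm z) * cis (pi * y)"
    proof cases
      case 1
      then show ?thesis using assms by (intro exI[of _ x]) auto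
    next
      case 2
      then show ?thesis using assms by (intro exI[of _ x]) (auto simp: z_def norm_mult)
    next
      case 3
      then have "z = of_real (r + q)" by (simp add: z_def)
      then show ?thesis using assms 3 by (intro exI[of _ 0]) (auto simp del: of_real_add)
    next
      case 4
      then show ?thesis using A zA by (intro exI[of _ "Arg z / pi"]) auto
    next
      case 5
      have "Im (cis (pi * x) * cnj z) = r * sin (pi * x)"
        by (simp add: z_def algebra_simps)
      also have "Im (cis (pi * x) * cnj z) = norm z * sin (pi * x - Arg z)"
        by (subst zA) (simp add: sin_diff algebra_simps)
      finally have "norm z * sin (pi * x - Arg z) = r * sin (pi * x)" .
      moreover have "0 < sin (pi * x)" using 5 by (intro sin_gt_zero) auto
      ultimately have "0 < norm z * sin (pi * x - Arg z)" using 5 by simp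
      then have pos: "0 < sin (pi * x - Arg z)" using 5 by (simp add: zero_less_mult_iff)
      have "\<not> pi * x < Arg z"
      proof
        assume *: "pi * x < Arg z"
        have "0 < pi * x" using 5 by simp
        then have "0 \<le> sin (Arg z - pi * x)" using A * by (intro sin_ge_zero) linarith+
        then show False using pos sin_minus[of "Arg z - pi * x"] by simp
      qed
      then show ?thesis using A zA by (intro exI[of _ "Arg z / pi"]) (auto simp: field_simps)
    qed
    then show ?thesis unfolding z_def .
  qed
  show ?thesis
  proof (cases s)
    case s: True
    then show ?thesis using True unfolding rot_def by simp
  next
    case False
    obtain y where y: "0 \<le> y" "y \<le> x" "of_real r + of_real q * cis (pi * x) = of_real (norm (of_real r + of_real q * cis (pi * x))) * cis (pi * y)"
      using True by blast
    have e: "of_real r + of_real q * cis (- (pi * x)) = cnj (of_real r + of_real q * cis (pi * x))"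
      by (simp add: cis_cnj)
    have "cnj (of_real r + of_real q * cis (pi * x)) = of_real (norm (cnj (of_real r + of_real q * cis (pi * x)))) * cis (- (pi * y))"
      by (subst y(3)) (simp add: cis_cnj del: complex_cnj_add)
    then show ?thesis using y(1,2) False unfolding rot_def by (auto simp only: if_False e[symmetric])
  qed
qed

text \<open>
  The predicate relates a polygon to the turns between its successive vertices, seen from the origin. The
  unit vector \<open>D\<close> is a direction of the first vertex. Directions are carried along because vertices may
  vanish; for this reason, and because a turn by \<open>pi\<close> can have either sense, a polygon has several turn lists.
\<close>
fun turning :: "complex \<Rightarrow> complex list \<Rightarrow> (bool \<times> real) list \<Rightarrow> bool" where
  "turning D [v] [] \<longleftrightarrow> norm D = 1 \<and> v = of_real (norm v) * D"
| "turning D (v # w # vs) ((s, x) # ds) \<longleftrightarrow>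
     norm D = 1 \<and> v = of_real (norm v) * D \<and> 0 \<le> x \<and> x \<le> 1 \<and> turning (D * rot s x) (w # vs) ds"
| "turning _ _ _ \<longleftrightarrow> False"

text \<open>
  One vertex moves towards its successor.
\<close>
inductive push :: "complex list \<Rightarrow> complex list \<Rightarrow> bool" where
  push_hd: "0 \<le> a \<Longrightarrow> push (v # w # vs) ((v + of_real a * w) # w # vs)"
| push_tl: "push vs ws \<Longrightarrow> push (v # vs) (v # ws)"

lemma turning_nonneg: "turning D vs ds \<Longrightarrow> d \<in> set ds \<Longrightarrow> 0 \<le> snd d \<and> snd d \<le> 1"
  by (induction D vs ds rule: turning.induct) auto

lemma turning_length: "turning D vs ds \<Longrightarrow> length vs = Suc (length ds)"
  by (induction D vs ds rule: turning.induct) auto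

lemma turning_hd: "turning D (v # vs) ds \<Longrightarrow> norm D = 1 \<and> v = of_real (norm v) * D"
  by (cases ds; cases vs) auto

lemma turning_push_hd:
  assumes "turning D (v # w # vs) ((s, x) # ds)" "0 \<le> a"
  shows "\<exists>y. 0 \<le> y \<and> y \<le> x \<and> turning (D * rot s y) ((v + of_real a * w) # w # vs) ((s, x - y) # ds)"
proof -
  have D: "norm D = 1" "v = of_real (norm v) * D" "0 \<le> x" "x \<le> 1"
    and tl: "turning (D * rot s x) (w # vs) ds"
    using assms by auto
  have w: "w = of_real (norm w) * (D * rot s x)"
    using turning_hd[OF tl] by simp
  let ?z = "of_real (norm v) + of_real (a * norm w) * rot s x"
  obtain y where y: "0 \<le> y" "y \<le> x" "?z = of_real (norm ?z) * rot s y"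
    using cone_rotation[of "norm v" "a * norm w" x s] D assms(2) by auto
  have z: "v + of_real a * w = D * ?z"
    by (subst D(2), subst w) (simp add: algebra_simps)
  have "v + of_real a * w = of_real (norm (v + of_real a * w)) * (D * rot s y)"
    unfolding z using D(1) y(3) by (metis (no_types, lifting) mult.left_commute mult.left_neutral norm_mult)
  moreover have "D * rot s y * rot s (x - y) = D * rot s x"
    by (auto simp: rot_def cis_mult algebra_simps)
  ultimately show ?thesis
    using y D tl by (intro exI[of _ y] conjI) (simp_all only: turning.simps, simp_all add: norm_mult)
qed

text \<open>
  A vertex other than the first exchanges angle between the turns on its two sides. The estimate is stated for
  all accumulators, so that it persists when turns are prepended.
\<close>
lemma turning_push_tl:
  assumes "push vs ws" "turning D (v # vs) ds"
  shows "\<exists>es. turning D (v # ws) es \<and> fst (last es) = fst (last ds) \<and>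
    (\<forall>s x. 0 \<le> x \<longrightarrow> runs_cost s x es \<le> runs_cost s x ds)"
  using assms
proof (induction vs ws arbitrary: D v ds rule: push.induct)
  case (push_hd a v1 w vs)
  obtain s1 x1 s2 x2 r where ds: "ds = (s1, x1) # (s2, x2) # r"
    using push_hd.prems by (cases ds; cases "tl ds"; cases "hd ds"; cases "hd (tl ds)") auto
  have D: "norm D = 1" "v = of_real (norm v) * D" "0 \<le> x1" "x1 \<le> 1"
    and tl: "turning (D * rot s1 x1) (v1 # w # vs) ((s2, x2) # r)"
    using push_hd.prems unfolding ds by auto
  obtain y where y: "0 \<le> y" "y \<le> x2" and
    t: "turning (D * rot s1 x1 * rot s2 y) ((v1 + of_real a * w) # w # vs) ((s2, x2 - y) # r)"
    using turning_push_hd[OF tl push_hd.hyps] by blast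
  obtain s' x' where c: "compose_turns (s1, x1) (s2, y) = (s', x')" by force
  have x2: "x2 \<le> 1" using tl by auto
  have x': "0 \<le> x'" "x' \<le> 1"
    using c D y x2 by (auto split: if_splits)
  have "turning D (v # (v1 + of_real a * w) # w # vs) ((s', x') # (s2, x2 - y) # r)"
    using t D x' rot_compose_turns[of s1 x1 s2 y] c by (simp add: mult.assoc)
  moreover have "runs_cost s x ((s', x') # (s2, x2 - y) # r) \<le> runs_cost s x ds" if "0 \<le> x" for s x
    unfolding ds c[symmetric] using that D y x2 turning_nonneg[OF tl]
    by (intro runs_cost_compose_turns) auto
  ultimately show ?case
    unfolding ds by (intro exI[of _ "(s', x') # (s2, x2 - y) # r"]) auto
next
  case (push_tl vs ws v1)
  obtain s1 x1 r where ds: "ds = (s1, x1) # r"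
    using push_tl.prems by (cases ds; cases "hd ds") auto
  have D: "norm D = 1" "v = of_real (norm v) * D" "0 \<le> x1" "x1 \<le> 1"
    and tl: "turning (D * rot s1 x1) (v1 # vs) r"
    using push_tl.prems unfolding ds by auto
  obtain es where es: "turning (D * rot s1 x1) (v1 # ws) es" "fst (last es) = fst (last r)"
    "\<And>s x. 0 \<le> x \<Longrightarrow> runs_cost s x es \<le> runs_cost s x r"
    using push_tl.IH[OF tl] by blast
  have "vs \<noteq> []" "ws \<noteq> []" using push_tl.hyps by (auto elim: push.cases)
  then have ne: "r \<noteq> []" "es \<noteq> []"
    using turning_length[OF tl] turning_length[OF es(1)] by auto
  show ?case
    unfolding ds using D es ne
    by (intro exI[of _ "(s1, x1) # es"]) auto
qed

lemma turning_push:
  assumes "push vs ws" "turning D vs ds"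
  shows "\<exists>D' es. turning D' ws es \<and> fst (last es) = fst (last ds) \<and> turn_cost es \<le> turn_cost ds"
  using assms(1)
proof cases
  case (push_hd a v w us)
  obtain s x r where ds: "ds = (s, x) # r"
    using assms(2) push_hd by (cases ds; cases "hd ds") auto
  obtain y where y: "0 \<le> y" "y \<le> x" "turning (D * rot s y) ws ((s, x - y) # r)"
    using turning_push_hd[of D v w us s x r a] assms(2) push_hd ds by auto
  have "turn_cost ((s, x - y) # r) \<le> turn_cost ds"
    using runs_cost_mono[of r "x - y" x s] turning_nonneg[OF y(3)] y(1) unfolding ds turn_cost_def by auto
  then show ?thesis
    using y(3) unfolding ds by (intro exI[of _ "D * rot s y"] exI[of _ "(s, x - y) # r"]) auto
next
  case (push_tl vs' ws' v)
  obtain es where es: "turning D ws es" "fst (last es) = fst (last ds)"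
    "\<And>s x. 0 \<le> x \<Longrightarrow> runs_cost s x es \<le> runs_cost s x ds"
    using turning_push_tl[of vs' ws' D v ds] push_tl assms(2) by auto
  have "vs' \<noteq> []" using push_tl by (auto elim: push.cases)
  then have "ds \<noteq> []" using turning_length[OF assms(2)] push_tl by auto
  then show ?thesis
    using es by (intro exI[of _ D] exI[of _ es]) (auto intro!: turn_cost_mono)
qed

lemma turning_pushes:
  assumes "push\<^sup>*\<^sup>* vs ws" "turning D vs ds"
  shows "\<exists>D' es. turning D' ws es \<and> fst (last es) = fst (last ds) \<and> turn_cost es \<le> turn_cost ds"
  using assms
proof (induction rule: rtranclp_induct)
  case base
  then show ?case by blast
next
  case (step ws us)
  then show ?case using turning_push[of ws us] by (metis order.trans)
qed

abbreviation det2 :: "complex \<Rightarrow> complex \<Rightarrow> real" where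
  "det2 v w \<equiv> Im (cnj v * w)"

lemma turning_det:
  assumes "turning D (v # w # vs) ds" "det2 v w \<noteq> 0"
  shows "fst (hd ds) \<longleftrightarrow> 0 < det2 v w"
proof -
  obtain s x r where ds: "ds = (s, x) # r"
    using assms(1) by (cases ds; cases "hd ds") auto
  have D: "norm D = 1" and v: "v = of_real (norm v) * D" and x: "0 \<le> x" "x \<le> 1"
    and tl: "turning (D * rot s x) (w # vs) r"
    using assms unfolding ds by auto
  have w: "w = of_real (norm w) * (D * rot s x)"
    using turning_hd[OF tl] by simp
  have "cnj v * w = of_real (norm v * norm w) * ((cnj D * D) * rot s x)"
    by (subst v, subst w) (simp add: algebra_simps)
  also have "cnj D * D = 1" using D complex_norm_square[of D] by (simp add: mult.commute)
  finally have "det2 v w = (if s then norm v * norm w * sin (pi * x) else - (norm v * norm w * sin (pi * x)))"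
    by (simp add: rot_def)
  moreover have "0 \<le> norm v * norm w * sin (pi * x)"
    using x by (intro mult_nonneg_nonneg sin_ge_zero) (auto simp: mult_left_le)
  ultimately obtain p where "det2 v w = (if s then p else - p)" "0 \<le> p"
    by blast
  then show ?thesis
    using assms(2) unfolding ds by (cases s) auto
qed

text \<open>
  Along pushes the cost does not increase and the sense of the last turn is preserved, while the sense of
  the first turn is the sign of \<open>det2 v w\<close>. If that sign changes, then so does the parity of the
  cost, which therefore drops by at least one.
\<close>
lemma turn_cost_drop:
  assumes "push\<^sup>*\<^sup>* (v # w # vs) (v' # w' # vs')" "det2 v w * det2 v' w' < 0"
    and "turning D (v # w # vs) ds"
    and "\<And>D es. turning D (v' # w' # vs') es \<Longrightarrow> c \<le> turn_cost es"
  shows "c + 1 \<le> turn_cost ds"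
proof -
  obtain D' es where es: "turning D' (v' # w' # vs') es" "fst (last es) = fst (last ds)" "turn_cost es \<le> turn_cost ds"
    using turning_pushes[OF assms(1,3)] by blast
  have ne: "ds \<noteq> []" "es \<noteq> []"
    using turning_length[OF assms(3)] turning_length[OF es(1)] by auto
  have "fst (hd ds) \<noteq> fst (hd es)"
    using turning_det[OF assms(3)] turning_det[OF es(1)] assms(2)
    by (auto simp: mult_less_0_iff)
  then have "even (turn_cost ds) \<noteq> even (turn_cost es)"
    using turn_cost_parity[OF ne(1)] turn_cost_parity[OF ne(2)] es(2) by auto
  then have "turn_cost es \<noteq> turn_cost ds" by auto
  then show ?thesis using es(3) assms(4)[OF es(1)] by linarith
qed

lemma exists_direction: "\<exists>D. norm D = 1 \<and> v = of_real (norm v) * D" for v :: complex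
  by (intro exI[of _ "cis (Arg v)"]) (simp add: rcis_cmod_Arg[unfolded rcis_def])

lemma exists_rot:
  assumes "norm D = 1" "norm E = 1"
  shows "\<exists>s x. 0 \<le> x \<and> x \<le> 1 \<and> E = D * rot s x"
proof -
  define a where "a = Arg (E / D)"
  have "norm (E / D) = 1" using assms by (simp add: norm_divide)
  then have ED: "E / D = cis a"
    using rcis_cmod_Arg[of "E / D"] unfolding a_def rcis_def by simp
  have "D \<noteq> 0" using assms by auto
  then have "E = D * cis a" using ED by (simp add: field_simps)
  moreover have "cis a = rot (0 \<le> a) (\<bar>a\<bar> / pi)" by (auto simp: rot_def)
  moreover have "\<bar>a\<bar> \<le> pi" using Arg_bounded[of "E / D"] unfolding a_def by linarith
  ultimately show ?thesis by (intro exI[of _ "0 \<le> a"] exI[of _ "\<bar>a\<bar> / pi"]) auto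
qed

text \<open>
  The last two vertices are parallel, so the last turn is by 0 or by \<open>pi\<close> and its sense is at our disposal: it is
  chosen opposite to the sense of the turn before it.
\<close>
lemma turning_exists_mixed:
  assumes "2 \<le> length vs" "norm D = 1" "v = of_real (norm v) * D"
    and "det2 (last (butlast vs)) (last vs) = 0"
  shows "\<exists>ds. turning D (v # vs) ds \<and> (\<exists>d \<in> set ds. fst d \<noteq> fst (hd ds))"
  using assms
proof (induction vs arbitrary: D v)
  case (Cons w ws)
  show ?case
  proof (cases "2 \<le> length ws")
    case True
    obtain E where E: "norm E = 1" "w = of_real (norm w) * E" using exists_direction by blast
    obtain s x where sx: "0 \<le> x" "x \<le> 1" "E = D * rot s x" using exists_rot[OF Cons.prems(2) E(1)] by blast
    have "ws \<noteq> []" "butlast ws \<noteq> []" using True by (cases ws; cases "tl ws"; auto)+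
    then obtain ds where ds: "turning E (w # ws) ds" "\<exists>d \<in> set ds. fst d \<noteq> fst (hd ds)"
      using Cons.IH[OF True E] Cons.prems by auto
    then show ?thesis
      using sx Cons.prems by (intro exI[of _ "(s, x) # ds"]) (cases ds; auto)
  next
    case False
    then obtain u where ws: "ws = [u]" using Cons.prems(1) by (cases ws; cases "tl ws") auto
    have det: "det2 w u = 0" using Cons.prems(4) ws by simp
    have "\<exists>E y. norm E = 1 \<and> w = of_real (norm w) * E \<and> 0 \<le> y \<and> y \<le> 1 \<and> (\<forall>t. u = of_real (norm u) * (E * rot t y))"
    proof (cases "w = 0")
      case True
      obtain E where "norm E = 1" "u = of_real (norm u) * E" using exists_direction by blast
      then show ?thesis using True by (intro exI[of _ E] exI[of _ 0]) (auto simp: rot_def)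
    next
      case False
      obtain E where E: "norm E = 1" "w = of_real (norm w) * E" using exists_direction by blast
      have EE: "E * cnj E = 1" using E(1) complex_norm_square[of E] by simp
      have "Im (cnj E * u) = 0"
        using det False by (subst (asm) E(2)) (simp add: algebra_simps)
      then obtain r where r: "cnj E * u = of_real r"
        by (metis complex_is_Real_iff Reals_cases)
      then have "E * cnj E * u = of_real r * E" by (simp add: mult.assoc)
      then have u: "u = of_real r * E" using EE by simp
      then have nu: "norm u = \<bar>r\<bar>" using E(1) by (simp add: norm_mult)
      show ?thesis
      proof (cases "0 \<le> r")
        case True
        then show ?thesis using E u nu by (intro exI[of _ E] exI[of _ 0]) (auto simp: rot_def)
      next
        case False
        have "cis (- pi) = - 1" by (simp add: complex_eq_iff)
        then show ?thesis using E u nu False by (intro exI[of _ E] exI[of _ 1]) (auto simp: rot_def)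
      qed
    qed
    then obtain E y where E: "norm E = 1" "w = of_real (norm w) * E" "0 \<le> y" "y \<le> 1"
      "\<And>t. u = of_real (norm u) * (E * rot t y)" by blast
    obtain s x where sx: "0 \<le> x" "x \<le> 1" "E = D * rot s x" using exists_rot[OF Cons.prems(2) E(1)] by blast
    have "turning D (v # w # [u]) [(s, x), (\<not> s, y)]"
      using sx E(1-4) E(5)[of "\<not> s"] Cons.prems by (simp add: norm_mult)
    then show ?thesis
      unfolding ws by (intro exI[of _ "[(s, x), (\<not> s, y)]"]) auto
  qed
qed simp

lemma turning_exists_le:
  assumes "3 \<le> length vs" "det2 (last (butlast vs)) (last vs) = 0"
  shows "\<exists>D ds. turning D vs ds \<and> turn_cost ds \<le> 2 * int (length vs) - 4"
proof -
  obtain v us where vs: "vs = v # us" using assms(1) by (cases vs) auto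
  have us: "2 \<le> length us" "us \<noteq> []" "butlast us \<noteq> []"
    using assms(1) vs by (cases us; cases "tl us"; auto)+
  obtain D where D: "norm D = 1" "v = of_real (norm v) * D" using exists_direction by blast
  obtain ds d where ds: "turning D vs ds" "d \<in> set ds" "fst d \<noteq> fst (hd ds)"
    using turning_exists_mixed[OF us(1) D] assms(2) us unfolding vs by auto
  have "turn_cost ds \<le> 2 * int (length ds) - 2"
    using turning_nonneg[OF ds(1)] ds(2,3) by (intro turn_cost_le[of _ d]) auto
  then show ?thesis using ds(1) turning_length[OF ds(1)] by auto
qed

section \<open>Chains of functions and Euler's method\<close>

text \<open>
  If all \<open>\<beta> j\<close> are 1, then \<open>x 0\<close> is a polynomial of degree at most \<open>m\<close> and \<open>x j\<close> is its derivative of order \<open>j\<close>.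
  Nonvanishing factors \<open>\<beta> j\<close> preserve what matters about zeros: Rolle's theorem still passes from \<open>x j\<close> to \<open>x (Suc j)\<close>.
\<close>
definition chain :: "nat \<Rightarrow> (nat \<Rightarrow> real \<Rightarrow> real) \<Rightarrow> (nat \<Rightarrow> real \<Rightarrow> 'a::real_normed_vector) \<Rightarrow> real set \<Rightarrow> bool" where
  "chain m \<beta> x S \<longleftrightarrow>
     (\<forall>j<m. continuous_on S (\<beta> j)) \<and>
     (\<forall>j<m. \<forall>t\<in>S. \<beta> j t \<noteq> 0 \<and> (x j has_vector_derivative \<beta> j t *\<^sub>R x (Suc j) t) (at t within S)) \<and>
     (\<exists>c. \<forall>t\<in>S. x m t = c)"

definition positive_chain :: "nat \<Rightarrow> (nat \<Rightarrow> real \<Rightarrow> real) \<Rightarrow> (nat \<Rightarrow> real \<Rightarrow> 'a::real_normed_vector) \<Rightarrow> real set \<Rightarrow> bool" where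
  "positive_chain m \<beta> x S \<longleftrightarrow> chain m \<beta> x S \<and> (\<forall>j<m. \<forall>t\<in>S. 0 < \<beta> j t)"

lemma chain_subset: "chain m \<beta> x S \<Longrightarrow> S' \<subseteq> S \<Longrightarrow> chain m \<beta> x S'"
  unfolding chain_def by (meson continuous_on_subset has_vector_derivative_within_subset subset_iff)

lemma positive_chain_subset: "positive_chain m \<beta> x S \<Longrightarrow> S' \<subseteq> S \<Longrightarrow> positive_chain m \<beta> x S'"
  unfolding positive_chain_def using chain_subset by blast

lemma chain_continuous_on: "chain m \<beta> x S \<Longrightarrow> j \<le> m \<Longrightarrow> continuous_on S (x j)"
proof (cases "j < m")
  case True
  then show "chain m \<beta> x S \<Longrightarrow> ?thesis"
    unfolding chain_def continuous_on_eq_continuous_within[of S "x j"]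
    by (blast intro: has_vector_derivative_continuous)
next
  case False
  assume "chain m \<beta> x S" "j \<le> m"
  then obtain c where "\<forall>t\<in>S. x j t = c" using False unfolding chain_def by (metis le_neq_implies_less)
  then show ?thesis by (metis continuous_on_cong continuous_on_const)
qed

lemma push_tl_rtranclp: "push\<^sup>*\<^sup>* vs ws \<Longrightarrow> push\<^sup>*\<^sup>* (v # vs) (v # ws)"
  by (induction rule: rtranclp_induct) (auto intro: push_tl rtranclp.rtrancl_into_rtrancl)

text \<open>
  Pushing the vertices in increasing order moves each of them by the old value of its successor. The
  result is a simultaneous step of Euler's method.
\<close>
lemma push_all:
  assumes "\<And>j. j < m \<Longrightarrow> 0 \<le> a j"
  shows "push\<^sup>*\<^sup>* (map y [0..<Suc m]) (map (\<lambda>j. if j < m then y j + of_real (a j) * y (Suc j) else y j) [0..<Suc m])"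
  using assms
proof (induction m arbitrary: a y)
  case 0
  then show ?case by simp
next
  case (Suc m)
  have eq: "map f [0..<Suc (Suc k)] = f 0 # map (f \<circ> Suc) [0..<Suc k]" for f :: "nat \<Rightarrow> complex" and k
    by (simp only: upt_conv_Cons[of 0 "Suc (Suc k)"] zero_less_Suc if_True list.map map_Suc_upt[symmetric] map_map)
  have hd: "map f [0..<Suc k] = f 0 # map f [1..<Suc k]" for f :: "nat \<Rightarrow> complex" and k
    by (simp add: upt_conv_Cons del: upt_Suc)
  let ?f = "\<lambda>j. if j < Suc m then y j + of_real (a j) * y (Suc j) else y j"
  have "push (y 0 # map (y \<circ> Suc) [0..<Suc m]) ((y 0 + of_real (a 0) * y (Suc 0)) # map (y \<circ> Suc) [0..<Suc m])"
    unfolding hd using push_hd[of "a 0" "y 0" "(y \<circ> Suc) 0"] Suc.prems[of 0] by simp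
  moreover have "push\<^sup>*\<^sup>* (map (y \<circ> Suc) [0..<Suc m]) (map (?f \<circ> Suc) [0..<Suc m])"
    using Suc.IH[of "a \<circ> Suc" "y \<circ> Suc"] Suc.prems unfolding comp_def by (simp del: upt_Suc)
  ultimately have "push\<^sup>*\<^sup>* (y 0 # map (y \<circ> Suc) [0..<Suc m]) (?f 0 # map (?f \<circ> Suc) [0..<Suc m])"
    using converse_rtranclp_into_rtranclp[OF _ push_tl_rtranclp] by simp
  then show ?case by (simp only: eq)
qed

lemma linearization_bound:
  fixes f :: "real \<Rightarrow> 'a::real_normed_vector"
  assumes f: "\<And>u. u \<in> {s..t} \<Longrightarrow> (f has_vector_derivative f' u) (at u within {s..t})"
    and d: "\<forall>u\<in>{s..t}. \<forall>v\<in>{s..t}. dist v u < d \<longrightarrow> dist (f' v) (f' u) < e"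
    and u: "u \<in> {s..t}" "u + h \<in> {s..t}" "0 \<le> h" "h < d"
  shows "norm (f (u + h) - f u - h *\<^sub>R f' u) \<le> e * h"
proof -
  have 1: "(f has_vector_derivative f' x) (at x within {u..u + h})" if "x \<in> {u..u + h}" for x
    using that u by (intro has_vector_derivative_within_subset[OF f]) simp_all
  have 2: "norm (f' x - f' u) \<le> e" if "x \<in> {u..u + h}" for x
  proof -
    have "dist (f' x) (f' u) < e" using that u by (intro d[rule_format]) (simp_all add: dist_real_def)
    then show ?thesis by (simp add: dist_norm)
  qed
  have 3: "closed_segment u (u + h) \<subseteq> {u..u + h}" using u by (simp add: closed_segment_eq_real_ivl)
  have "norm (f (u + h) - f u - (u + h - u) *\<^sub>R f' u) \<le> norm (u + h - u) * e"
    by (rule vector_differentiable_bound_linearization[OF 1 3 2]) (use u in simp_all)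
  then show ?thesis using u by (simp add: mult.commute)
qed

lemma uniform_linearization:
  fixes f :: "real \<Rightarrow> 'a::real_normed_vector"
  assumes "\<And>u. u \<in> {s..t} \<Longrightarrow> (f has_vector_derivative f' u) (at u within {s..t})"
    and "continuous_on {s..t} f'" "0 < e"
  shows "\<exists>d>0. \<forall>u h. u \<in> {s..t} \<longrightarrow> u + h \<in> {s..t} \<longrightarrow> 0 \<le> h \<longrightarrow> h < d \<longrightarrow> norm (f (u + h) - f u - h *\<^sub>R f' u) \<le> e * h"
proof -
  have "uniformly_continuous_on {s..t} f'"
    using assms(2) by (intro compact_uniformly_continuous) simp_all
  from this[unfolded uniformly_continuous_on_def, rule_format, OF assms(3)]
  obtain d where d: "d > 0" "\<forall>u\<in>{s..t}. \<forall>v\<in>{s..t}. dist v u < d \<longrightarrow> dist (f' v) (f' u) < e"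
    by (elim exE conjE)
  show ?thesis
    by (intro exI[of _ d] conjI allI impI d(1) linearization_bound[OF assms(1) d(2)])
qed

lemma exists_steps: "0 < d \<Longrightarrow> \<exists>N>0. (L::real) / real N < d"
proof -
  assume d: "0 < d"
  obtain N :: nat where N: "max 1 (L / d) < real N" using reals_Archimedean2 by blast
  then have "0 < real N" "L < real N * d" using d by (auto simp: pos_divide_less_eq)
  then have "0 < N" "L / real N < d" by (simp_all add: pos_divide_less_eq mult.commute)
  then show ?thesis by blast
qed

text \<open>
  Euler's method for the system \<open>x j' = \<beta> j * x (Suc j)\<close> consists of pushes, because the \<open>\<beta> j\<close> are positive.
  The initial values range over a neighbourhood of the exact ones so that such approximations can be concatenated.
\<close>
lemma chain_push:
  fixes x :: "nat \<Rightarrow> real \<Rightarrow> complex"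
  assumes "positive_chain m \<beta> x {s..t}" "s \<le> t" "0 < \<epsilon>"
  shows "\<exists>\<eta>>0. \<forall>y. (\<forall>j\<le>m. norm (y j - x j s) < \<eta>) \<longrightarrow>
    (\<exists>z. push\<^sup>*\<^sup>* (map y [0..<Suc m]) (map z [0..<Suc m]) \<and> (\<forall>j\<le>m. norm (z j - x j t) < \<epsilon>))"
proof -
  note ch = assms(1)[unfolded positive_chain_def chain_def]
  have "\<exists>B. \<forall>u\<in>{s..t}. \<beta> j u \<le> B" if "j < m" for j
  proof -
    have "continuous_on {s..t} (\<beta> j)" using ch that by blast
    then show ?thesis
      using continuous_attains_sup[of "{s..t}" "\<beta> j"] assms(2) by auto
  qed
  then obtain b where b: "\<And>j u. j < m \<Longrightarrow> u \<in> {s..t} \<Longrightarrow> \<beta> j u \<le> b j" by metis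
  define B where "B = (\<Sum>j<m. \<bar>b j\<bar>)"
  have B0: "0 \<le> B" unfolding B_def by (simp add: sum_nonneg)
  have B: "\<beta> j u \<le> B" if "j < m" "u \<in> {s..t}" for j u
    using b[OF that] member_le_sum[of j "{..<m}" "\<lambda>j. \<bar>b j\<bar>"] that unfolding B_def by auto
  define L where "L = t - s"
  have L0: "0 \<le> L" unfolding L_def using assms by simp
  \<comment> \<open>An error of \<eta> initially and of \<eta> per unit of time in the steps grows by a factor of at most \<open>exp (B * L)\<close> up to time \<open>t\<close>.\<close>
  define \<eta> where "\<eta> = \<epsilon> / (2 * (exp (B * L) * (1 + L)))"
  have \<eta>: "0 < \<eta>" "exp (B * L) * (\<eta> + L * \<eta>) < \<epsilon>"
  proof -
    have p: "0 < exp (B * L) * (1 + L)" using L0 by simp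
    then show "0 < \<eta>" unfolding \<eta>_def using assms by simp
    have "exp (B * L) * (\<eta> + L * \<eta>) = (exp (B * L) * (1 + L)) * \<eta>" by (simp add: algebra_simps)
    also have "\<dots> = \<epsilon> / 2" unfolding \<eta>_def using p by (simp add: field_simps)
    finally show "exp (B * L) * (\<eta> + L * \<eta>) < \<epsilon>" using assms by simp
  qed
  have "\<exists>d>0. \<forall>u h. u \<in> {s..t} \<longrightarrow> u + h \<in> {s..t} \<longrightarrow> 0 \<le> h \<longrightarrow> h < d \<longrightarrow>
      norm (x j (u + h) - x j u - h *\<^sub>R (\<beta> j u *\<^sub>R x (Suc j) u)) \<le> \<eta> * h" if "j < m" for j
    using ch that chain_continuous_on[of m \<beta> x "{s..t}" "Suc j"] assms(1) \<eta>(1) unfolding positive_chain_def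
    by (intro uniform_linearization continuous_intros) auto
  then obtain d where d: "\<And>j. j < m \<Longrightarrow> 0 < d j" "\<And>j u h. j < m \<Longrightarrow> u \<in> {s..t} \<Longrightarrow> u + h \<in> {s..t} \<Longrightarrow> 0 \<le> h \<Longrightarrow> h < d j \<Longrightarrow>
      norm (x j (u + h) - x j u - h *\<^sub>R (\<beta> j u *\<^sub>R x (Suc j) u)) \<le> \<eta> * h"
    by metis
  define d0 where "d0 = Min (insert 1 (d ` {..<m}))"
  have d0: "0 < d0" "\<And>j. j < m \<Longrightarrow> d0 \<le> d j" unfolding d0_def using d(1) by auto
  obtain N :: nat where N: "N > 0" "L / real N < d0" using exists_steps[OF d0(1)] by blast
  define h where "h = L / real N"
  have h: "0 \<le> h" "real N * h = L" "h < d0" unfolding h_def using L0 N by auto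
  have main: "\<exists>z. push\<^sup>*\<^sup>* (map y [0..<Suc m]) (map z [0..<Suc m]) \<and>
      (\<forall>j\<le>m. norm (z j - x j (s + real k * h)) \<le> (1 + h * B) ^ k * (\<eta> + real k * h * \<eta>))"
    if y: "\<forall>j\<le>m. norm (y j - x j s) < \<eta>" and "k \<le> N" for y k
    using \<open>k \<le> N\<close>
  proof (induction k)
    case 0
    then show ?case using y by (intro exI[of _ y]) (auto simp: less_imp_le)
  next
    case (Suc k)
    let ?u = "s + real k * h"
    let ?E = "(1 + h * B) ^ k * (\<eta> + real k * h * \<eta>)"
    obtain z where z: "push\<^sup>*\<^sup>* (map y [0..<Suc m]) (map z [0..<Suc m])"
      "\<And>j. j \<le> m \<Longrightarrow> norm (z j - x j ?u) \<le> ?E"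
      using Suc by auto
    have "real (Suc k) * h \<le> real N * h" using Suc.prems h by (intro mult_right_mono) auto
    then have u: "?u \<in> {s..t}" "?u + h \<in> {s..t}" using h unfolding L_def by (auto simp: algebra_simps intro: add_nonneg_nonneg)
    define w where "w = (\<lambda>j. if j < m then z j + of_real (h * \<beta> j ?u) * z (Suc j) else z j)"
    have pw: "push\<^sup>*\<^sup>* (map y [0..<Suc m]) (map w [0..<Suc m])"
      unfolding w_def using ch u h(1) by (intro rtranclp_trans[OF z(1) push_all] mult_nonneg_nonneg) (auto simp: less_imp_le)
    have E0: "0 \<le> ?E" using B0 h \<eta> by (intro mult_nonneg_nonneg add_nonneg_nonneg zero_le_power) auto
    have P1: "1 \<le> (1 + h * B) ^ Suc k" using B0 h by (intro one_le_power) auto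
    have E': "(1 + h * B) * ?E + \<eta> * h \<le> (1 + h * B) ^ Suc k * (\<eta> + real (Suc k) * h * \<eta>)"
    proof -
      have "(1 + h * B) ^ Suc k * (\<eta> + real (Suc k) * h * \<eta>) = (1 + h * B) * ?E + (1 + h * B) ^ Suc k * (h * \<eta>)"
        by (simp add: algebra_simps)
      moreover have "1 * (h * \<eta>) \<le> (1 + h * B) ^ Suc k * (h * \<eta>)"
        using P1 h \<eta> by (intro mult_right_mono) auto
      ultimately show ?thesis by (simp add: mult.commute)
    qed
    have "norm (w j - x j (?u + h)) \<le> (1 + h * B) ^ Suc k * (\<eta> + real (Suc k) * h * \<eta>)" if j: "j \<le> m" for j
    proof (cases "j < m")
      case True
      have hb: "0 \<le> h * \<beta> j ?u" "h * \<beta> j ?u \<le> h * B"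
        using ch True u(1) h(1) B[OF True u(1)]
        by (simp_all add: mult_left_mono less_imp_le)
      have "w j - x j (?u + h) = (z j - x j ?u) + of_real (h * \<beta> j ?u) * (z (Suc j) - x (Suc j) ?u)
         - (x j (?u + h) - x j ?u - h *\<^sub>R (\<beta> j ?u *\<^sub>R x (Suc j) ?u))"
        using True unfolding w_def by (simp add: algebra_simps scaleR_conv_of_real)
      also have "norm \<dots> \<le> norm (z j - x j ?u) + norm (of_real (h * \<beta> j ?u) * (z (Suc j) - x (Suc j) ?u))
         + norm (x j (?u + h) - x j ?u - h *\<^sub>R (\<beta> j ?u *\<^sub>R x (Suc j) ?u))"
        by (rule order.trans[OF norm_triangle_ineq4 add_right_mono[OF norm_triangle_ineq]])
      also have "\<dots> \<le> ?E + (h * B) * ?E + \<eta> * h"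
      proof (intro add_mono)
        show "norm (z j - x j ?u) \<le> ?E" using z(2) j .
        have "norm (of_real (h * \<beta> j ?u) * (z (Suc j) - x (Suc j) ?u)) = (h * \<beta> j ?u) * norm (z (Suc j) - x (Suc j) ?u)"
          using hb by (simp only: norm_mult norm_of_real abs_of_nonneg)
        also have "\<dots> \<le> (h * B) * ?E"
          using hb True E0 by (intro mult_mono[OF hb(2) z(2)]) auto
        finally show "norm (of_real (h * \<beta> j ?u) * (z (Suc j) - x (Suc j) ?u)) \<le> (h * B) * ?E" .
        show "norm (x j (?u + h) - x j ?u - h *\<^sub>R (\<beta> j ?u *\<^sub>R x (Suc j) ?u)) \<le> \<eta> * h"
          using d(2)[OF True u(1,2) h(1)] h(3) d0(2)[OF True] by simp
      qed
      also have "\<dots> = (1 + h * B) * ?E + \<eta> * h" by (simp add: algebra_simps)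
      finally show ?thesis using E' by linarith
    next
      case False
      then have jm: "j = m" using j by simp
      obtain c where "\<forall>t\<in>{s..t}. x m t = c" using ch by blast
      then have "x j (?u + h) = x j ?u" using u jm by simp
      then have "norm (w j - x j (?u + h)) \<le> ?E" unfolding w_def using z(2)[OF j] False by simp
      also have "\<dots> \<le> (1 + h * B) * ?E + \<eta> * h"
      proof -
        have "1 * ?E \<le> (1 + h * B) * ?E" using B0 h(1) E0 by (intro mult_right_mono) auto
        moreover have "0 \<le> \<eta> * h" using \<eta> h by simp
        ultimately show ?thesis by linarith
      qed
      finally show ?thesis using E' by linarith
    qed
    moreover have "?u + h = s + real (Suc k) * h" by (simp add: algebra_simps)
    ultimately show ?case using pw by (intro exI[of _ w]) auto
  qed
  have "(1 + h * B) ^ N \<le> exp (h * B) ^ N"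
    using B0 h(1) by (intro power_mono exp_ge_add_one_self add_nonneg_nonneg) auto
  also have "\<dots> = exp (B * L)" using h(2) by (simp add: exp_of_nat_mult[symmetric] mult_ac)
  finally have "(1 + h * B) ^ N * (\<eta> + L * \<eta>) \<le> exp (B * L) * (\<eta> + L * \<eta>)"
    using \<eta>(1) L0 by (intro mult_right_mono) auto
  then have fin: "(1 + h * B) ^ N * (\<eta> + real N * h * \<eta>) < \<epsilon>"
    using \<eta>(2) unfolding h(2) by linarith
  have last: "s + real N * h = t" using h(2) unfolding L_def by simp
  show ?thesis
  proof (intro exI[of _ \<eta>] conjI allI impI \<eta>(1))
    fix y assume "\<forall>j\<le>m. norm (y j - x j s) < \<eta>"
    then obtain z where z: "push\<^sup>*\<^sup>* (map y [0..<Suc m]) (map z [0..<Suc m])"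
      "\<forall>j\<le>m. norm (z j - x j t) \<le> (1 + h * B) ^ N * (\<eta> + real N * h * \<eta>)"
      using main[of y N] unfolding last by blast
    then show "\<exists>z. push\<^sup>*\<^sup>* (map y [0..<Suc m]) (map z [0..<Suc m]) \<and> (\<forall>j\<le>m. norm (z j - x j t) < \<epsilon>)"
      using fin le_less_trans by blast
  qed
qed

lemma det2_altdef: "det2 z w = z \<bullet> (- \<i> * w)" "det2 z w = w \<bullet> (\<i> * z)"
  by (simp_all add: inner_complex_def algebra_simps)

section \<open>Perturbation of planar chains\<close>

text \<open>
  With \<open>\<delta> = e \<bullet> g\<close> the component of \<open>\<phi> t\<close> along \<open>e\<close> is the integral of the square of \<open>e \<bullet> g\<close>.
\<close>
lemma exists_shift:
  fixes g :: "real \<Rightarrow> complex"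
  assumes "s < t" "continuous_on {s..t} g" "\<exists>u\<in>{s..t}. e \<bullet> g u \<noteq> 0"
  shows "\<exists>\<delta> \<phi>. continuous_on {s..t} \<delta> \<and> \<phi> s = 0 \<and> 0 < e \<bullet> \<phi> t \<and>
    (\<forall>u\<in>{s..t}. (\<phi> has_vector_derivative \<delta> u *\<^sub>R g u) (at u within {s..t}))"
proof -
  define \<delta> where "\<delta> = (\<lambda>u. e \<bullet> g u)"
  define \<phi> where "\<phi> = (\<lambda>u. integral {s..u} (\<lambda>u. \<delta> u *\<^sub>R g u))"
  have c: "continuous_on {s..t} \<delta>" "continuous_on {s..t} (\<lambda>u. \<delta> u *\<^sub>R g u)"
    unfolding \<delta>_def using assms by (auto intro!: continuous_intros)
  have c2: "continuous_on {s..t} (\<lambda>u. (\<delta> u)\<^sup>2)" using c by (intro continuous_intros)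
  have "e \<bullet> \<phi> t = integral {s..t} (\<lambda>u. e \<bullet> (\<delta> u *\<^sub>R g u))"
    unfolding \<phi>_def using integral_linear[OF integrable_continuous_real[OF c(2)] bounded_linear_inner_right[of e]]
    by (simp add: comp_def)
  also have "\<dots> = integral {s..t} (\<lambda>u. (\<delta> u)\<^sup>2)"
    by (simp add: \<delta>_def power2_eq_square)
  finally have e: "e \<bullet> \<phi> t = integral {s..t} (\<lambda>u. (\<delta> u)\<^sup>2)" .
  have "integral {s..t} (\<lambda>u. (\<delta> u)\<^sup>2) \<noteq> 0"
    using integral_eq_0_iff[OF c2 assms(1)] assms(3) by (auto simp: \<delta>_def)
  moreover have "0 \<le> integral {s..t} (\<lambda>u. (\<delta> u)\<^sup>2)"
    by (intro integral_nonneg integrable_continuous_real c2) auto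
  ultimately have "0 < e \<bullet> \<phi> t" unfolding e by simp
  moreover have "\<phi> s = 0" unfolding \<phi>_def by simp
  moreover have "(\<phi> has_vector_derivative \<delta> u *\<^sub>R g u) (at u within {s..t})" if "u \<in> {s..t}" for u
    unfolding \<phi>_def by (rule integral_has_vector_derivative[OF c(2) that])
  ultimately show ?thesis
    using c(1) by (intro exI[of _ \<delta>] exI[of _ \<phi>]) simp
qed

lemma eventually_positive_perturbation:
  fixes \<beta> \<delta> :: "real \<Rightarrow> real"
  assumes "continuous_on {s..t} \<beta>" "continuous_on {s..t} \<delta>" "\<And>u. u \<in> {s..t} \<Longrightarrow> 0 < \<beta> u" "s \<le> t"
  shows "\<forall>\<^sub>F \<kappa> in at_right 0. \<forall>u\<in>{s..t}. 0 < \<beta> u + \<kappa> * \<delta> u"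
proof -
  obtain u0 where u0: "u0 \<in> {s..t}" "\<And>u. u \<in> {s..t} \<Longrightarrow> \<beta> u0 \<le> \<beta> u"
    using continuous_attains_inf[OF _ _ assms(1)] assms(4) by auto
  obtain D where D: "\<forall>u\<in>{s..t}. \<bar>\<delta> u\<bar> \<le> D"
    using compact_imp_bounded[OF compact_continuous_image[OF assms(2)]] unfolding bounded_iff by auto
  have "((\<lambda>\<kappa>. \<kappa> * D) \<longlongrightarrow> 0 * D) (at_right 0)" by (intro tendsto_intros)
  then have "\<forall>\<^sub>F \<kappa> in at_right 0. \<kappa> * D < \<beta> u0"
    using assms(3)[OF u0(1)] order_tendstoD(2)[of _ "0::real" _ "\<beta> u0"] by simp
  then show ?thesis
    using eventually_at_right_less[of "0::real"]
  proof eventually_elim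
    case (elim \<kappa>)
    have "0 < \<beta> u + \<kappa> * \<delta> u" if "u \<in> {s..t}" for u
    proof -
      have "\<kappa> * - \<delta> u \<le> \<kappa> * D" using elim D that by (intro mult_left_mono) fastforce+
      then show ?thesis using elim u0(2)[OF that] by simp
    qed
    then show ?case by blast
  qed
qed

lemma eventually_small_scaleR:
  fixes v :: "'a::real_normed_vector"
  assumes "0 < (\<epsilon>::real)"
  shows "\<forall>\<^sub>F \<kappa> in at_right 0. norm (\<kappa> *\<^sub>R v) < \<epsilon>"
proof -
  have "((\<lambda>\<kappa>. norm (\<kappa> *\<^sub>R v)) \<longlongrightarrow> norm (0 *\<^sub>R v)) (at_right (0::real))" by (intro tendsto_intros)
  then show ?thesis using assms order_tendstoD(2)[of _ "0::real" _ \<epsilon>] by simp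
qed

text \<open>
  Adding a small multiple of \<open>\<delta>\<close> to the first speed moves the end point of \<open>x 0\<close> by a multiple of \<open>\<phi> t\<close> and
  affects no other component.
\<close>
lemma kick_first:
  fixes x :: "nat \<Rightarrow> real \<Rightarrow> complex"
  assumes ch: "positive_chain m \<beta> x {s..t}" and "s < t" "1 \<le> m" "0 < \<epsilon>"
    and e: "\<exists>u\<in>{s..t}. e \<bullet> x 1 u \<noteq> 0"
  shows "\<exists>\<beta>' x'. positive_chain m \<beta>' x' {s..t} \<and> (\<forall>j\<le>m. x' j s = x j s) \<and>
    (\<forall>j\<le>m. norm (x' j t - x j t) < \<epsilon>) \<and> (\<forall>j. 1 \<le> j \<longrightarrow> x' j = x j) \<and> 0 < e \<bullet> (x' 0 t - x 0 t)"
proof -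
  note c = ch[unfolded positive_chain_def chain_def]
  have cx: "continuous_on {s..t} (x 1)"
    using ch assms(3) unfolding positive_chain_def by (intro chain_continuous_on[of m \<beta> x]) simp_all
  obtain \<delta> \<phi> where \<delta>: "continuous_on {s..t} \<delta>" "\<phi> s = 0" "0 < e \<bullet> \<phi> t"
    "\<And>u. u \<in> {s..t} \<Longrightarrow> (\<phi> has_vector_derivative \<delta> u *\<^sub>R x 1 u) (at u within {s..t})"
    using exists_shift[OF assms(2) cx e] by blast
  have "\<forall>\<^sub>F \<kappa> in at_right 0. (\<forall>u\<in>{s..t}. 0 < \<beta> 0 u + \<kappa> * \<delta> u) \<and> norm (\<kappa> *\<^sub>R \<phi> t) < \<epsilon> \<and> 0 < \<kappa>"
    using c assms \<delta> by (intro eventually_conj eventually_positive_perturbation eventually_small_scaleR eventually_at_right_less) auto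
  then obtain \<kappa> :: real where \<kappa>: "\<And>u. u \<in> {s..t} \<Longrightarrow> 0 < \<beta> 0 u + \<kappa> * \<delta> u" "norm (\<kappa> *\<^sub>R \<phi> t) < \<epsilon>" "0 < \<kappa>"
    using eventually_happens'[OF trivial_limit_at_right_real] by blast
  define x' where "x' = x(0 := (\<lambda>u. x 0 u + \<kappa> *\<^sub>R \<phi> u))"
  define \<beta>' where "\<beta>' = \<beta>(0 := (\<lambda>u. \<beta> 0 u + \<kappa> * \<delta> u))"
  have d: "(x' 0 has_vector_derivative \<beta>' 0 u *\<^sub>R x' 1 u) (at u within {s..t})" if "u \<in> {s..t}" for u
  proof -
    have "((\<lambda>u. x 0 u + \<kappa> *\<^sub>R \<phi> u) has_vector_derivative \<beta> 0 u *\<^sub>R x (Suc 0) u + \<kappa> *\<^sub>R (\<delta> u *\<^sub>R x 1 u)) (at u within {s..t})"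
      using c assms(3) that \<delta>(4)[OF that] by (auto intro!: derivative_eq_intros)
    then show ?thesis unfolding x'_def \<beta>'_def by (simp add: scaleR_add_left)
  qed
  have "chain m \<beta>' x' {s..t}"
    unfolding chain_def
  proof (intro conjI allI impI ballI)
    fix j assume j: "j < m"
    show "continuous_on {s..t} (\<beta>' j)"
      using c j \<delta>(1) unfolding \<beta>'_def by (auto intro!: continuous_intros)
    fix u assume u: "u \<in> {s..t}"
    show "\<beta>' j u \<noteq> 0" using c j \<kappa>(1)[OF u] u unfolding \<beta>'_def by auto
    show "(x' j has_vector_derivative \<beta>' j u *\<^sub>R x' (Suc j) u) (at u within {s..t})"
      using d[OF u] c j u by (cases j) (auto simp: x'_def \<beta>'_def)
  next
    show "\<exists>c. \<forall>t\<in>{s..t}. x' m t = c" using c assms(3) unfolding x'_def by auto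
  qed
  then have "positive_chain m \<beta>' x' {s..t}"
    unfolding positive_chain_def using c \<kappa>(1) by (auto simp: \<beta>'_def)
  moreover have "0 < e \<bullet> (x' 0 t - x 0 t)" using \<kappa>(3) \<delta>(3) unfolding x'_def by simp
  ultimately show ?thesis
    using \<kappa>(2) \<delta>(2) assms(4) by (intro exI[of _ \<beta>'] exI[of _ x']) (auto simp: x'_def)
qed

text \<open>
  Where \<open>x 1\<close> vanishes, moving \<open>x 0\<close> does not change the determinant. Instead the second speed is perturbed so
  that \<open>x 1 t\<close> becomes a short vector on the prescribed side of \<open>x 0 t\<close>.
\<close>
lemma kick_second:
  fixes x :: "nat \<Rightarrow> real \<Rightarrow> complex"
  assumes ch: "positive_chain m \<beta> x {s..t}" and "s < t" "2 \<le> m" "0 < \<epsilon>"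
    and e: "\<exists>u\<in>{s..t}. e \<bullet> x 2 u \<noteq> 0" and "x 1 t = 0" "e = of_real \<sigma> * (\<i> * x 0 t)"
  shows "\<exists>\<beta>' x'. positive_chain m \<beta>' x' {s..t} \<and> (\<forall>j\<le>m. x' j s = x j s) \<and>
    (\<forall>j\<le>m. norm (x' j t - x j t) < \<epsilon>) \<and> 0 < \<sigma> * det2 (x' 0 t) (x' 1 t)"
proof -
  note c = ch[unfolded positive_chain_def chain_def]
  have cx: "continuous_on {s..t} (x 2)"
    using ch assms(3) unfolding positive_chain_def by (intro chain_continuous_on[of m \<beta> x]) simp_all
  obtain \<delta> \<phi> where \<delta>: "continuous_on {s..t} \<delta>" "\<phi> s = 0" "0 < e \<bullet> \<phi> t"
    "\<And>u. u \<in> {s..t} \<Longrightarrow> (\<phi> has_vector_derivative \<delta> u *\<^sub>R x 2 u) (at u within {s..t})"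
    using exists_shift[OF assms(2) cx e] by blast
  have c\<phi>: "continuous_on {s..t} \<phi>"
    unfolding continuous_on_eq_continuous_within using \<delta>(4) by (blast intro: has_vector_derivative_continuous)
  \<comment> \<open>The change that the perturbation of \<open>x 1\<close> by \<open>\<phi>\<close> causes in \<open>x 0\<close>.\<close>
  define w where "w = (\<lambda>u. integral {s..u} (\<lambda>u. \<beta> 0 u *\<^sub>R \<phi> u))"
  have w: "w s = 0" "\<And>u. u \<in> {s..t} \<Longrightarrow> (w has_vector_derivative \<beta> 0 u *\<^sub>R \<phi> u) (at u within {s..t})"
    unfolding w_def using c assms(3) c\<phi> by (auto intro!: integral_has_vector_derivative continuous_intros)
  have pos: "0 < \<sigma> * det2 (x 0 t) (\<phi> t)"
    using \<delta>(3) unfolding assms(7) det2_altdef(2)[of "x 0 t"] by (simp add: inner_complex_def algebra_simps)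
  have "((\<lambda>\<kappa>. \<sigma> * det2 (x 0 t + \<kappa> *\<^sub>R w t) (\<phi> t)) \<longlongrightarrow> \<sigma> * det2 (x 0 t + 0 *\<^sub>R w t) (\<phi> t)) (at_right 0)"
    by (intro tendsto_intros)
  then have ev: "\<forall>\<^sub>F \<kappa> in at_right 0. 0 < \<sigma> * det2 (x 0 t + \<kappa> *\<^sub>R w t) (\<phi> t)"
    using pos order_tendstoD(1)[of _ "\<sigma> * det2 (x 0 t) (\<phi> t)" _ 0] by simp
  have "\<forall>\<^sub>F \<kappa> in at_right 0. (\<forall>u\<in>{s..t}. 0 < \<beta> 1 u + \<kappa> * \<delta> u) \<and> norm (\<kappa> *\<^sub>R \<phi> t) < \<epsilon> \<and> norm (\<kappa> *\<^sub>R w t) < \<epsilon> \<and> 0 < \<kappa>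
     \<and> 0 < \<sigma> * det2 (x 0 t + \<kappa> *\<^sub>R w t) (\<phi> t)"
    using c assms \<delta> ev by (intro eventually_conj eventually_positive_perturbation eventually_small_scaleR eventually_at_right_less) auto
  then obtain \<kappa> :: real where \<kappa>: "\<And>u. u \<in> {s..t} \<Longrightarrow> 0 < \<beta> 1 u + \<kappa> * \<delta> u" "norm (\<kappa> *\<^sub>R \<phi> t) < \<epsilon>" "norm (\<kappa> *\<^sub>R w t) < \<epsilon>" "0 < \<kappa>"
    "0 < \<sigma> * det2 (x 0 t + \<kappa> *\<^sub>R w t) (\<phi> t)"
    using eventually_happens'[OF trivial_limit_at_right_real] by blast
  define x' where "x' = x(0 := (\<lambda>u. x 0 u + \<kappa> *\<^sub>R w u), 1 := (\<lambda>u. x 1 u + \<kappa> *\<^sub>R \<phi> u))"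
  define \<beta>' where "\<beta>' = \<beta>(1 := (\<lambda>u. \<beta> 1 u + \<kappa> * \<delta> u))"
  have d1: "(x' 1 has_vector_derivative \<beta>' 1 u *\<^sub>R x' 2 u) (at u within {s..t})" if "u \<in> {s..t}" for u
  proof -
    have x1: "(x 1 has_vector_derivative \<beta> 1 u *\<^sub>R x 2 u) (at u within {s..t})"
      using c assms(3) that by (metis One_nat_def Suc_1 Suc_le_lessD)
    have "((\<lambda>u. x 1 u + \<kappa> *\<^sub>R \<phi> u) has_vector_derivative \<beta> 1 u *\<^sub>R x 2 u + \<kappa> *\<^sub>R (\<delta> u *\<^sub>R x 2 u)) (at u within {s..t})"
      using x1 \<delta>(4)[OF that] by (auto intro!: derivative_eq_intros)
    then show ?thesis unfolding x'_def \<beta>'_def by (simp add: scaleR_add_left)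
  qed
  have d0: "(x' 0 has_vector_derivative \<beta>' 0 u *\<^sub>R x' 1 u) (at u within {s..t})" if "u \<in> {s..t}" for u
  proof -
    have x0: "(x 0 has_vector_derivative \<beta> 0 u *\<^sub>R x 1 u) (at u within {s..t})"
      using c assms(3) that by (metis One_nat_def less_le_trans pos2)
    have "((\<lambda>u. x 0 u + \<kappa> *\<^sub>R w u) has_vector_derivative \<beta> 0 u *\<^sub>R x 1 u + \<kappa> *\<^sub>R (\<beta> 0 u *\<^sub>R \<phi> u)) (at u within {s..t})"
      using x0 w(2)[OF that] by (auto intro!: derivative_eq_intros)
    then show ?thesis unfolding x'_def \<beta>'_def by (simp add: scaleR_add_right mult.commute)
  qed
  have "chain m \<beta>' x' {s..t}"
    unfolding chain_def
  proof (intro conjI allI impI ballI)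
    fix j assume j: "j < m"
    show "continuous_on {s..t} (\<beta>' j)"
      using c j \<delta>(1) unfolding \<beta>'_def by (auto intro!: continuous_intros)
    fix u assume u: "u \<in> {s..t}"
    show "\<beta>' j u \<noteq> 0" using c j \<kappa>(1)[OF u] u unfolding \<beta>'_def by auto
    show "(x' j has_vector_derivative \<beta>' j u *\<^sub>R x' (Suc j) u) (at u within {s..t})"
    proof -
      consider "j = 0" | "j = 1" | "2 \<le> j" by linarith
      then show ?thesis
      proof cases
        case 1
        then show ?thesis using d0[OF u] by simp
      next
        case 2
        then show ?thesis using d1[OF u] by (simp add: numeral_2_eq_2)
      next
        case 3
        then show ?thesis using c j u unfolding x'_def \<beta>'_def by simp
      qed
    qed
  next
    show "\<exists>c. \<forall>t\<in>{s..t}. x' m t = c" using c assms(3) unfolding x'_def by auto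
  qed
  then have "positive_chain m \<beta>' x' {s..t}"
    unfolding positive_chain_def using c \<kappa>(1) by (auto simp: \<beta>'_def)
  moreover have "0 < \<sigma> * det2 (x' 0 t) (x' 1 t)"
  proof -
    have "\<sigma> * det2 (x' 0 t) (x' 1 t) = \<kappa> * (\<sigma> * det2 (x 0 t + \<kappa> *\<^sub>R w t) (\<phi> t))"
      using assms(6) unfolding x'_def by (simp add: algebra_simps)
    then show ?thesis using \<kappa>(4,5) by (simp only: mult_pos_pos)
  qed
  ultimately show ?thesis
    using \<kappa>(2,3) \<delta>(2) w(1) assms(4) by (intro exI[of _ \<beta>'] exI[of _ x']) (auto simp: x'_def)
qed

text \<open>
  At a zero of \<open>det2 (x 0) (x 1)\<close> an arbitrarily small change of the speeds gives the determinant a prescribed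
  sign. This makes zeros without change of sign as costly as the others.
\<close>
lemma kick:
  fixes x :: "nat \<Rightarrow> real \<Rightarrow> complex"
  assumes ch: "positive_chain m \<beta> x {s..t}" and st: "s < t" and m: "2 \<le> m" and "0 < \<epsilon>"
    and "det2 (x 0 t) (x 1 t) = 0" "\<sigma> \<noteq> 0"
    and e1: "\<And>e. e \<noteq> 0 \<Longrightarrow> \<exists>u\<in>{s..t}. e \<bullet> x 1 u \<noteq> 0"
    and e2: "\<And>e. x 1 t = 0 \<Longrightarrow> e \<noteq> 0 \<Longrightarrow> \<exists>u\<in>{s..t}. e \<bullet> x 2 u \<noteq> 0"
  shows "\<exists>\<beta>' x'. positive_chain m \<beta>' x' {s..t} \<and> (\<forall>j\<le>m. x' j s = x j s) \<and>
    (\<forall>j\<le>m. norm (x' j t - x j t) < \<epsilon>) \<and> 0 < \<sigma> * det2 (x' 0 t) (x' 1 t)"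
proof (cases "x 1 t = 0")
  case False
  define e where "e = of_real \<sigma> * (- \<i> * x 1 t)"
  have "e \<noteq> 0" using False assms(6) unfolding e_def by simp
  obtain \<beta>' x' where x': "positive_chain m \<beta>' x' {s..t}" "\<forall>j\<le>m. x' j s = x j s"
    "\<forall>j\<le>m. norm (x' j t - x j t) < \<epsilon>" "\<forall>j. 1 \<le> j \<longrightarrow> x' j = x j" "0 < e \<bullet> (x' 0 t - x 0 t)"
    using kick_first[OF ch st _ assms(4) e1[OF \<open>e \<noteq> 0\<close>]] m by auto
  have "0 < \<sigma> * det2 (x' 0 t - x 0 t) (x 1 t)"
    using x'(5) unfolding e_def by (simp add: inner_complex_def algebra_simps)
  then have "0 < \<sigma> * det2 (x' 0 t) (x' 1 t)"
    using assms(5) x'(4) by (simp add: algebra_simps)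
  then show ?thesis using x' by blast
next
  case True
  have "\<exists>\<beta>' x'. positive_chain m \<beta>' x' {s..t} \<and> (\<forall>j\<le>m. x' j s = x j s) \<and>
    (\<forall>j\<le>m. norm (x' j t - x j t) < \<epsilon> / 2) \<and> (\<forall>j. 1 \<le> j \<longrightarrow> x' j = x j) \<and> x' 0 t \<noteq> 0"
  proof (cases "x 0 t = 0")
    case False
    then show ?thesis using ch assms(4) by (intro exI[of _ \<beta>] exI[of _ x]) auto
  next
    case 0: True
    have "0 < \<epsilon> / 2" using assms(4) by simp
    then obtain \<beta>' x' where "positive_chain m \<beta>' x' {s..t}" "\<forall>j\<le>m. x' j s = x j s"
      "\<forall>j\<le>m. norm (x' j t - x j t) < \<epsilon> / 2" "\<forall>j. 1 \<le> j \<longrightarrow> x' j = x j" "0 < 1 \<bullet> (x' 0 t - x 0 t)"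
      using kick_first[OF ch st _ _ e1[of 1], of "\<epsilon> / 2"] m by auto
    then show ?thesis using 0 by (intro exI[of _ \<beta>'] exI[of _ x']) auto
  qed
  then obtain \<beta>1 x1 where x1: "positive_chain m \<beta>1 x1 {s..t}" "\<forall>j\<le>m. x1 j s = x j s"
    "\<forall>j\<le>m. norm (x1 j t - x j t) < \<epsilon> / 2" "\<forall>j. 1 \<le> j \<longrightarrow> x1 j = x j" "x1 0 t \<noteq> 0" by blast
  define e where "e = of_real \<sigma> * (\<i> * x1 0 t)"
  have "e \<noteq> 0" using x1(5) assms(6) unfolding e_def by simp
  have "0 < \<epsilon> / 2" "x1 1 t = 0" "\<exists>u\<in>{s..t}. e \<bullet> x1 2 u \<noteq> 0"
    using assms(4) True x1(4) e2[OF True \<open>e \<noteq> 0\<close>] by auto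
  then obtain \<beta>2 x2 where x2: "positive_chain m \<beta>2 x2 {s..t}" "\<forall>j\<le>m. x2 j s = x1 j s"
    "\<forall>j\<le>m. norm (x2 j t - x1 j t) < \<epsilon> / 2" "0 < \<sigma> * det2 (x2 0 t) (x2 1 t)"
    using kick_second[OF x1(1) st m _ _ _ e_def] by blast
  have "norm (x2 j t - x j t) < \<epsilon>" if "j \<le> m" for j
  proof -
    have "norm (x2 j t - x j t) \<le> norm (x2 j t - x1 j t) + norm (x1 j t - x j t)"
      using norm_triangle_ineq[of "x2 j t - x1 j t" "x1 j t - x j t"] by simp
    moreover have "norm (x2 j t - x1 j t) < \<epsilon> / 2" "norm (x1 j t - x j t) < \<epsilon> / 2"
      using x1(3) x2(3) that by auto
    ultimately show ?thesis by linarith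
  qed
  then show ?thesis using x1(2) x2 by (intro exI[of _ \<beta>2] exI[of _ x2]) auto
qed

section \<open>Zeros of the determinant along a planar chain\<close>

lemma chain_bounded_linear:
  assumes "chain m \<beta> x S" "bounded_linear l"
  shows "chain m \<beta> (\<lambda>j t. l (x j t)) S"
proof -
  interpret bounded_linear l by fact
  have "((\<lambda>t. l (x j t)) has_vector_derivative \<beta> j t *\<^sub>R l (x (Suc j) t)) (at t within S)" if "j < m" "t \<in> S" for j t
  proof -
    have "(x j has_vector_derivative \<beta> j t *\<^sub>R x (Suc j) t) (at t within S)"
      using assms(1) that unfolding chain_def by blast
    from bounded_linear.has_vector_derivative[OF assms(2) this] show ?thesis by (simp add: scaleR)
  qed
  moreover obtain c where "\<forall>t\<in>S. x m t = c" using assms(1) unfolding chain_def by blast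
  then have "\<forall>t\<in>S. l (x m t) = l c" by simp
  ultimately show ?thesis using assms(1) unfolding chain_def by blast
qed

text \<open>
  On the subinterval, differentiation carries the vanishing from \<open>y j\<close> up to the constant \<open>y m\<close>, which is
  therefore zero on the whole interval. Integration carries it back down from \<open>y m\<close> to \<open>y j\<close>; the constants
  of integration are zero because they are so on the subinterval.
\<close>
lemma chain_unique_continuation:
  fixes y :: "nat \<Rightarrow> real \<Rightarrow> real"
  assumes ch: "chain m \<beta> y {a..<b}" and st: "a \<le> s" "s < t" "t \<le> b"
    and j: "j \<le> m" "\<And>u. u \<in> {s<..<t} \<Longrightarrow> y j u = 0"
    and i: "j \<le> i" "i \<le> m" and u: "u \<in> {a..<b}"
  shows "y i u = 0"
proof -
  have sub: "{s<..<t} \<subseteq> {a..<b}" using st by auto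
  have loc: "\<forall>u\<in>{s<..<t}. y (j + k) u = 0" if "j + k \<le> m" for k
    using that
  proof (induction k)
    case 0
    then show ?case using j by simp
  next
    case (Suc k)
    show ?case
    proof
      fix u assume u: "u \<in> {s<..<t}"
      have "j + k < m" "u \<in> {a..<b}" using Suc.prems u sub by auto
      then have nz: "\<beta> (j + k) u \<noteq> 0" and "(y (j + k) has_vector_derivative \<beta> (j + k) u *\<^sub>R y (Suc (j + k)) u) (at u within {a..<b})"
        using ch unfolding chain_def by blast+
      then have "(y (j + k) has_vector_derivative \<beta> (j + k) u *\<^sub>R y (Suc (j + k)) u) (at u within {s<..<t})"
        using has_vector_derivative_within_subset sub by blast
      then have d: "(y (j + k) has_vector_derivative \<beta> (j + k) u *\<^sub>R y (Suc (j + k)) u) (at u)"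
        using u by (simp add: at_within_open[of u "{s<..<t}"])
      have "((\<lambda>_. 0) has_vector_derivative 0) (at u)" by simp
      then have "(y (j + k) has_vector_derivative 0) (at u)"
        by (rule has_vector_derivative_transform_within_open[where S = "{s<..<t}"]) (use Suc u in auto)
      then have "\<beta> (j + k) u *\<^sub>R y (Suc (j + k)) u = 0"
        using d vector_derivative_unique_at by blast
      then show "y (j + Suc k) u = 0" using nz by simp
    qed
  qed
  define p where "p = (s + t) / 2"
  have p: "p \<in> {s<..<t}" "p \<in> {a..<b}" using st unfolding p_def by auto
  have glob: "\<forall>u\<in>{a..<b}. y (m - k) u = 0" if "k \<le> m - j" for k
    using that
  proof (induction k)
    case 0
    obtain c where "\<forall>t\<in>{a..<b}. y m t = c" using ch unfolding chain_def by blast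
    moreover have "y m p = 0" using loc[of "m - j"] j(1) p(1) by simp
    ultimately show ?case using p by auto
  next
    case (Suc k)
    let ?i = "m - Suc k"
    have im: "?i < m" "Suc ?i = m - k" "?i = j + (?i - j)" using Suc.prems by auto
    have "(y ?i has_vector_derivative 0) (at u within {a..<b})" if "u \<in> {a..<b}" for u
    proof -
      have "(y ?i has_vector_derivative \<beta> ?i u *\<^sub>R y (Suc ?i) u) (at u within {a..<b})"
        using ch im(1) that unfolding chain_def by blast
      moreover have "y (Suc ?i) u = 0" using Suc that im(2) by simp
      ultimately show ?thesis by simp
    qed
    from has_vector_derivative_zero_constant[OF convex_real_interval(7) this]
    obtain c where "\<And>u. u \<in> {a..<b} \<Longrightarrow> y ?i u = c" by blast
    moreover have "y ?i p = 0" using loc[of "?i - j"] im(1) p(1) Suc.prems by simp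
    ultimately have "c = 0" using p(2) by simp
    then show ?case using \<open>\<And>u. u \<in> {a..<b} \<Longrightarrow> y ?i u = c\<close> by simp
  qed
  show ?thesis using glob[of "m - i"] i u by simp
qed

lemma sgn_mult_pos: "d \<noteq> 0 \<Longrightarrow> 0 < sgn d * d" for d :: real
  by (simp add: sgn_if)

lemma det2_stable:
  assumes "\<sigma> * det2 p q > 0"
  shows "\<exists>\<eta>>0. \<forall>p' q'. norm (p' - p) < \<eta> \<longrightarrow> norm (q' - q) < \<eta> \<longrightarrow> 0 < \<sigma> * det2 p' q'"
proof -
  have "((\<lambda>z. \<sigma> * det2 (fst z) (snd z)) \<longlongrightarrow> \<sigma> * det2 (fst (p, q)) (snd (p, q))) (at (p, q))"
    by (intro tendsto_intros)
  then have "\<forall>\<^sub>F z in at (p, q). 0 < \<sigma> * det2 (fst z) (snd z)"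
    using assms order_tendstoD(1)[of _ "\<sigma> * det2 p q" _ 0] by simp
  then obtain d where d: "d > 0" "\<And>z. z \<noteq> (p, q) \<Longrightarrow> dist z (p, q) < d \<Longrightarrow> 0 < \<sigma> * det2 (fst z) (snd z)"
    unfolding eventually_at by auto
  have "0 < \<sigma> * det2 p' q'" if "norm (p' - p) < d / 2" "norm (q' - q) < d / 2" for p' q'
  proof -
    have "dist (p', q') (p, q) \<le> dist p' p + dist q' q"
      unfolding dist_prod_def by (simp add: sqrt_sum_squares_le_sum)
    then have "dist (p', q') (p, q) < d" using that by (simp add: dist_norm)
    then show ?thesis using d(2)[of "(p', q')"] assms by (cases "(p', q') = (p, q)") auto
  qed
  then show ?thesis using d(1) by (intro exI[of _ "d / 2"]) auto
qed

text \<open>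
  The first nondegeneracy condition says that the chain does not lie in a line through the origin, the second that
  the velocity of \<open>x 0\<close> does not have a fixed direction.
\<close>
locale planar_chain =
  fixes m :: nat and \<beta> :: "nat \<Rightarrow> real \<Rightarrow> real" and x :: "nat \<Rightarrow> real \<Rightarrow> complex" and a b :: real
  assumes pos: "positive_chain m \<beta> x {a..<b}"
    and m: "3 \<le> m"
    and nondegenerate: "\<And>e. e \<noteq> 0 \<Longrightarrow> \<exists>j\<le>m. \<exists>t\<in>{a..<b}. e \<bullet> x j t \<noteq> 0"
    and rotating: "\<And>e. e \<noteq> 0 \<Longrightarrow> \<exists>t\<in>{a..<b}. e \<bullet> x 1 t \<noteq> 0"
begin

lemma chain_x: "chain m \<beta> x {a..<b}"
  using pos unfolding positive_chain_def by blast

lemma chain_inner: "chain m \<beta> (\<lambda>j t. e \<bullet> x j t) {a..<b}"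
  by (rule chain_bounded_linear[OF chain_x bounded_linear_inner_right])

text \<open>
  If the determinant vanished on an interval, then \<open>x 0\<close> would have a fixed direction there, since the derivative of
  the quotient of its coordinates is a multiple of the determinant.
\<close>
lemma exists_det2_nonzero:
  assumes "a \<le> s" "s < t" "t \<le> b"
  shows "\<exists>u\<in>{s<..<t}. det2 (x 0 u) (x 1 u) \<noteq> 0"
proof (rule ccontr)
  assume "\<not> ?thesis"
  then have zero: "\<And>u. u \<in> {s<..<t} \<Longrightarrow> det2 (x 0 u) (x 1 u) = 0" by blast
  have sub: "{s<..<t} \<subseteq> {a..<b}" using assms by auto
  have uc: False if "e \<noteq> 0" "a \<le> s'" "s' < t'" "t' \<le> b" "\<And>u. u \<in> {s'<..<t'} \<Longrightarrow> e \<bullet> x 0 u = 0" for e s' t'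
    using nondegenerate[OF that(1)] chain_unique_continuation[OF chain_inner that(2-4), of 0 e] that(5) by auto
  obtain u0 where u0: "u0 \<in> {s<..<t}" "1 \<bullet> x 0 u0 \<noteq> 0"
    using uc[of 1 s t] assms by auto
  have d: "((\<lambda>t. e \<bullet> x 0 t) has_real_derivative \<beta> 0 u * (e \<bullet> x 1 u)) (at u)" if "u \<in> {s<..<t}" for e u
  proof -
    have "((\<lambda>t. e \<bullet> x 0 t) has_vector_derivative \<beta> 0 u *\<^sub>R (e \<bullet> x 1 u)) (at u within {s<..<t})"
      using chain_inner[of e] m that sub unfolding chain_def
      by (intro has_vector_derivative_within_subset[OF _ sub]) (auto simp: subset_iff)
    then show ?thesis
      using that by (simp add: at_within_open[of u "{s<..<t}"] has_real_derivative_iff_has_vector_derivative)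
  qed
  have "continuous (at u0) (\<lambda>t. 1 \<bullet> x 0 t)" using d[OF u0(1), of 1] DERIV_isCont by blast
  then obtain r where r: "r > 0" "\<And>u. dist u0 u < r \<Longrightarrow> 1 \<bullet> x 0 u \<noteq> 0"
    using continuous_at_avoid[of u0 "\<lambda>t. 1 \<bullet> x 0 t" 0] u0(2) by blast
  define s' t' where "s' = max s (u0 - r)" and "t' = min t (u0 + r)"
  have st': "a \<le> s'" "s' < t'" "t' \<le> b" "{s'<..<t'} \<subseteq> {s<..<t}" using assms u0 r(1) unfolding s'_def t'_def by auto
  have nz: "1 \<bullet> x 0 u \<noteq> 0" if "u \<in> {s'<..<t'}" for u
  proof (rule r(2))
    show "dist u0 u < r" using that unfolding s'_def t'_def dist_real_def by (simp add: abs_less_iff)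
  qed
  define q where "q = (\<lambda>u. (\<i> \<bullet> x 0 u) / (1 \<bullet> x 0 u))"
  have "(q has_real_derivative 0) (at u within {s'<..<t'})" if u: "u \<in> {s'<..<t'}" for u
  proof -
    have "u \<in> {s<..<t}" using u st' by auto
    then have "(q has_real_derivative (\<beta> 0 u * (\<i> \<bullet> x 1 u) * (1 \<bullet> x 0 u) - (\<i> \<bullet> x 0 u) * (\<beta> 0 u * (1 \<bullet> x 1 u))) / ((1 \<bullet> x 0 u) * (1 \<bullet> x 0 u))) (at u)"
      unfolding q_def by (intro DERIV_divide d nz u)
    moreover have "\<beta> 0 u * (\<i> \<bullet> x 1 u) * (1 \<bullet> x 0 u) - (\<i> \<bullet> x 0 u) * (\<beta> 0 u * (1 \<bullet> x 1 u)) = \<beta> 0 u * det2 (x 0 u) (x 1 u)"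
      by (simp add: inner_complex_def algebra_simps)
    ultimately have "(q has_real_derivative 0) (at u)" using zero[OF \<open>u \<in> {s<..<t}\<close>] by simp
    then show ?thesis by (rule has_field_derivative_at_within)
  qed
  then obtain c where c: "\<And>u. u \<in> {s'<..<t'} \<Longrightarrow> q u = c"
    using has_field_derivative_zero_constant[of "{s'<..<t'}" q] by (auto simp: convex_real_interval)
  have "(\<i> - of_real c) \<bullet> x 0 u = 0" if "u \<in> {s'<..<t'}" for u
    using c[OF that] nz[OF that] unfolding q_def by (simp add: inner_complex_def field_simps)
  moreover have "\<i> - of_real c \<noteq> 0" by (simp add: complex_eq_iff)
  ultimately show False using uc st' by blast
qed

lemma rotating_between:
  assumes "e \<noteq> 0" "a \<le> s" "s < t" "t < b"
  shows "\<exists>u\<in>{s..t}. e \<bullet> x 1 u \<noteq> 0"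
proof (rule ccontr)
  assume no: "\<not> ?thesis"
  have "1 \<le> m" using m by simp
  moreover have "\<And>u. u \<in> {s<..<t} \<Longrightarrow> e \<bullet> x 1 u = 0"
    using no greaterThanLessThan_subseteq_atLeastAtMost_iff[of s t s t] by blast
  ultimately have z: "e \<bullet> x 1 u = 0" if "u \<in> {a..<b}" for u
    using chain_unique_continuation[OF chain_inner[of e] assms(2,3) less_imp_le[OF assms(4)], of 1 1 u] that by blast
  then show False using rotating[OF assms(1)] z by blast
qed

lemma rotating_next_between:
  assumes "e \<noteq> 0" "a \<le> s" "s < t" "t < b" "x 1 t = 0"
  shows "\<exists>u\<in>{s..t}. e \<bullet> x 2 u \<noteq> 0"
proof (rule ccontr)
  assume no: "\<not> ?thesis"
  have "2 \<le> m" using m by simp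
  moreover have "\<And>u. u \<in> {s<..<t} \<Longrightarrow> e \<bullet> x 2 u = 0"
    using no greaterThanLessThan_subseteq_atLeastAtMost_iff[of s t s t] by blast
  ultimately have z: "e \<bullet> x 2 u = 0" if "u \<in> {a..<b}" for u
    using chain_unique_continuation[OF chain_inner[of e] assms(2,3) less_imp_le[OF assms(4)], of 2 2 u] that by blast
  have "((\<lambda>t. e \<bullet> x 1 t) has_vector_derivative \<beta> 1 u *\<^sub>R (e \<bullet> x (Suc 1) u)) (at u within {a..<b})" if "u \<in> {a..<b}" for u
    using chain_inner[of e] m that unfolding chain_def by auto
  then have "((\<lambda>t. e \<bullet> x 1 t) has_vector_derivative 0) (at u within {a..<b})" if "u \<in> {a..<b}" for u
    using that z by (simp add: numeral_2_eq_2)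
  then obtain c where c: "\<And>u. u \<in> {a..<b} \<Longrightarrow> e \<bullet> x 1 u = c"
    using has_vector_derivative_zero_constant[of "{a..<b}" "\<lambda>t. e \<bullet> x 1 t"] by (auto simp: convex_real_interval)
  have "t \<in> {a..<b}" using assms by auto
  from c[OF this] have "c = 0" using assms(5) by simp
  then show False using rotating[OF assms(1)] c by auto
qed

abbreviation points :: "(nat \<Rightarrow> complex) \<Rightarrow> complex list" where
  "points y \<equiv> map y [0..<Suc m]"

lemma points_eq: "points y = y 0 # y 1 # map y [2..<Suc m]"
  using m by (simp add: upt_conv_Cons numeral_2_eq_2 del: upt_Suc)

lemma cost_drop:
  assumes "push\<^sup>*\<^sup>* (points y) (points z)" "det2 (y 0) (y 1) * det2 (z 0) (z 1) < 0"
    and "turning D (points y) ds" "\<And>D es. turning D (points z) es \<Longrightarrow> c \<le> turn_cost es"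
  shows "c + 1 \<le> turn_cost ds"
  using turn_cost_drop[of "y 0" "y 1" "map y [2..<Suc m]" "z 0" "z 1" "map z [2..<Suc m]" D ds c] assms
  unfolding points_eq by blast

lemma flow:
  assumes "a \<le> s" "s \<le> t" "t < b" "0 < \<epsilon>"
  shows "\<exists>\<eta>>0. \<forall>y. (\<forall>j\<le>m. norm (y j - x j s) < \<eta>) \<longrightarrow>
    (\<exists>z. push\<^sup>*\<^sup>* (points y) (points z) \<and> (\<forall>j\<le>m. norm (z j - x j t) < \<epsilon>))"
  using assms by (intro chain_push[where \<beta> = \<beta>] positive_chain_subset[OF pos]) auto

lemma flow_kick:
  assumes "a \<le> s" "s < t" "t < b" "0 < \<epsilon>" "det2 (x 0 t) (x 1 t) = 0" "\<sigma> \<noteq> 0"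
  shows "\<exists>\<eta>>0. \<forall>y. (\<forall>j\<le>m. norm (y j - x j s) < \<eta>) \<longrightarrow>
    (\<exists>z. push\<^sup>*\<^sup>* (points y) (points z) \<and> (\<forall>j\<le>m. norm (z j - x j t) < \<epsilon>) \<and> 0 < \<sigma> * det2 (z 0) (z 1))"
proof -
  have pos': "positive_chain m \<beta> x {s..t}" using assms by (intro positive_chain_subset[OF pos]) auto
  have "2 \<le> m" "0 < \<epsilon> / 2" using m assms by auto
  then obtain \<beta>' x' where x': "positive_chain m \<beta>' x' {s..t}" "\<forall>j\<le>m. x' j s = x j s"
    "\<forall>j\<le>m. norm (x' j t - x j t) < \<epsilon> / 2" "0 < \<sigma> * det2 (x' 0 t) (x' 1 t)"
    using kick[OF pos' assms(2) _ _ assms(5,6)] rotating_between rotating_next_between assms by metis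
  obtain \<eta>1 where \<eta>1: "0 < \<eta>1" "\<And>p q. norm (p - x' 0 t) < \<eta>1 \<Longrightarrow> norm (q - x' 1 t) < \<eta>1 \<Longrightarrow> 0 < \<sigma> * det2 p q"
    using det2_stable[OF x'(4)] by blast
  obtain \<eta> where \<eta>: "0 < \<eta>" "\<And>y. (\<forall>j\<le>m. norm (y j - x' j s) < \<eta>) \<Longrightarrow>
    (\<exists>z. push\<^sup>*\<^sup>* (points y) (points z) \<and> (\<forall>j\<le>m. norm (z j - x' j t) < min \<eta>1 (\<epsilon> / 2)))"
    using chain_push[OF x'(1), of "min \<eta>1 (\<epsilon> / 2)"] \<eta>1(1) assms by auto
  show ?thesis
  proof (intro exI[of _ \<eta>] conjI allI impI \<eta>(1))
    fix y assume "\<forall>j\<le>m. norm (y j - x j s) < \<eta>"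
    then obtain z where z: "push\<^sup>*\<^sup>* (points y) (points z)" "\<forall>j\<le>m. norm (z j - x' j t) < min \<eta>1 (\<epsilon> / 2)"
      using \<eta>(2)[of y] x'(2) by auto
    have "norm (z j - x j t) < \<epsilon>" if "j \<le> m" for j
    proof -
      have "norm (z j - x j t) \<le> norm (z j - x' j t) + norm (x' j t - x j t)"
        using norm_triangle_ineq[of "z j - x' j t" "x' j t - x j t"] by simp
      moreover have "norm (z j - x' j t) < \<epsilon> / 2" "norm (x' j t - x j t) < \<epsilon> / 2" using z(2) x'(3) that by auto
      ultimately show ?thesis by linarith
    qed
    moreover have "0 < \<sigma> * det2 (z 0) (z 1)" using \<eta>1(2)[of "z 0" "z 1"] z(2) m by auto
    ultimately show "\<exists>z. push\<^sup>*\<^sup>* (points y) (points z) \<and> (\<forall>j\<le>m. norm (z j - x j t) < \<epsilon>) \<and> 0 < \<sigma> * det2 (z 0) (z 1)"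
      using z(1) by blast
  qed
qed

text \<open>
  Between successive zeros there are parameters where the determinant is nonzero. If its sign
  differs before and after a zero, then following the chain past this zero lowers the cost by one. If the
  sign is the same, a kick at the zero produces two changes of sign.
\<close>
lemma zeros_le_turn_cost:
  assumes "sorted_wrt (<) ts" "\<forall>t\<in>set ts. g < t \<and> t < b \<and> det2 (x 0 t) (x 1 t) = 0"
    and "a \<le> g" "g < b" "det2 (x 0 g) (x 1 g) \<noteq> 0"
  shows "\<exists>\<eta>>0. \<forall>y. (\<forall>j\<le>m. norm (y j - x j g) < \<eta>) \<longrightarrow> (\<forall>D ds. turning D (points y) ds \<longrightarrow> int (length ts) + 1 \<le> turn_cost ds)"
  using assms
proof (induction ts arbitrary: g)
  case Nil
  then show ?case using turn_cost_ge_1 by (intro exI[of _ 1]) auto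
next
  case (Cons t ts)
  define q where "q = (if ts = [] then b else hd ts)"
  have t: "g < t" "t < b" "det2 (x 0 t) (x 1 t) = 0" using Cons.prems by auto
  have q: "t < q" "q \<le> b" using Cons.prems unfolding q_def by (cases ts; auto)+
  have q': "q \<le> u" if "u \<in> set ts" for u using Cons.prems that unfolding q_def by (cases ts) (auto simp: less_imp_le)
  obtain g' where g': "t < g'" "g' < q" "det2 (x 0 g') (x 1 g') \<noteq> 0"
    using exists_det2_nonzero[of t q] q t Cons.prems(3) by auto
  have g'b: "a \<le> g'" "g' < b" using g' q t Cons.prems(3) by auto
  have srt: "sorted_wrt (<) ts" "\<forall>u\<in>set ts. g' < u \<and> u < b \<and> det2 (x 0 u) (x 1 u) = 0"
    using Cons.prems(1,2) g' q' by (auto intro: less_le_trans)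
  obtain \<eta>1 where \<eta>1: "0 < \<eta>1" "\<And>y D ds. (\<forall>j\<le>m. norm (y j - x j g') < \<eta>1) \<Longrightarrow> turning D (points y) ds \<Longrightarrow> int (length ts) + 1 \<le> turn_cost ds"
    using Cons.IH[OF srt g'b g'(3)] by blast
  let ?s = "sgn (det2 (x 0 g) (x 1 g))" and ?s' = "sgn (det2 (x 0 g') (x 1 g'))"
  have "0 < ?s * det2 (x 0 g) (x 1 g)" "0 < ?s' * det2 (x 0 g') (x 1 g')"
    using sgn_mult_pos[OF Cons.prems(5)] sgn_mult_pos[OF g'(3)] by blast+
  note sgns = this
  obtain \<eta>2 where \<eta>2: "0 < \<eta>2" "\<And>p q. norm (p - x 0 g) < \<eta>2 \<Longrightarrow> norm (q - x 1 g) < \<eta>2 \<Longrightarrow> 0 < ?s * det2 p q"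
    using det2_stable[OF sgns(1)] by blast
  obtain \<eta>3 where \<eta>3: "0 < \<eta>3" "\<And>p q. norm (p - x 0 g') < \<eta>3 \<Longrightarrow> norm (q - x 1 g') < \<eta>3 \<Longrightarrow> 0 < ?s' * det2 p q"
    using det2_stable[OF sgns(2)] by blast
  have ss: "?s \<noteq> 0" "?s' \<noteq> 0" "?s = 1 \<or> ?s = -1" "?s' = 1 \<or> ?s' = -1"
    using Cons.prems(5) g'(3) by (auto simp: sgn_if)
  show ?case
  proof (cases "?s' = ?s")
    case False
    obtain \<eta> where \<eta>: "0 < \<eta>" "\<And>y. (\<forall>j\<le>m. norm (y j - x j g) < \<eta>) \<Longrightarrow>
      \<exists>z. push\<^sup>*\<^sup>* (points y) (points z) \<and> (\<forall>j\<le>m. norm (z j - x j g') < min \<eta>1 \<eta>3)"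
      using flow[of g g' "min \<eta>1 \<eta>3"] Cons.prems g' g'b t \<eta>1(1) \<eta>3(1) by auto
    show ?thesis
    proof (intro exI[of _ "min \<eta> \<eta>2"] conjI allI impI)
      show "0 < min \<eta> \<eta>2" using \<eta> \<eta>2 by simp
      fix y D ds assume y: "\<forall>j\<le>m. norm (y j - x j g) < min \<eta> \<eta>2" and ds: "turning D (points y) ds"
      obtain z where z: "push\<^sup>*\<^sup>* (points y) (points z)" "\<forall>j\<le>m. norm (z j - x j g') < min \<eta>1 \<eta>3"
        using \<eta>(2)[of y] y by auto
      have "0 < ?s * det2 (y 0) (y 1)" "0 < ?s' * det2 (z 0) (z 1)"
        using \<eta>2(2)[of "y 0" "y 1"] \<eta>3(2)[of "z 0" "z 1"] y z(2) m by auto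
      then have opp: "det2 (y 0) (y 1) * det2 (z 0) (z 1) < 0"
        using ss False by (auto simp: mult_less_0_iff simp del: times_complex.sel)
      show "int (length (t # ts)) + 1 \<le> turn_cost ds"
        using cost_drop[OF z(1) opp ds, of "int (length ts) + 1"] \<eta>1(2)[of z] z(2) by auto
    qed
  next
    case True
    obtain \<eta>4 where \<eta>4: "0 < \<eta>4" "\<And>y. (\<forall>j\<le>m. norm (y j - x j t) < \<eta>4) \<Longrightarrow>
      \<exists>z. push\<^sup>*\<^sup>* (points y) (points z) \<and> (\<forall>j\<le>m. norm (z j - x j g') < min \<eta>1 \<eta>3)"
      using flow[of t g' "min \<eta>1 \<eta>3"] Cons.prems g' g'b t \<eta>1(1) \<eta>3(1) by auto
    obtain \<eta> where \<eta>: "0 < \<eta>" "\<And>y. (\<forall>j\<le>m. norm (y j - x j g) < \<eta>) \<Longrightarrow>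
      \<exists>z. push\<^sup>*\<^sup>* (points y) (points z) \<and> (\<forall>j\<le>m. norm (z j - x j t) < \<eta>4) \<and> 0 < - ?s * det2 (z 0) (z 1)"
      using flow_kick[of g t \<eta>4 "- ?s"] Cons.prems t \<eta>4(1) ss by auto
    show ?thesis
    proof (intro exI[of _ "min \<eta> \<eta>2"] conjI allI impI)
      show "0 < min \<eta> \<eta>2" using \<eta> \<eta>2 by simp
      fix y D ds assume y: "\<forall>j\<le>m. norm (y j - x j g) < min \<eta> \<eta>2" and ds: "turning D (points y) ds"
      obtain z where z: "push\<^sup>*\<^sup>* (points y) (points z)" "\<forall>j\<le>m. norm (z j - x j t) < \<eta>4" "0 < - ?s * det2 (z 0) (z 1)"
        using \<eta>(2)[of y] y by auto
      obtain w where w: "push\<^sup>*\<^sup>* (points z) (points w)" "\<forall>j\<le>m. norm (w j - x j g') < min \<eta>1 \<eta>3"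
        using \<eta>4(2)[OF z(2)] by auto
      have "0 < ?s * det2 (y 0) (y 1)" "0 < ?s' * det2 (w 0) (w 1)"
        using \<eta>2(2)[of "y 0" "y 1"] \<eta>3(2)[of "w 0" "w 1"] y w(2) m by auto
      then have opp: "det2 (y 0) (y 1) * det2 (z 0) (z 1) < 0" "det2 (z 0) (z 1) * det2 (w 0) (w 1) < 0"
        using ss True z(3) by (auto simp: mult_less_0_iff simp del: times_complex.sel)
      have "int (length ts) + 2 \<le> turn_cost es" if "turning E (points z) es" for E es
        using cost_drop[OF w(1) opp(2) that, of "int (length ts) + 1"] \<eta>1(2)[of w] w(2) by auto
      then show "int (length (t # ts)) + 1 \<le> turn_cost ds"
        using cost_drop[OF z(1) opp(1) ds, of "int (length ts) + 2"] by auto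
    qed
  qed
qed

lemma det2_scale: "det2 p (of_real k * q) = k * det2 p q"
  by (simp add: algebra_simps)

lemma det2_add_normal: "det2 (p + of_real k * (- \<i> * q)) q = det2 p q + k * (norm q)\<^sup>2"
  unfolding cmod_power2 by (simp add: algebra_simps power2_eq_square)

text \<open>
  A pair of parallel vectors can be moved slightly to either orientation.
\<close>
lemma exists_near_det2_sign:
  assumes "det2 p q = 0" "0 < \<epsilon>" "\<sigma> \<noteq> 0"
  shows "\<exists>p' q'. norm (p' - p) < \<epsilon> \<and> norm (q' - q) < \<epsilon> \<and> 0 < \<sigma> * det2 p' q'"
proof -
  have "\<exists>q'. norm (q' - q) < \<epsilon> \<and> det2 p q' = 0 \<and> q' \<noteq> 0"
  proof (cases "q = 0")
    case False
    then show ?thesis using assms by (intro exI[of _ q]) auto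
  next
    case True
    define r where "r = (if p = 0 then 1 else p)"
    have r: "r \<noteq> 0" "det2 p r = 0" unfolding r_def by auto
    define k where "k = \<epsilon> / (2 * norm r)"
    have "k \<noteq> 0" "\<bar>k\<bar> * norm r = \<epsilon> / 2" unfolding k_def using r(1) assms(2) by auto
    moreover have "det2 p (of_real k * r) = 0" unfolding det2_scale r(2) by simp
    ultimately show ?thesis
      using True r(1) assms(2) by (intro exI[of _ "of_real k * r"]) (simp add: norm_mult)
  qed
  then obtain q' where q': "norm (q' - q) < \<epsilon>" "det2 p q' = 0" "q' \<noteq> 0" by blast
  define k where "k = sgn \<sigma> * (\<epsilon> / (2 * norm q'))"
  have "norm (of_real k * (- \<i> * q')) = \<epsilon> / 2"
    unfolding norm_mult norm_of_real k_def using q'(3) assms(2,3) by (simp add: abs_mult abs_sgn_eq)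
  moreover have "\<sigma> * k = (\<sigma> * sgn \<sigma>) * (\<epsilon> / (2 * norm q'))" by (simp add: k_def)
  then have "0 < \<sigma> * k * (norm q')\<^sup>2"
    using q'(3) assms(2) sgn_mult_pos[OF assms(3)] by (simp add: mult.commute)
  then have "0 < \<sigma> * det2 (p + of_real k * (- \<i> * q')) q'"
    unfolding det2_add_normal q'(2) by (simp add: mult.assoc)
  ultimately show ?thesis
    using q'(1) assms(2) by (intro exI[of _ "p + of_real k * (- \<i> * q')"] exI[of _ q']) simp
qed

text \<open>
  The polygon starts at the smallest zero, slightly displaced so that its determinant has the sign opposite
  to the one just after this zero; thus the smallest zero is paid for as well. Initially the cost is at most \<open>2 * m - 2\<close>
  because the last two vertices are parallel, and a cost of at least 1 remains in the end.
\<close>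
lemma card_det2_zeros_le:
  assumes "finite Z" "Z \<subseteq> {a..<b}" "\<And>t. t \<in> Z \<Longrightarrow> det2 (x 0 t) (x 1 t) = 0"
    and par: "\<And>t. t \<in> {a..<b} \<Longrightarrow> det2 (x (m - 1) t) (x m t) = 0"
  shows "card Z \<le> 2 * m - 3"
proof (cases "Z = {}")
  case False
  obtain t ts where ts: "sorted_list_of_set Z = t # ts"
    using False assms(1) by (cases "sorted_list_of_set Z") auto
  have srt: "sorted_wrt (<) (t # ts)" unfolding ts[symmetric] by (rule strict_sorted_list_of_set)
  have elems: "set (t # ts) = Z" and len: "length (t # ts) = card Z"
    unfolding ts[symmetric] using assms(1) by simp_all
  define q where "q = (if ts = [] then b else hd ts)"
  have t: "a \<le> t" "t < b" "det2 (x 0 t) (x 1 t) = 0" using elems assms by auto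
  have zs: "\<forall>u\<in>set ts. t < u \<and> u < b \<and> det2 (x 0 u) (x 1 u) = 0" using srt elems assms by auto
  have q: "t < q" "q \<le> b" using zs t unfolding q_def by (cases ts; auto)+
  have q': "q \<le> u" if "u \<in> set ts" for u using srt that unfolding q_def by (cases ts) (auto simp: less_imp_le)
  obtain g where g: "t < g" "g < q" "det2 (x 0 g) (x 1 g) \<noteq> 0"
    using exists_det2_nonzero[of t q] q t by auto
  have gb: "a \<le> g" "g < b" using g q t by auto
  have srt': "sorted_wrt (<) ts" "\<forall>u\<in>set ts. g < u \<and> u < b \<and> det2 (x 0 u) (x 1 u) = 0"
    using srt zs g q' by (auto intro: less_le_trans)
  obtain \<eta>1 where \<eta>1: "0 < \<eta>1" "\<And>y D ds. (\<forall>j\<le>m. norm (y j - x j g) < \<eta>1) \<Longrightarrow> turning D (points y) ds \<Longrightarrow> int (length ts) + 1 \<le> turn_cost ds"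
    using zeros_le_turn_cost[OF srt' gb g(3)] by blast
  let ?s = "sgn (det2 (x 0 g) (x 1 g))"
  have ss: "?s \<noteq> 0" "?s = 1 \<or> ?s = -1" using g(3) by (auto simp: sgn_if)
  have sgns: "0 < ?s * det2 (x 0 g) (x 1 g)" using sgn_mult_pos[OF g(3)] .
  obtain \<eta>2 where \<eta>2: "0 < \<eta>2" "\<And>p q. norm (p - x 0 g) < \<eta>2 \<Longrightarrow> norm (q - x 1 g) < \<eta>2 \<Longrightarrow> 0 < ?s * det2 p q"
    using det2_stable[OF sgns] by blast
  obtain \<eta> where \<eta>: "0 < \<eta>" "\<And>y. (\<forall>j\<le>m. norm (y j - x j t) < \<eta>) \<Longrightarrow>
      \<exists>z. push\<^sup>*\<^sup>* (points y) (points z) \<and> (\<forall>j\<le>m. norm (z j - x j g) < min \<eta>1 \<eta>2)"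
    using flow[of t g "min \<eta>1 \<eta>2"] g gb t \<eta>1(1) \<eta>2(1) by auto
  obtain p q where pq: "norm (p - x 0 t) < \<eta>" "norm (q - x 1 t) < \<eta>" "0 < - ?s * det2 p q"
    using exists_near_det2_sign[OF t(3) \<eta>(1), of "- ?s"] ss(1) by auto
  \<comment> \<open>The last two vertices are not displaced, since \<open>3 \<le> m\<close>; they remain parallel.\<close>
  define y where "y = (\<lambda>j. x j t)(0 := p, 1 := q)"
  have y: "y 0 = p" "y 1 = q" "\<forall>j\<le>m. norm (y j - x j t) < \<eta>" unfolding y_def using pq \<eta>(1) by auto
  obtain z where z: "push\<^sup>*\<^sup>* (points y) (points z)" "\<forall>j\<le>m. norm (z j - x j g) < min \<eta>1 \<eta>2"
    using \<eta>(2)[OF y(3)] by blast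
  have "last (points y) = x m t" using m unfolding y_def by simp
  moreover have "last (butlast (points y)) = x (m - 1) t" using m unfolding y_def by (cases m) (auto simp: butlast_append)
  ultimately obtain D ds where ds: "turning D (points y) ds" "turn_cost ds \<le> 2 * int (length (points y)) - 4"
    using turning_exists_le[of "points y"] par[of t] t m by auto
  have "0 < ?s * det2 (z 0) (z 1)" using \<eta>2(2)[of "z 0" "z 1"] z(2) m by auto
  then have opp: "det2 (y 0) (y 1) * det2 (z 0) (z 1) < 0"
    using ss pq(3) unfolding y(1,2) by (auto simp: mult_less_0_iff simp del: times_complex.sel)
  have "int (length ts) + 2 \<le> turn_cost ds"
    using cost_drop[OF z(1) opp ds(1), of "int (length ts) + 1"] \<eta>1(2)[of z] z(2) by auto
  then show ?thesis using ds(2) len m by auto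
qed simp

end

section \<open>Smoothness and orders of vanishing on an interval\<close>

text \<open>
  The condition makes derivatives within \<open>J\<close> unique, including one-sided ones at end points of \<open>J\<close>.
\<close>
locale thick =
  fixes J :: "real set"
  assumes thick: "s \<in> J \<Longrightarrow> at s within J \<noteq> bot"
begin

abbreviation vderiv :: "(real \<Rightarrow> 'a::real_normed_vector) \<Rightarrow> real \<Rightarrow> 'a" where
  "vderiv f \<equiv> (\<lambda>t. vector_derivative f (at t within J))"

lemma nderiv_0: "nderiv J 0 f = f"
  by (simp add: nderiv_def)

lemma nderiv_Suc: "nderiv J (Suc k) f = nderiv J k (vderiv f)"
  unfolding nderiv_def by (simp only: funpow_Suc_right comp_apply)

lemma vderiv_eqI: "s \<in> J \<Longrightarrow> (f has_vector_derivative f') (at s within J) \<Longrightarrow> vderiv f s = f'"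
  by (rule vector_derivative_within[OF thick])

lemma vderiv_cong:
  assumes "open U" "\<And>s. s \<in> J \<inter> U \<Longrightarrow> f s = g s" "s \<in> J \<inter> U"
  shows "vderiv f s = vderiv g s"
  using assms by (intro vector_derivative_cong_eq) (auto simp: eventually_nhds)

lemma nderiv_cong:
  assumes "open U" "\<And>s. s \<in> J \<inter> U \<Longrightarrow> f s = g s" "s \<in> J \<inter> U"
  shows "nderiv J k f s = nderiv J k g s"
  using assms(2,3)
proof (induction k arbitrary: f g)
  case 0
  then show ?case by (simp add: nderiv_0)
next
  case (Suc k)
  show ?case unfolding nderiv_Suc
    using Suc vderiv_cong[OF assms(1)] by (intro Suc.IH) blast+
qed

definition cdiff :: "real set \<Rightarrow> nat \<Rightarrow> (real \<Rightarrow> 'a::real_normed_vector) \<Rightarrow> bool" where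
  "cdiff U k f \<longleftrightarrow> (\<forall>i<k. \<forall>s\<in>J \<inter> U. nderiv J i f differentiable (at s within J))"

lemma cdiff_0: "cdiff U 0 f"
  by (simp add: cdiff_def)

lemma cdiff_Suc: "cdiff U (Suc k) f \<longleftrightarrow> (\<forall>s\<in>J \<inter> U. f differentiable (at s within J)) \<and> cdiff U k (vderiv f)"
proof -
  have "(\<forall>i<Suc k. P i) \<longleftrightarrow> P 0 \<and> (\<forall>i<k. P (Suc i))" for P
    using less_Suc_eq_0_disj by auto
  then show ?thesis unfolding cdiff_def by (simp only: nderiv_0 nderiv_Suc)
qed

lemma cdiff_mono: "cdiff U k f \<Longrightarrow> i \<le> k \<Longrightarrow> cdiff U i f"
  unfolding cdiff_def by auto

lemma cdiff_subset: "cdiff U k f \<Longrightarrow> V \<subseteq> U \<Longrightarrow> cdiff V k f"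
  unfolding cdiff_def by blast

lemma cdiff_SucD: "cdiff U (Suc k) f \<Longrightarrow> cdiff U k f"
  by (erule cdiff_mono) simp

lemma cdiff_cong:
  assumes "open U" "\<And>s. s \<in> J \<inter> U \<Longrightarrow> f s = g s" "cdiff U k f"
  shows "cdiff U k g"
proof -
  have "nderiv J i g differentiable (at s within J)" if "i < k" "s \<in> J \<inter> U" for i s
  proof -
    have "nderiv J i f differentiable (at s within J)"
      using assms(3) that unfolding cdiff_def by blast
    then obtain D where D: "(nderiv J i f has_derivative D) (at s within J)"
      unfolding differentiable_def by blast
    have "\<forall>\<^sub>F x in at s within J. nderiv J i f x = nderiv J i g x"
      unfolding eventually_at_filter eventually_nhds
      using assms(1) that(2) nderiv_cong[OF assms(1,2)] by (intro exI[of _ U]) auto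
    then have "(nderiv J i g has_derivative D) (at s within J)"
      using D that(2) nderiv_cong[OF assms(1,2) that(2)] by (intro has_derivative_transform_eventually[OF D]) auto
    then show ?thesis unfolding differentiable_def by blast
  qed
  then show ?thesis unfolding cdiff_def by blast
qed

lemma cdiff_has_vderiv: "cdiff U (Suc k) f \<Longrightarrow> s \<in> J \<inter> U \<Longrightarrow> (f has_vector_derivative vderiv f s) (at s within J)"
  unfolding cdiff_Suc by (simp add: vector_derivative_works)

lemma cdiff_SucI:
  assumes "open U" "\<And>s. s \<in> J \<inter> U \<Longrightarrow> (f has_vector_derivative f' s) (at s within J)" "cdiff U k f'"
  shows "cdiff U (Suc k) f"
  unfolding cdiff_Suc
proof
  show "\<forall>s\<in>J \<inter> U. f differentiable (at s within J)"
    using assms(2) differentiableI_vector by blast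
  show "cdiff U k (vderiv f)"
  proof (rule cdiff_cong[OF assms(1) _ assms(3)])
    show "f' s = vderiv f s" if "s \<in> J \<inter> U" for s
      using vderiv_eqI[OF _ assms(2)[OF that]] that by simp
  qed
qed

lemma cdiff_const: "open U \<Longrightarrow> cdiff U k (\<lambda>_. c)"
proof (induction k arbitrary: c)
  case (Suc k)
  then show ?case by (intro cdiff_SucI[where f' = "\<lambda>_. 0"]) auto
qed (simp add: cdiff_0)

lemma cdiff_add: "open U \<Longrightarrow> cdiff U k f \<Longrightarrow> cdiff U k g \<Longrightarrow> cdiff U k (\<lambda>t. f t + g t)"
proof (induction k arbitrary: f g)
  case (Suc k)
  show ?case
  proof (rule cdiff_SucI[OF Suc.prems(1)])
    show "((\<lambda>t. f t + g t) has_vector_derivative vderiv f s + vderiv g s) (at s within J)" if "s \<in> J \<inter> U" for s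
      using cdiff_has_vderiv[OF Suc.prems(2) that] cdiff_has_vderiv[OF Suc.prems(3) that]
      by (rule has_vector_derivative_add)
    show "cdiff U k (\<lambda>s. vderiv f s + vderiv g s)"
      using Suc.prems unfolding cdiff_Suc by (intro Suc.IH) blast+
  qed
qed (simp add: cdiff_0)

lemma cdiff_scaleR: "open U \<Longrightarrow> cdiff U k f \<Longrightarrow> cdiff U k g \<Longrightarrow> cdiff U k (\<lambda>t. f t *\<^sub>R g t)"
proof (induction k arbitrary: f g)
  case (Suc k)
  show ?case
  proof (rule cdiff_SucI[OF Suc.prems(1)])
    show "((\<lambda>t. f t *\<^sub>R g t) has_vector_derivative f s *\<^sub>R vderiv g s + vderiv f s *\<^sub>R g s) (at s within J)" if "s \<in> J \<inter> U" for s
      using cdiff_has_vderiv[OF Suc.prems(2) that] cdiff_has_vderiv[OF Suc.prems(3) that]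
      by (intro has_vector_derivative_scaleR) (simp_all add: has_real_derivative_iff_has_vector_derivative)
    have "cdiff U k f" "cdiff U k g" "cdiff U k (vderiv f)" "cdiff U k (vderiv g)"
      using Suc.prems cdiff_SucD unfolding cdiff_Suc by blast+
    then show "cdiff U k (\<lambda>s. f s *\<^sub>R vderiv g s + vderiv f s *\<^sub>R g s)"
      using Suc.prems(1) by (intro cdiff_add Suc.IH)
  qed
qed (simp add: cdiff_0)

lemma cdiff_inverse:
  fixes f :: "real \<Rightarrow> real"
  shows "open U \<Longrightarrow> (\<And>s. s \<in> J \<inter> U \<Longrightarrow> f s \<noteq> 0) \<Longrightarrow> cdiff U k f \<Longrightarrow> cdiff U k (\<lambda>t. inverse (f t))"
proof (induction k)
  case (Suc k)
  show ?case
  proof (rule cdiff_SucI[OF Suc.prems(1)])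
    show "((\<lambda>t. inverse (f t)) has_vector_derivative (- 1) *\<^sub>R (vderiv f s *\<^sub>R (inverse (f s) *\<^sub>R inverse (f s)))) (at s within J)" if "s \<in> J \<inter> U" for s
      using DERIV_inverse'[of f "vderiv f s" s J] cdiff_has_vderiv[OF Suc.prems(3) that] Suc.prems(2)[OF that]
      by (simp add: has_real_derivative_iff_has_vector_derivative mult_ac)
    have "cdiff U k (\<lambda>t. inverse (f t))" "cdiff U k (vderiv f)"
      using Suc cdiff_SucD unfolding cdiff_Suc by blast+
    then show "cdiff U k (\<lambda>s. (- 1) *\<^sub>R (vderiv f s *\<^sub>R (inverse (f s) *\<^sub>R inverse (f s))))"
      using Suc.prems(1) by (intro cdiff_scaleR cdiff_const)
  qed
qed (simp add: cdiff_0)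

lemma cdiff_bounded_linear:
  assumes "bounded_linear l" "open U"
  shows "cdiff U k f \<Longrightarrow> cdiff U k (\<lambda>t. l (f t))"
proof (induction k arbitrary: f)
  case (Suc k)
  show ?case
    using cdiff_has_vderiv[OF Suc.prems] Suc.IH[of "vderiv f"] Suc.prems bounded_linear.has_vector_derivative[OF assms(1)]
    unfolding cdiff_Suc[of U k f] by (intro cdiff_SucI[OF assms(2), where f' = "\<lambda>t. l (vderiv f t)"]) blast+
qed (simp add: cdiff_0)

definition smooth_at :: "(real \<Rightarrow> 'a::real_normed_vector) \<Rightarrow> real \<Rightarrow> bool" where
  "smooth_at f t \<longleftrightarrow> (\<exists>U. open U \<and> t \<in> U \<and> (\<forall>k. cdiff U k f))"

lemma smooth_at_open: "smooth_at f t \<Longrightarrow> \<exists>U. open U \<and> t \<in> U \<and> (\<forall>s\<in>U. smooth_at f s)"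
  unfolding smooth_at_def by blast

lemma smooth_at_cong:
  assumes "open U" "t \<in> U" "\<And>s. s \<in> J \<inter> U \<Longrightarrow> f s = g s" "smooth_at f t"
  shows "smooth_at g t"
proof -
  obtain V where V: "open V" "t \<in> V" "\<And>k. cdiff V k f" using assms(4) unfolding smooth_at_def by blast
  have "cdiff (U \<inter> V) k g" for k
    using assms V by (intro cdiff_cong[OF _ _ cdiff_subset[OF V(3)]]) auto
  then show ?thesis
    unfolding smooth_at_def using assms V by (intro exI[of _ "U \<inter> V"]) auto
qed

lemma smooth_at_combine:
  assumes "\<And>U k. open U \<Longrightarrow> cdiff U k f \<Longrightarrow> cdiff U k g \<Longrightarrow> cdiff U k h" "smooth_at f t" "smooth_at g t"
  shows "smooth_at h t"
proof -
  obtain U V where "open U" "t \<in> U" "\<And>k. cdiff U k f" "open V" "t \<in> V" "\<And>k. cdiff V k g"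
    using assms(2,3) unfolding smooth_at_def by blast
  then show ?thesis
    unfolding smooth_at_def by (intro exI[of _ "U \<inter> V"]) (auto intro!: assms(1) intro: cdiff_subset)
qed

lemma smooth_at_scaleR: "smooth_at f t \<Longrightarrow> smooth_at g t \<Longrightarrow> smooth_at (\<lambda>t. f t *\<^sub>R g t) t"
  by (rule smooth_at_combine[OF cdiff_scaleR])

lemma smooth_at_bounded_linear: "bounded_linear l \<Longrightarrow> smooth_at f t \<Longrightarrow> smooth_at (\<lambda>t. l (f t)) t"
  by (rule smooth_at_combine[of f f]) (auto intro: cdiff_bounded_linear)

lemma smooth_at_has_vderiv: "smooth_at f t \<Longrightarrow> t \<in> J \<Longrightarrow> (f has_vector_derivative vderiv f t) (at t within J)"
  unfolding smooth_at_def by (meson IntI cdiff_has_vderiv)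

lemma smooth_at_vderiv: "smooth_at f t \<Longrightarrow> smooth_at (vderiv f) t"
  unfolding smooth_at_def using cdiff_Suc by blast

lemma smooth_at_continuous: "smooth_at f t \<Longrightarrow> t \<in> J \<Longrightarrow> continuous (at t within J) f"
  using smooth_at_has_vderiv has_vector_derivative_continuous by blast

lemma nonzero_near:
  fixes f :: "real \<Rightarrow> 'a::real_normed_vector"
  assumes "smooth_at f t" "t \<in> J" "f t \<noteq> 0"
  shows "\<exists>U. open U \<and> t \<in> U \<and> (\<forall>s\<in>J \<inter> U. f s \<noteq> 0)"
proof -
  have "\<forall>\<^sub>F s in at t within J. f s \<noteq> 0"
    using smooth_at_continuous[OF assms(1,2)] assms(3) tendsto_imp_eventually_ne[of f "f t"]
    unfolding continuous_within by blast
  then obtain U where U: "open U" "t \<in> U" "\<forall>s\<in>U. s \<noteq> t \<longrightarrow> s \<in> J \<longrightarrow> f s \<noteq> 0"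
    unfolding eventually_at_topological by blast
  then have "\<forall>s\<in>J \<inter> U. f s \<noteq> 0" using assms(3) by auto
  then show ?thesis using U by blast
qed

lemma smooth_at_inverse:
  fixes f :: "real \<Rightarrow> real"
  assumes "smooth_at f t" "t \<in> J" "f t \<noteq> 0"
  shows "smooth_at (\<lambda>t. inverse (f t)) t"
proof -
  obtain U where U: "open U" "t \<in> U" "\<And>s. s \<in> J \<inter> U \<Longrightarrow> f s \<noteq> 0" using nonzero_near[OF assms] by blast
  obtain V where V: "open V" "t \<in> V" "\<And>k. cdiff V k f" using assms(1) unfolding smooth_at_def by blast
  have "cdiff (U \<inter> V) k (\<lambda>t. inverse (f t))" for k
    using U V by (intro cdiff_inverse cdiff_subset[OF V(3)]) auto
  then show ?thesis
    unfolding smooth_at_def using U V by (intro exI[of _ "U \<inter> V"]) auto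
qed

definition vanishes :: "nat \<Rightarrow> (real \<Rightarrow> 'a::real_normed_vector) \<Rightarrow> real \<Rightarrow> bool" where
  "vanishes k f t \<longleftrightarrow> (\<forall>i<k. nderiv J i f t = 0)"

lemma vanishes_0: "vanishes 0 f t"
  by (simp add: vanishes_def)

lemma vanishes_Suc: "vanishes (Suc k) f t \<longleftrightarrow> f t = 0 \<and> vanishes k (vderiv f) t"
proof -
  have "(\<forall>i<Suc k. P i) \<longleftrightarrow> P 0 \<and> (\<forall>i<k. P (Suc i))" for P
    using less_Suc_eq_0_disj by auto
  then show ?thesis unfolding vanishes_def by (simp only: nderiv_0 nderiv_Suc)
qed

lemma vanishes_mono: "vanishes k f t \<Longrightarrow> i \<le> k \<Longrightarrow> vanishes i f t"
  unfolding vanishes_def by auto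

lemma vanishes_cong:
  assumes "open U" "t \<in> J \<inter> U" "\<And>s. s \<in> J \<inter> U \<Longrightarrow> f s = g s"
  shows "vanishes k f t \<longleftrightarrow> vanishes k g t"
  unfolding vanishes_def using nderiv_cong[OF assms(1,3,2)] by simp

text \<open>
  Rules for derivatives are lifted to a neighbourhood, which is what allows them to be differentiated again.
\<close>
lemma vderiv_near_eqI:
  assumes "t \<in> J" "smooth_at f t" "smooth_at g t"
    and "\<And>s. s \<in> J \<Longrightarrow> (f has_vector_derivative vderiv f s) (at s within J) \<Longrightarrow>
      (g has_vector_derivative vderiv g s) (at s within J) \<Longrightarrow> (h has_vector_derivative h' s) (at s within J)"
  shows "\<exists>U. open U \<and> t \<in> U \<and> (\<forall>s\<in>J \<inter> U. vderiv h s = h' s)"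
proof -
  obtain U where U: "open U" "t \<in> U" "\<forall>s\<in>U. smooth_at f s" using smooth_at_open[OF assms(2)] by blast
  obtain V where V: "open V" "t \<in> V" "\<forall>s\<in>V. smooth_at g s" using smooth_at_open[OF assms(3)] by blast
  have "vderiv h s = h' s" if s: "s \<in> J \<inter> (U \<inter> V)" for s
  proof -
    have "s \<in> J" "smooth_at f s" "smooth_at g s" using s U V by auto
    then show ?thesis by (intro vderiv_eqI assms(4) smooth_at_has_vderiv)
  qed
  then show ?thesis using U V by (intro exI[of _ "U \<inter> V"]) (simp add: open_Int)
qed

lemma vanishes_add:
  "t \<in> J \<Longrightarrow> smooth_at f t \<Longrightarrow> smooth_at g t \<Longrightarrow> vanishes k f t \<Longrightarrow> vanishes k g t \<Longrightarrow> vanishes k (\<lambda>t. f t + g t) t"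
proof (induction k arbitrary: f g)
  case (Suc k)
  have "\<exists>U. open U \<and> t \<in> U \<and> (\<forall>s\<in>J \<inter> U. vderiv (\<lambda>t. f t + g t) s = vderiv f s + vderiv g s)"
    by (rule vderiv_near_eqI[OF Suc.prems(1-3)]) (rule has_vector_derivative_add)
  then obtain U where U: "open U" "t \<in> U" "\<And>s. s \<in> J \<inter> U \<Longrightarrow> vderiv (\<lambda>t. f t + g t) s = vderiv f s + vderiv g s"
    by blast
  have "vanishes k (\<lambda>s. vderiv f s + vderiv g s) t"
    using Suc.prems unfolding vanishes_Suc by (intro Suc.IH smooth_at_vderiv) auto
  then show ?case
    using Suc.prems vanishes_cong[OF U(1) _ U(3)] U(2) unfolding vanishes_Suc by auto
qed (simp add: vanishes_0)

lemma vanishes_scaleR: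
  "t \<in> J \<Longrightarrow> smooth_at f t \<Longrightarrow> smooth_at g t \<Longrightarrow> vanishes k g t \<Longrightarrow> vanishes k (\<lambda>t. f t *\<^sub>R g t) t"
proof (induction k arbitrary: f g)
  case (Suc k)
  have der: "((\<lambda>t. f t *\<^sub>R g t) has_vector_derivative f s *\<^sub>R vderiv g s + vderiv f s *\<^sub>R g s) (at s within J)"
    if "(f has_vector_derivative vderiv f s) (at s within J)" "(g has_vector_derivative vderiv g s) (at s within J)" for s
    using that by (intro has_vector_derivative_scaleR) (simp_all add: has_real_derivative_iff_has_vector_derivative)
  have "\<exists>U. open U \<and> t \<in> U \<and> (\<forall>s\<in>J \<inter> U. vderiv (\<lambda>t. f t *\<^sub>R g t) s = f s *\<^sub>R vderiv g s + vderiv f s *\<^sub>R g s)"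
    by (rule vderiv_near_eqI[OF Suc.prems(1-3)]) (rule der)
  then obtain U where U: "open U" "t \<in> U" "\<And>s. s \<in> J \<inter> U \<Longrightarrow> vderiv (\<lambda>t. f t *\<^sub>R g t) s = f s *\<^sub>R vderiv g s + vderiv f s *\<^sub>R g s"
    by blast
  have g: "vanishes k g t" "vanishes k (vderiv g) t"
    using vanishes_mono[OF Suc.prems(4), of k] Suc.prems(4) unfolding vanishes_Suc by auto
  note sm = smooth_at_vderiv[OF Suc.prems(2)] smooth_at_vderiv[OF Suc.prems(3)]
  have *: "vanishes k (\<lambda>s. f s *\<^sub>R vderiv g s + vderiv f s *\<^sub>R g s) t"
    by (rule vanishes_add[OF Suc.prems(1) smooth_at_scaleR[OF Suc.prems(2) sm(2)] smooth_at_scaleR[OF sm(1) Suc.prems(3)]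
          Suc.IH[OF Suc.prems(1,2) sm(2) g(2)] Suc.IH[OF Suc.prems(1) sm(1) Suc.prems(3) g(1)]])
  have "vanishes k (vderiv (\<lambda>t. f t *\<^sub>R g t)) t \<longleftrightarrow> vanishes k (\<lambda>s. f s *\<^sub>R vderiv g s + vderiv f s *\<^sub>R g s) t"
    by (rule vanishes_cong[OF U(1) _ U(3)]) (use U(2) Suc.prems(1) in simp_all)
  from this[THEN iffD2, OF *] have "vanishes k (vderiv (\<lambda>t. f t *\<^sub>R g t)) t" .
  then show ?case using Suc.prems(4) unfolding vanishes_Suc by simp
qed (simp add: vanishes_0)

text \<open>
  This is why orders of vanishing do not depend on the scaling of a lift.
\<close>
lemma vanishes_scaleR_iff:
  assumes "t \<in> J" "smooth_at f t" "smooth_at g t" "f t \<noteq> 0"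
  shows "vanishes k (\<lambda>t. f t *\<^sub>R g t) t \<longleftrightarrow> vanishes k g t"
proof
  assume *: "vanishes k (\<lambda>t. f t *\<^sub>R g t) t"
  obtain U where U: "open U" "t \<in> U" "\<And>s. s \<in> J \<inter> U \<Longrightarrow> f s \<noteq> 0"
    using nonzero_near[OF assms(2,1,4)] by blast
  have "vanishes k (\<lambda>t. inverse (f t) *\<^sub>R (f t *\<^sub>R g t)) t"
    by (rule vanishes_scaleR[OF assms(1) smooth_at_inverse[OF assms(2,1,4)] smooth_at_scaleR[OF assms(2,3)] *])
  then show "vanishes k g t"
    using vanishes_cong[OF U(1), of t "\<lambda>t. inverse (f t) *\<^sub>R (f t *\<^sub>R g t)" g k] U assms(1) by simp
next
  show "vanishes k (\<lambda>t. f t *\<^sub>R g t) t" if "vanishes k g t"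
    by (rule vanishes_scaleR[OF assms(1-3) that])
qed

lemma nderiv_bounded_linear:
  assumes "bounded_linear l" "t \<in> J"
  shows "smooth_at f t \<Longrightarrow> nderiv J k (\<lambda>t. l (f t)) t = l (nderiv J k f t)"
proof (induction k arbitrary: f)
  case 0
  then show ?case by (simp add: nderiv_0)
next
  case (Suc k)
  have "\<exists>U. open U \<and> t \<in> U \<and> (\<forall>s\<in>J \<inter> U. vderiv (\<lambda>t. l (f t)) s = l (vderiv f s))"
    by (rule vderiv_near_eqI[OF assms(2) Suc.prems Suc.prems]) (rule bounded_linear.has_vector_derivative[OF assms(1)])
  then obtain U where U: "open U" "t \<in> U" "\<And>s. s \<in> J \<inter> U \<Longrightarrow> vderiv (\<lambda>t. l (f t)) s = l (vderiv f s)"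
    by blast
  have "nderiv J (Suc k) (\<lambda>t. l (f t)) t = nderiv J k (\<lambda>s. l (vderiv f s)) t"
    unfolding nderiv_Suc using U assms(2) by (intro nderiv_cong[OF U(1)]) auto
  also have "\<dots> = l (nderiv J k (vderiv f) t)"
    using Suc smooth_at_vderiv by blast
  finally show ?case unfolding nderiv_Suc .
qed

end

section \<open>Lifts, multiplicities and osculating flags\<close>

lemma linear_form_separates:
  fixes x :: "'a::euclidean_space"
  assumes "subspace S" "x \<notin> S"
  shows "\<exists>l :: 'a \<Rightarrow> real. linear l \<and> (\<forall>y\<in>S. l y = 0) \<and> l x \<noteq> 0"
proof -
  obtain y z where yz: "y \<in> span S" "\<And>w. w \<in> span S \<Longrightarrow> orthogonal z w" "x = y + z"
    using orthogonal_subspace_decomp_exists[of S x] by blast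
  have S: "span S = S" using assms(1) by (simp add: span_eq_iff)
  have "z \<noteq> 0" using yz assms(2) S by auto
  have "linear (\<lambda>w. z \<bullet> w)" by (rule bounded_linear.linear[OF bounded_linear_inner_right])
  moreover have "\<forall>y\<in>S. z \<bullet> y = 0" using yz(2) S by (auto simp: orthogonal_def)
  moreover have "z \<bullet> x \<noteq> 0"
    using yz(2)[OF yz(1)] \<open>z \<noteq> 0\<close> unfolding yz(3) inner_add_right by (simp add: orthogonal_def)
  ultimately show ?thesis by blast
qed

text \<open>
  Osculating spaces are compared through their annihilators, which orders of vanishing describe
  independently of the choice of a lift.
\<close>
lemma subspace_le_annihilators:
  fixes S S' :: "'a::euclidean_space set"
  assumes "subspace S'" "\<And>l :: 'a \<Rightarrow> real. linear l \<Longrightarrow> (\<forall>x\<in>S'. l x = 0) \<Longrightarrow> (\<forall>x\<in>S. l x = 0)"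
  shows "S \<subseteq> S'"
proof
  fix x assume "x \<in> S"
  show "x \<in> S'"
  proof (rule ccontr)
    assume "x \<notin> S'"
    then obtain l :: "'a \<Rightarrow> real" where "linear l" "\<forall>y\<in>S'. l y = 0" "l x \<noteq> 0"
      using linear_form_separates[OF assms(1)] by blast
    then show False using assms(2)[of l] \<open>x \<in> S\<close> by blast
  qed
qed

lemma linear_vanishes_on_span:
  fixes l :: "'a::real_vector \<Rightarrow> real"
  assumes "linear l"
  shows "(\<forall>x\<in>span B. l x = 0) \<longleftrightarrow> (\<forall>x\<in>B. l x = 0)"
  using linear_eq_0_on_span[OF assms] span_superset by blast

lemma exists_dual_basis:
  fixes D :: "nat \<Rightarrow> real ^ 'n"
  assumes "\<And>l :: real ^ 'n \<Rightarrow> real. linear l \<Longrightarrow> (\<And>i. i < CARD('n) \<Longrightarrow> l (D i) = 0) \<Longrightarrow> l = (\<lambda>_. 0)"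
  shows "\<exists>u :: nat \<Rightarrow> real ^ 'n \<Rightarrow> real. (\<forall>j. linear (u j)) \<and> (\<forall>i<CARD('n). \<forall>j<CARD('n). u j (D i) = (if i = j then 1 else 0))
    \<and> (\<forall>w. w = (\<Sum>i<CARD('n). u i w *\<^sub>R D i))"
proof -
  define B where "B = D ` {..<CARD('n)}"
  have fin: "finite B" and card: "card B \<le> CARD('n)" unfolding B_def using card_image_le[of "{..<CARD('n)}" D] by auto
  have "UNIV \<subseteq> span B"
  proof (rule subspace_le_annihilators)
    fix l :: "real ^ 'n \<Rightarrow> real" assume l: "linear l" "\<forall>x\<in>span B. l x = 0"
    then have "l = (\<lambda>_. 0)" by (intro assms) (auto simp: B_def intro: span_base)
    then show "\<forall>x\<in>UNIV. l x = 0" by simp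
  qed simp
  then have span: "span B = UNIV" by blast
  have dimU: "dim (UNIV :: (real ^ 'n) set) = CARD('n)" by (simp add: dim_UNIV)
  have ind: "independent B" using span fin card dimU by (intro card_le_dim_spanning[of B UNIV]) auto
  have "card B = CARD('n)" using dim_span_eq_card_independent[OF ind] unfolding span dimU by simp
  then have inj: "inj_on D {..<CARD('n)}" unfolding B_def by (intro eq_card_imp_inj_on) auto
  define f where "f = (\<lambda>j x. if x = D j then 1 else 0 :: real)"
  have "\<exists>g. linear g \<and> (\<forall>x\<in>B. g x = f j x)" for j by (rule linear_independent_extend[OF ind])
  then obtain u where u: "\<And>j. linear (u j)" "\<And>j x. x \<in> B \<Longrightarrow> u j x = f j x" by metis
  have uD: "u j (D i) = (if i = j then 1 else 0)" if "i < CARD('n)" "j < CARD('n)" for i j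
    using u(2)[of "D i" j] inj_onD[OF inj, of i j] that unfolding B_def f_def by auto
  have lin: "linear (\<lambda>w. (\<Sum>i<CARD('n). u i w *\<^sub>R D i))"
    by (rule linearI)
      (simp_all add: linear_add[OF u(1)] linear_scale[OF u(1)] scaleR_add_left sum.distrib scaleR_sum_right)
  have "w = (\<Sum>i<CARD('n). u i w *\<^sub>R D i)" for w
  proof -
    have "(\<lambda>w. w) w = (\<lambda>w. \<Sum>i<CARD('n). u i w *\<^sub>R D i) w"
    proof (rule linear_eq_on_span[OF linear_ident lin])
      show "w \<in> span B" using span by simp
      fix x assume "x \<in> B"
      then obtain j where j: "j < CARD('n)" "x = D j" unfolding B_def by auto
      have "(\<Sum>i<CARD('n). u i x *\<^sub>R D i) = (\<Sum>i<CARD('n). if i = j then D j else 0)"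
        using j uD by (intro sum.cong) auto
      then show "x = (\<Sum>i<CARD('n). u i x *\<^sub>R D i)" using j by simp
    qed
    then show ?thesis .
  qed
  then show ?thesis using u(1) uD by blast
qed

lemma enat_le_vanishing_order: "enat k \<le> vanishing_order J g t \<longleftrightarrow> (\<forall>i<k. nderiv J i g t = 0)"
proof (cases "\<exists>k. nderiv J k g t \<noteq> 0")
  case True
  let ?m = "LEAST k. nderiv J k g t \<noteq> 0"
  have "nderiv J ?m g t \<noteq> 0" using True by (rule LeastI_ex)
  moreover have "nderiv J i g t = 0" if "i < ?m" for i using not_less_Least[OF that] by blast
  ultimately have "k \<le> ?m \<longleftrightarrow> (\<forall>i<k. nderiv J i g t = 0)"
    using not_less[of ?m k] less_le_trans[of _ k ?m] by blast
  then show ?thesis using True unfolding vanishing_order_def by simp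
qed (auto simp: vanishing_order_def)

context thick
begin

lemma local_liftD:
  assumes "local_lift J c t v"
  shows "smooth_at v t" "\<exists>U. open U \<and> t \<in> U \<and> (\<forall>s\<in>J \<inter> U. v s \<noteq> 0 \<and> c s = span {v s} \<and> local_lift J c s v)"
proof -
  obtain U where U: "open U" "t \<in> U" "\<forall>k. \<forall>s\<in>J \<inter> U. nderiv J k v differentiable (at s within J)"
    "\<forall>s\<in>J \<inter> U. v s \<noteq> 0 \<and> c s = span {v s}"
    using assms unfolding local_lift_def by blast
  then show "smooth_at v t" unfolding smooth_at_def cdiff_def by blast
  have "local_lift J c s v" if "s \<in> J \<inter> U" for s
    unfolding local_lift_def using U that by (intro exI[of _ U]) blast
  then show "\<exists>U. open U \<and> t \<in> U \<and> (\<forall>s\<in>J \<inter> U. v s \<noteq> 0 \<and> c s = span {v s} \<and> local_lift J c s v)"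
    using U by blast
qed

lemma linear_smooth_at: "linear (l :: real ^ 'n \<Rightarrow> real) \<Longrightarrow> smooth_at v t \<Longrightarrow> smooth_at (\<lambda>s. l (v s)) t"
  by (rule smooth_at_bounded_linear) (simp add: linear_conv_bounded_linear)

text \<open>
  The two lifts differ by the factor \<open>p (w s) / p (v s)\<close>, which is smooth near \<open>t\<close>, where \<open>p\<close> is the scalar product with \<open>v t\<close>.
\<close>
lemma vanishes_lift:
  fixes l :: "real ^ 'n \<Rightarrow> real"
  assumes "t \<in> J" "local_lift J c t v" "local_lift J c t w" "linear l"
  shows "vanishes k (\<lambda>s. l (w s)) t \<longleftrightarrow> vanishes k (\<lambda>s. l (v s)) t"
proof -
  obtain U where U: "open U" "t \<in> U" "\<forall>s\<in>J \<inter> U. v s \<noteq> 0 \<and> c s = span {v s} \<and> local_lift J c s v"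
    using local_liftD(2)[OF assms(2)] by blast
  obtain V where V: "open V" "t \<in> V" "\<forall>s\<in>J \<inter> V. w s \<noteq> 0 \<and> c s = span {w s} \<and> local_lift J c s w"
    using local_liftD(2)[OF assms(3)] by blast
  note sv = local_liftD(1)[OF assms(2)] and sw = local_liftD(1)[OF assms(3)]
  define p where "p = (\<lambda>y. v t \<bullet> y)"
  have p: "linear p" unfolding p_def by (rule bounded_linear.linear[OF bounded_linear_inner_right])
  have pv: "p (v t) \<noteq> 0" unfolding p_def using U assms(1) by simp
  define g where "g = (\<lambda>s. inverse (p (v s)) *\<^sub>R p (w s))"
  obtain W where W: "open W" "t \<in> W" "\<forall>s\<in>J \<inter> W. p (v s) \<noteq> 0"
    using nonzero_near[OF linear_smooth_at[OF p sv] assms(1) pv] by blast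
  have w: "w s = g s *\<^sub>R v s" if "s \<in> J \<inter> (U \<inter> V \<inter> W)" for s
  proof -
    have "w s \<in> span {w s}" by (simp add: span_base)
    then have "w s \<in> span {v s}" using that U V by auto
    then obtain k where k: "w s = k *\<^sub>R v s" by (auto simp: span_singleton)
    have "p (w s) = k * p (v s)" unfolding k using linear_scale[OF p] by simp
    then have "g s = k" unfolding g_def using that W by simp
    then show ?thesis using k by simp
  qed
  have sg: "smooth_at g t"
    unfolding g_def by (intro smooth_at_scaleR smooth_at_inverse linear_smooth_at[OF p] sv sw assms(1) pv)
  have "w t \<noteq> 0" using V assms(1) by simp
  then have nz: "g t \<noteq> 0" using w[of t] U V W assms(1) by auto
  have o: "open (U \<inter> V \<inter> W)" "t \<in> J \<inter> (U \<inter> V \<inter> W)" using U V W assms(1) by auto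
  have "vanishes k (\<lambda>s. l (w s)) t \<longleftrightarrow> vanishes k (\<lambda>s. g s *\<^sub>R l (v s)) t"
  proof (rule vanishes_cong[OF o])
    show "l (w s) = g s *\<^sub>R l (v s)" if "s \<in> J \<inter> (U \<inter> V \<inter> W)" for s
      using w[OF that] linear_scale[OF assms(4)] by simp
  qed
  also have "\<dots> \<longleftrightarrow> vanishes k (\<lambda>s. l (v s)) t"
    by (rule vanishes_scaleR_iff[OF assms(1) sg linear_smooth_at[OF assms(4) sv] nz])
  finally show ?thesis .
qed

lemma nderiv_linear:
  "linear (l :: real ^ 'n \<Rightarrow> real) \<Longrightarrow> t \<in> J \<Longrightarrow> smooth_at v t \<Longrightarrow> nderiv J k (\<lambda>s. l (v s)) t = l (nderiv J k v t)"
  by (rule nderiv_bounded_linear) (simp_all add: linear_conv_bounded_linear)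

lemma local_lift_lift_at: "local_lift J c t v \<Longrightarrow> local_lift J c t (lift_at J c t)"
  unfolding lift_at_def by (rule someI[of "local_lift J c t"])

lemma enat_le_local_multiplicity:
  assumes "t \<in> J" "local_lift J c t v" "linear l"
  shows "enat k \<le> local_multiplicity J c l t \<longleftrightarrow> vanishes k (\<lambda>s. l (v s)) t"
  unfolding local_multiplicity_def enat_le_vanishing_order vanishes_def[symmetric]
  by (rule vanishes_lift[OF assms(1,2) local_lift_lift_at[OF assms(2)] assms(3)])

lemma annihilates_osculating_flag:
  fixes l :: "real ^ 'n \<Rightarrow> real"
  assumes "t \<in> J" "local_lift J c t v" "linear l"
  shows "(\<forall>y\<in>osculating_flag J c t k. l y = 0) \<longleftrightarrow> vanishes k (\<lambda>s. l (v s)) t"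
proof -
  have eq: "nderiv J i (\<lambda>s. l (lift_at J c t s)) t = l (nderiv J i (lift_at J c t) t)" for i
    by (rule nderiv_linear[OF assms(3,1) local_liftD(1)[OF local_lift_lift_at[OF assms(2)]]])
  have "(\<forall>y\<in>osculating_flag J c t k. l y = 0) \<longleftrightarrow> vanishes k (\<lambda>s. l (lift_at J c t s)) t"
    unfolding osculating_flag_def linear_vanishes_on_span[OF assms(3)] vanishes_def eq by blast
  also have "\<dots> \<longleftrightarrow> vanishes k (\<lambda>s. l (v s)) t"
    by (rule vanishes_lift[OF assms(1,2) local_lift_lift_at[OF assms(2)] assms(3)])
  finally show ?thesis .
qed

lemma osculating_flag_eqI:
  assumes "t \<in> J" "local_lift J c t v"
    and "\<And>l :: real ^ 'n \<Rightarrow> real. linear l \<Longrightarrow> (\<forall>y\<in>B. l y = 0) \<longleftrightarrow> vanishes k (\<lambda>s. l (v s)) t"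
  shows "osculating_flag J c t k = span B"
proof
  show "osculating_flag J c t k \<subseteq> span B"
  proof (rule subspace_le_annihilators[OF subspace_span])
    show "\<forall>x\<in>osculating_flag J c t k. l x = 0" if "linear l" "\<forall>x\<in>span B. l x = 0" for l :: "real ^ 'n \<Rightarrow> real"
      using assms(3)[OF that(1)] annihilates_osculating_flag[OF assms(1,2) that(1)] that(2) linear_vanishes_on_span[OF that(1)] by blast
  qed
  show "span B \<subseteq> osculating_flag J c t k"
  proof (rule subspace_le_annihilators)
    show "subspace (osculating_flag J c t k)" unfolding osculating_flag_def by (rule subspace_span)
    show "\<forall>x\<in>span B. l x = 0" if "linear l" "\<forall>x\<in>osculating_flag J c t k. l x = 0" for l :: "real ^ 'n \<Rightarrow> real"
      using assms(3)[OF that(1)] annihilates_osculating_flag[OF assms(1,2) that(1)] that linear_vanishes_on_span[OF that(1)] by blast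
  qed
qed

text \<open>
  The multiplicities at \<open>t\<close> and \<open>b\<close> are two terms of the sum that convexity bounds.
\<close>
lemma convex_curve_vanishing:
  fixes c :: "real \<Rightarrow> (real ^ 'n) set" and l :: "real ^ 'n \<Rightarrow> real"
  assumes "convex_curve J T c" "T \<subseteq> J" "linear l" "l \<noteq> (\<lambda>_. 0)"
    and "t \<in> T" "local_lift J c t v" "vanishes i (\<lambda>s. l (v s)) t"
  shows "i < CARD('n)"
    and "b \<in> T \<Longrightarrow> b \<noteq> t \<Longrightarrow> local_lift J c b w \<Longrightarrow> vanishes j (\<lambda>s. l (w s)) b \<Longrightarrow> i + j < CARD('n)"
proof -
  let ?f = "local_multiplicity J c l"
  have le: "sum ?f F \<le> enat (CARD('n) - 1)" if "finite F" "F \<subseteq> T" for F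
  proof -
    have "sum ?f F \<le> infsum ?f T" unfolding infsum_enat by (rule SUP_upper) (use that in simp)
    also have "\<dots> \<le> enat (CARD('n) - 1)" using assms(1,3,4) unfolding convex_curve_def by blast
    finally show ?thesis .
  qed
  have J: "t \<in> J" using assms(2,5) by blast
  have t: "enat i \<le> ?f t" by (rule enat_le_local_multiplicity[OF J assms(6,3), THEN iffD2, OF assms(7)])
  also have "?f t \<le> enat (CARD('n) - 1)" using le[of "{t}"] assms(5) by simp
  finally have "i \<le> CARD('n) - 1" by simp
  moreover have pos: "0 < CARD('n)" by simp
  ultimately show "i < CARD('n)" by linarith
  assume b: "b \<in> T" "b \<noteq> t" "local_lift J c b w" "vanishes j (\<lambda>s. l (w s)) b"
  have "b \<in> J" using assms(2) b(1) by blast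
  from enat_le_local_multiplicity[OF this b(3) assms(3), THEN iffD2, OF b(4)]
  have "enat i + enat j \<le> ?f t + ?f b" by (rule add_mono[OF t])
  also have "\<dots> = sum ?f {t, b}" using b(2) by simp
  also have "\<dots> \<le> enat (CARD('n) - 1)" using le[of "{t, b}"] assms(5) b(1) by simp
  finally have "i + j \<le> CARD('n) - 1" by simp
  then show "i + j < CARD('n)" using pos by linarith
qed

end

section \<open>The frame of a convex arc\<close>

text \<open>
  The forms \<open>u j\<close> are the basis dual to the jet of the curve at the end \<open>b\<close> of the arc, in reversed order. Thus
  \<open>u j\<close> with \<open>j < n - k\<close> annihilates the osculating space of dimension \<open>k\<close> at \<open>b\<close>.
\<close>
locale arc_frame = thick J for J :: "real set" +
  fixes T :: "real set" and c :: "real \<Rightarrow> (real ^ 'n) set" and a b :: real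
    and u :: "nat \<Rightarrow> real ^ 'n \<Rightarrow> real" and n :: nat
  assumes convex: "convex_curve J T c" and TJ: "T \<subseteq> J" and ab: "a < b" "{a..b} \<subseteq> T"
    and n: "n = CARD('n)"
    and linear_u: "linear (u j)"
    and u_D: "i < n \<Longrightarrow> j < n \<Longrightarrow>
      u j (nderiv J i (lift_at J c b) b) = (if i + j = n - 1 then 1 else 0)"
    and u_expansion: "w = (\<Sum>j<n. u j w *\<^sub>R nderiv J (n - 1 - j) (lift_at J c b) b)"
begin

definition D :: "nat \<Rightarrow> real ^ 'n" where
  "D i = nderiv J i (lift_at J c b) b"

lemma n_pos: "0 < n" unfolding n by simp

lemma arc_mem: "t \<in> {a..<b} \<Longrightarrow> t \<in> T" "t \<in> {a..<b} \<Longrightarrow> t \<in> J" "t \<in> {a..<b} \<Longrightarrow> t \<noteq> b" "b \<in> T" "b \<in> J"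
  using ab(1) subsetD[OF ab(2)] subsetD[OF TJ] by auto

lemma lift_exists: "t \<in> J \<Longrightarrow> local_lift J c t (lift_at J c t)"
  using convex unfolding convex_curve_def smooth_curve_def by (metis local_lift_lift_at)

lemma vanishes_at_b: "linear (l :: real ^ 'n \<Rightarrow> real) \<Longrightarrow> vanishes k (\<lambda>s. l (lift_at J c b s)) b \<longleftrightarrow> (\<forall>i<k. l (D i) = 0)"
  unfolding vanishes_def D_def
  by (simp only: nderiv_linear[OF _ arc_mem(5) local_liftD(1)[OF lift_exists[OF arc_mem(5)]]])

lemma u_D': "i < n \<Longrightarrow> j < n \<Longrightarrow> u j (D i) = (if i + j = n - 1 then 1 else 0)"
  unfolding D_def by (rule u_D)

text \<open>
  The form would have multiplicity \<open>Suc j\<close> at \<open>t\<close> and \<open>n - Suc j\<close> at \<open>b\<close>, hence total multiplicity at least \<open>n\<close>.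
\<close>
lemma no_excess_vanishing:
  fixes l :: "real ^ 'n \<Rightarrow> real"
  assumes t: "t \<in> {a..<b}" "local_lift J c t v" and l: "linear l" "l \<noteq> (\<lambda>_. 0)" and j: "j < n"
    and b: "\<And>i. i < n - Suc j \<Longrightarrow> l (D i) = 0" and v: "vanishes (Suc j) (\<lambda>s. l (v s)) t"
  shows False
proof -
  have vb: "vanishes (n - Suc j) (\<lambda>s. l (lift_at J c b s)) b"
    unfolding vanishes_at_b[OF l(1)] using b by blast
  have "Suc j + (n - Suc j) < n"
    using convex_curve_vanishing(2)[OF convex TJ l arc_mem(1)[OF t(1)] t(2) v arc_mem(4) arc_mem(3)[OF t(1), symmetric] lift_exists[OF arc_mem(5)] vb]
    unfolding n .
  then show False using j by simp
qed

text \<open>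
  By convexity the osculating space of dimension \<open>Suc j\<close> at \<open>t\<close> and the one of dimension \<open>n - j\<close> at \<open>b\<close> intersect
  in a line, and \<open>frame j t\<close> is the vector on this line at which \<open>u j\<close> is 1. For \<open>j = 0\<close> the line is \<open>c t\<close>. Since
  \<open>u 0, \<dots>, u j\<close> are constant along \<open>frame j\<close>, they annihilate its derivative, which therefore is a multiple of
  \<open>frame (Suc j) t\<close>.
\<close>
primrec frame :: "nat \<Rightarrow> real \<Rightarrow> real ^ 'n" where
  "frame 0 = (\<lambda>t. THE y. y \<in> c t \<and> u 0 y = 1)"
| "frame (Suc j) = (\<lambda>t. inverse (u (Suc j) (vderiv (frame j) t)) *\<^sub>R vderiv (frame j) t)"

definition speed :: "nat \<Rightarrow> real \<Rightarrow> real" where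
  "speed j t = u (Suc j) (vderiv (frame j) t)"

lemma frame_Suc: "frame (Suc j) t = inverse (speed j t) *\<^sub>R vderiv (frame j) t"
  by (simp add: speed_def)

declare frame.simps(2) [simp del]

definition adapted :: "nat \<Rightarrow> real \<Rightarrow> bool" where
  "adapted j t \<longleftrightarrow> smooth_at (frame j) t \<and>
     (\<exists>U. open U \<and> t \<in> U \<and> (\<forall>s\<in>J \<inter> U. u j (frame j s) = 1 \<and> (\<forall>i<j. u i (frame j s) = 0)))"

lemma smooth_speed: "smooth_at (frame j) t \<Longrightarrow> smooth_at (speed j) t"
  unfolding speed_def[abs_def] by (intro linear_smooth_at linear_u smooth_at_vderiv)

lemma u_nonzero: "j < n \<Longrightarrow> u j \<noteq> (\<lambda>_. 0)"
  using u_D'[of "n - 1 - j" j] by auto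

lemma frame_0:
  assumes "t \<in> {a..<b}"
  shows "local_lift J c t (frame 0)" "adapted 0 t"
proof -
  have tJ: "t \<in> J" using arc_mem assms by blast
  define v where "v = lift_at J c t"
  have v: "local_lift J c t v" unfolding v_def by (rule lift_exists[OF tJ])
  note sv = local_liftD(1)[OF v]
  obtain U where U: "open U" "t \<in> U" "\<forall>s\<in>J \<inter> U. v s \<noteq> 0 \<and> c s = span {v s} \<and> local_lift J c s v"
    using local_liftD(2)[OF v] by blast
  have nz: "u 0 (v t) \<noteq> 0"
  proof
    assume "u 0 (v t) = 0"
    then have "vanishes (Suc 0) (\<lambda>s. u 0 (v s)) t" by (simp add: vanishes_Suc vanishes_0)
    moreover have "u 0 (D i) = 0" if "i < n - Suc 0" for i using u_D'[of i 0] that by simp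
    ultimately show False
      using no_excess_vanishing[OF assms v linear_u u_nonzero[OF n_pos] n_pos] by blast
  qed
  obtain V where V: "open V" "t \<in> V" "\<forall>s\<in>J \<inter> V. u 0 (v s) \<noteq> 0"
    using nonzero_near[OF linear_smooth_at[OF linear_u sv] tJ nz] by blast
  have UV: "open (U \<inter> V)" "t \<in> U \<inter> V" using U V by auto
  have eq: "frame 0 s = inverse (u 0 (v s)) *\<^sub>R v s" if s: "s \<in> J \<inter> (U \<inter> V)" for s
  proof -
    have cs: "c s = span {v s}" "u 0 (v s) \<noteq> 0" using U V s by auto
    have "(THE y. y \<in> c s \<and> u 0 y = 1) = inverse (u 0 (v s)) *\<^sub>R v s"
    proof (rule the_equality)
      show "inverse (u 0 (v s)) *\<^sub>R v s \<in> c s \<and> u 0 (inverse (u 0 (v s)) *\<^sub>R v s) = 1"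
        using cs by (simp add: span_base span_scale linear_scale[OF linear_u])
      fix y assume y: "y \<in> c s \<and> u 0 y = 1"
      then obtain k where k: "y = k *\<^sub>R v s" using cs by (auto simp: span_singleton)
      have "k * u 0 (v s) = 1" using y unfolding k linear_scale[OF linear_u] by simp
      then have "k = inverse (u 0 (v s))" by (metis inverse_unique mult.commute)
      then show "y = inverse (u 0 (v s)) *\<^sub>R v s" using k by simp
    qed
    then show ?thesis by simp
  qed
  have sm: "smooth_at (\<lambda>s. inverse (u 0 (v s)) *\<^sub>R v s) t"
    by (rule smooth_at_scaleR[OF smooth_at_inverse[OF linear_smooth_at[OF linear_u sv] tJ nz] sv])
  have s0: "smooth_at (frame 0) t"
    by (rule smooth_at_cong[OF UV _ sm]) (rule eq[symmetric])
  have u0: "u 0 (frame 0 s) = 1" if "s \<in> J \<inter> (U \<inter> V)" for s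
    using eq[OF that] that V by (simp add: linear_scale[OF linear_u])
  then show "adapted 0 t"
    unfolding adapted_def using s0 UV by (intro conjI exI[of _ "U \<inter> V"]) simp_all
  obtain W where W: "open W" "t \<in> W" "\<forall>k. cdiff W k (frame 0)" using s0 unfolding smooth_at_def by blast
  show "local_lift J c t (frame 0)"
    unfolding local_lift_def
  proof (intro exI[of _ "W \<inter> (U \<inter> V)"] conjI ballI allI)
    show "open (W \<inter> (U \<inter> V))" "t \<in> W \<inter> (U \<inter> V)" using W UV by auto
    show "nderiv J k (frame 0) differentiable (at s within J)" if "s \<in> J \<inter> (W \<inter> (U \<inter> V))" for k s
    proof -
      have "cdiff W (Suc k) (frame 0)" "s \<in> J \<inter> W" using W that by auto
      then show ?thesis unfolding cdiff_def by blast
    qed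
    fix s assume s: "s \<in> J \<inter> (W \<inter> (U \<inter> V))"
    then have cs: "c s = span {v s}" "u 0 (v s) \<noteq> 0" and f: "frame 0 s = inverse (u 0 (v s)) *\<^sub>R v s" using U V eq[of s] by auto
    show "frame 0 s \<noteq> 0" using u0[of s] s linear_0[OF linear_u, of 0] by auto
    have "v s = u 0 (v s) *\<^sub>R frame 0 s" using f cs by simp
    then show "c s = span {frame 0 s}"
      unfolding cs(1) using f by (intro span_eq[THEN iffD2] conjI) (auto intro: span_scale span_base simp: span_singleton)
  qed
qed

lemma vderiv_frame:
  assumes "t \<in> J" "smooth_at (frame j) t" "speed j t \<noteq> 0"
  shows "\<exists>U. open U \<and> t \<in> U \<and> (\<forall>s\<in>J \<inter> U. vderiv (frame j) s = speed j s *\<^sub>R frame (Suc j) s)"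
proof -
  obtain U where U: "open U" "t \<in> U" "\<forall>s\<in>J \<inter> U. speed j s \<noteq> 0"
    using nonzero_near[OF smooth_speed[OF assms(2)] assms(1,3)] by blast
  then have "vderiv (frame j) s = speed j s *\<^sub>R frame (Suc j) s" if "s \<in> J \<inter> U" for s
    using that unfolding frame_Suc by simp
  then show ?thesis using U by blast
qed

lemma vderiv_linear:
  fixes l :: "real ^ 'n \<Rightarrow> real"
  assumes "linear l" "t \<in> J" "smooth_at v t"
  shows "vderiv (\<lambda>s. l (v s)) t = l (vderiv v t)"
  using nderiv_linear[OF assms, of 1] unfolding One_nat_def nderiv_Suc nderiv_0 .

text \<open>
  The derivative of \<open>l (frame j s)\<close> is \<open>speed j s * l (frame (Suc j) s)\<close>, and the factor \<open>speed j\<close> does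
  not affect orders of vanishing.
\<close>
lemma vanishes_frame:
  fixes l :: "real ^ 'n \<Rightarrow> real"
  assumes "t \<in> J" "linear l"
  shows "(\<And>i. i \<le> k \<Longrightarrow> smooth_at (frame i) t) \<Longrightarrow> (\<And>i. i < k \<Longrightarrow> speed i t \<noteq> 0) \<Longrightarrow>
    vanishes (k + r) (\<lambda>s. l (frame 0 s)) t \<longleftrightarrow> (\<forall>i<k. l (frame i t) = 0) \<and> vanishes r (\<lambda>s. l (frame k s)) t"
proof (induction k arbitrary: r)
  case 0
  then show ?case by simp
next
  case (Suc k)
  have sk: "smooth_at (frame k) t" and nz: "speed k t \<noteq> 0" and sk': "smooth_at (frame (Suc k)) t"
    using Suc.prems by auto
  obtain U where U: "open U" "t \<in> U" "\<forall>s\<in>J \<inter> U. vderiv (frame k) s = speed k s *\<^sub>R frame (Suc k) s"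
    using vderiv_frame[OF assms(1) sk nz] by blast
  obtain V where V: "open V" "t \<in> V" "\<forall>s\<in>V. smooth_at (frame k) s" using smooth_at_open[OF sk] by blast
  have eq: "vderiv (\<lambda>s. l (frame k s)) s = speed k s *\<^sub>R l (frame (Suc k) s)" if "s \<in> J \<inter> (U \<inter> V)" for s
  proof -
    have "vderiv (\<lambda>s. l (frame k s)) s = l (vderiv (frame k) s)"
      using that V by (intro vderiv_linear[OF assms(2)]) auto
    then show ?thesis using that U linear_scale[OF assms(2)] by simp
  qed
  have o: "open (U \<inter> V)" "t \<in> J \<inter> (U \<inter> V)" using U V assms(1) by auto
  have "vanishes r (vderiv (\<lambda>s. l (frame k s))) t \<longleftrightarrow> vanishes r (\<lambda>s. speed k s *\<^sub>R l (frame (Suc k) s)) t"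
    by (rule vanishes_cong[OF o eq])
  also have "\<dots> \<longleftrightarrow> vanishes r (\<lambda>s. l (frame (Suc k) s)) t"
    by (rule vanishes_scaleR_iff[OF assms(1) smooth_speed[OF sk] linear_smooth_at[OF assms(2) sk'] nz])
  finally have v: "vanishes (Suc r) (\<lambda>s. l (frame k s)) t \<longleftrightarrow> l (frame k t) = 0 \<and> vanishes r (\<lambda>s. l (frame (Suc k) s)) t"
    unfolding vanishes_Suc by simp
  have "vanishes (k + Suc r) (\<lambda>s. l (frame 0 s)) t \<longleftrightarrow>
      (\<forall>i<k. l (frame i t) = 0) \<and> vanishes (Suc r) (\<lambda>s. l (frame k s)) t"
    by (rule Suc.IH) (use Suc.prems in auto)
  then show ?case unfolding v by (auto simp: less_Suc_eq)
qed

text \<open>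
  The matrix of the values \<open>u i (e j)\<close> is unitriangular, so that \<open>p\<close> can be interpolated on the vectors \<open>e j\<close> by the forms \<open>u i\<close>.
\<close>
lemma exists_triangular_correction:
  fixes p :: "real ^ 'n \<Rightarrow> real"
  assumes "linear p" "\<And>i. i < k \<Longrightarrow> u i (e i) = 1" "\<And>i j. i < j \<Longrightarrow> j < k \<Longrightarrow> u i (e j) = 0"
  shows "\<exists>r. \<forall>j<k. p (e j) = (\<Sum>i<k. r i * u i (e j))"
  using assms
proof (induction k arbitrary: p)
  case (Suc k)
  define q where "q = (\<lambda>x. p x - p (e k) * u k x)"
  have "linear q"
    unfolding q_def by (rule linearI) (simp_all add: linear_add[OF Suc.prems(1)] linear_scale[OF Suc.prems(1)]
      linear_add[OF linear_u] linear_scale[OF linear_u] algebra_simps)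
  then obtain r where r: "\<And>j. j < k \<Longrightarrow> q (e j) = (\<Sum>i<k. r i * u i (e j))"
    using Suc.IH[of q] Suc.prems(2,3) by auto
  define r' where "r' = r(k := p (e k))"
  have "p (e j) = (\<Sum>i<Suc k. r' i * u i (e j))" if "j < Suc k" for j
  proof -
    have eq: "(\<Sum>i<Suc k. r' i * u i (e j)) = (\<Sum>i<k. r i * u i (e j)) + p (e k) * u k (e j)"
    proof -
      have "(\<Sum>i<k. r' i * u i (e j)) = (\<Sum>i<k. r i * u i (e j))"
        unfolding r'_def by (intro sum.cong) auto
      then show ?thesis unfolding r'_def by simp
    qed
    show ?thesis
    proof (cases "j = k")
      case True
      have "(\<Sum>i<k. r i * u i (e j)) = 0" using Suc.prems(3)[of _ k] True by simp
      then show ?thesis unfolding eq using True Suc.prems(2)[of k] by simp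
    next
      case False
      then show ?thesis unfolding eq using r[of j] that unfolding q_def by simp
    qed
  qed
  then show ?case by blast
qed simp

text \<open>
  Suppose that \<open>speed j t = 0\<close>. Subtracting from \<open>u (Suc j)\<close> a combination of \<open>u 0, \<dots>, u j\<close> gives a
  nonzero form that vanishes on \<open>frame 0 t, \<dots>, frame j t\<close> and on the derivative of \<open>frame j\<close>. Along the curve it vanishes to
  order \<open>j + 2\<close> at \<open>t\<close> and to order \<open>n - j - 2\<close> at \<open>b\<close>, which convexity excludes.
\<close>
lemma speed_step:
  assumes t: "t \<in> {a..<b}" and j: "Suc j < n" and g: "\<And>i. i \<le> j \<Longrightarrow> adapted i t" and nz: "\<And>i. i < j \<Longrightarrow> speed i t \<noteq> 0"
  shows "speed j t \<noteq> 0" "adapted (Suc j) t"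
proof -
  have tJ: "t \<in> J" using arc_mem t by blast
  have sm: "smooth_at (frame i) t" if "i \<le> j" for i using g[OF that] unfolding adapted_def by blast
  have tri: "u i (frame i t) = 1" "\<And>m. m < i \<Longrightarrow> u m (frame i t) = 0" if "i \<le> j" for i
    using g[OF that] tJ unfolding adapted_def by auto
  obtain U where U: "open U" "t \<in> U" "\<forall>s\<in>J \<inter> U. u j (frame j s) = 1 \<and> (\<forall>i<j. u i (frame j s) = 0)"
    using g[of j] unfolding adapted_def by auto
  obtain V where V: "open V" "t \<in> V" "\<forall>s\<in>V. smooth_at (frame j) s" using smooth_at_open[OF sm[of j]] by auto
  have flat: "u i (vderiv (frame j) s) = 0" if s: "s \<in> J \<inter> (U \<inter> V)" and i: "i \<le> j" for i s
  proof -
    have "u i (vderiv (frame j) s) = vderiv (\<lambda>s. u i (frame j s)) s"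
      using s V by (intro vderiv_linear[OF linear_u, symmetric]) auto
    also have "\<dots> = vderiv (\<lambda>_. if i = j then 1 else 0) s"
      using s U i by (intro vderiv_cong[OF U(1)]) auto
    also have "\<dots> = 0" using s by (intro vderiv_eqI) auto
    finally show ?thesis .
  qed
  show ne: "speed j t \<noteq> 0"
  proof
    assume z: "speed j t = 0"
    have t2: "u i (frame j' t) = 0" if "i < j'" "j' < Suc j" for i j' using tri(2)[of j' i] that by simp
    obtain r where r: "\<And>i. i < Suc j \<Longrightarrow> u (Suc j) (frame i t) = (\<Sum>m<Suc j. r m * u m (frame i t))"
      using exists_triangular_correction[OF linear_u, of "Suc j" "\<lambda>i. frame i t" "Suc j"] tri(1) t2
      by (metis less_Suc_eq_le)
    \<comment> \<open>The form that vanishes on \<open>frame 0 t, \<dots>, frame j t\<close>.\<close>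
    define l where "l = (\<lambda>x. u (Suc j) x - (\<Sum>m<Suc j. r m * u m x))"
    have lin: "linear l"
      unfolding l_def by (rule linearI) (simp_all add: linear_add[OF linear_u] linear_scale[OF linear_u]
          sum.distrib sum_distrib_left algebra_simps del: sum.lessThan_Suc)
    have lD: "l (D i) = (if i + Suc j = n - 1 then 1 else 0)" if "i < n - Suc j" for i
    proof -
      have "u m (D i) = 0" if "m < Suc j" for m using u_D'[of i m] \<open>i < n - Suc j\<close> that by simp
      then have "(\<Sum>m<Suc j. r m * u m (D i)) = 0" by (intro sum.neutral) auto
      then show ?thesis unfolding l_def using u_D'[of i "Suc j"] that j by simp
    qed
    have "l (D (n - 1 - Suc j)) = 1" using lD[of "n - 1 - Suc j"] j by simp
    then have lnz: "l \<noteq> (\<lambda>_. 0)" by auto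
    have "l (frame i t) = 0" if "i \<le> j" for i using r[of i] that unfolding l_def by simp
    moreover have "l (vderiv (frame j) t) = 0"
    proof -
      have "u m (vderiv (frame j) t) = 0" if "m < Suc j" for m using flat[of t m] that U V tJ by auto
      then have "(\<Sum>m<Suc j. r m * u m (vderiv (frame j) t)) = 0" by (intro sum.neutral) auto
      then show ?thesis unfolding l_def using z unfolding speed_def by simp
    qed
    ultimately have "vanishes 2 (\<lambda>s. l (frame j s)) t" "\<forall>i<j. l (frame i t) = 0"
      using vderiv_linear[OF lin tJ sm[of j]] by (auto simp: numeral_2_eq_2 vanishes_Suc vanishes_0)
    then have "vanishes (j + 2) (\<lambda>s. l (frame 0 s)) t"
      using vanishes_frame[OF tJ lin, of j 2] sm nz by blast
    then have "vanishes (Suc (Suc j)) (\<lambda>s. l (frame 0 s)) t" by simp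
    moreover have "l (D i) = 0" if "i < n - Suc (Suc j)" for i using lD[of i] that by simp
    ultimately show False
      using no_excess_vanishing[OF t frame_0(1)[OF t] lin lnz j] by blast
  qed
  obtain W where W: "open W" "t \<in> W" "\<forall>s\<in>J \<inter> W. speed j s \<noteq> 0"
    using nonzero_near[OF smooth_speed[OF sm[of j]] tJ ne] by auto
  have "smooth_at (frame (Suc j)) t"
    unfolding frame_Suc[abs_def]
    by (rule smooth_at_scaleR[OF smooth_at_inverse[OF smooth_speed[OF sm] tJ ne] smooth_at_vderiv[OF sm]]) simp_all
  moreover have "u (Suc j) (frame (Suc j) s) = 1 \<and> (\<forall>i<Suc j. u i (frame (Suc j) s) = 0)" if s: "s \<in> J \<inter> (U \<inter> V \<inter> W)" for s
  proof -
    have "speed j s \<noteq> 0" using W s by auto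
    then have "u (Suc j) (frame (Suc j) s) = 1" unfolding frame_Suc linear_scale[OF linear_u] by (simp add: speed_def)
    moreover have "u i (frame (Suc j) s) = 0" if "i < Suc j" for i
      unfolding frame_Suc linear_scale[OF linear_u] using flat[of s i] s that by simp
    ultimately show ?thesis by blast
  qed
  ultimately show "adapted (Suc j) t"
    unfolding adapted_def using U V W by (intro conjI exI[of _ "U \<inter> V \<inter> W"]) auto
qed

lemma frame_adapted: "j < n \<Longrightarrow> t \<in> {a..<b} \<Longrightarrow> (\<forall>i\<le>j. adapted i t) \<and> (\<forall>i<j. speed i t \<noteq> 0)"
proof (induction j)
  case 0
  then show ?case using frame_0(2) by simp
next
  case (Suc j)
  then have IH: "\<forall>i\<le>j. adapted i t" "\<forall>i<j. speed i t \<noteq> 0" by auto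
  then have "speed j t \<noteq> 0" "adapted (Suc j) t" using speed_step[OF Suc.prems(2,1)] by blast+
  then show ?case using IH by (auto simp: le_Suc_eq less_Suc_eq)
qed

lemma smooth_frame: "j < n \<Longrightarrow> t \<in> {a..<b} \<Longrightarrow> smooth_at (frame j) t"
proof -
  assume "j < n" "t \<in> {a..<b}"
  then have "adapted j t" using frame_adapted[of j t] by simp
  then show ?thesis unfolding adapted_def by (rule conjunct1)
qed

lemma u_frame:
  assumes "j < n" "t \<in> {a..<b}"
  shows "u j (frame j t) = 1 \<and> (\<forall>i<j. u i (frame j t) = 0)"
proof -
  have "adapted j t" using frame_adapted[OF assms] by simp
  then obtain U where "t \<in> U" "\<forall>s\<in>J \<inter> U. u j (frame j s) = 1 \<and> (\<forall>i<j. u i (frame j s) = 0)"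
    unfolding adapted_def by (elim conjE exE)
  then show ?thesis using arc_mem(2)[OF assms(2)] by simp
qed

lemma u_frame_eq: "j < n \<Longrightarrow> t \<in> {a..<b} \<Longrightarrow> u j (frame j t) = 1"
  and u_frame_less: "j < n \<Longrightarrow> t \<in> {a..<b} \<Longrightarrow> i < j \<Longrightarrow> u i (frame j t) = 0"
  by (simp_all add: u_frame)

lemma speed_nonzero: "Suc j < n \<Longrightarrow> t \<in> {a..<b} \<Longrightarrow> speed j t \<noteq> 0"
  using frame_adapted[of "Suc j" t] by simp

lemma eq_0_iff_u: "w = 0 \<longleftrightarrow> (\<forall>j<n. u j w = 0)"
proof
  assume *: "\<forall>j<n. u j w = 0"
  have "w = (\<Sum>j<n. u j w *\<^sub>R nderiv J (n - 1 - j) (lift_at J c b) b)" by (rule u_expansion)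
  also have "\<dots> = 0" using * by (intro sum.neutral) auto
  finally show "w = 0" .
qed (simp add: linear_0[OF linear_u])

lemma frame_last:
  assumes "t \<in> {a..<b}"
  shows "frame (n - 1) t = D 0"
proof -
  have "u j (frame (n - 1) t - D 0) = 0" if "j < n" for j
    using u_frame_eq[of "n - 1" t] u_frame_less[of "n - 1" t j] assms that u_D'[of 0 j]
    unfolding linear_diff[OF linear_u] by (cases "j = n - 1") auto
  then show ?thesis using eq_0_iff_u[of "frame (n - 1) t - D 0"] by simp
qed

lemma chain_frame: "chain (n - 1) speed frame {a..<b}"
  unfolding chain_def
proof (intro conjI allI impI ballI)
  fix j assume j: "j < n - 1"
  show "continuous_on {a..<b} (speed j)"
    unfolding continuous_on_eq_continuous_within
  proof
    fix t assume t: "t \<in> {a..<b}"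
    have "smooth_at (speed j) t" using j t by (intro smooth_speed smooth_frame) auto
    then have "continuous (at t within J) (speed j)" using arc_mem(2)[OF t] by (rule smooth_at_continuous)
    then show "continuous (at t within {a..<b}) (speed j)" by (rule continuous_within_subset) (use arc_mem in auto)
  qed
  fix t assume t: "t \<in> {a..<b}"
  show nz: "speed j t \<noteq> 0" using speed_nonzero j t by simp
  have "smooth_at (frame j) t" using j t by (intro smooth_frame) auto
  then have "(frame j has_vector_derivative vderiv (frame j) t) (at t within J)" using arc_mem(2)[OF t] by (rule smooth_at_has_vderiv)
  moreover have "vderiv (frame j) t = speed j t *\<^sub>R frame (Suc j) t" using nz unfolding frame_Suc by simp
  ultimately have "(frame j has_vector_derivative speed j t *\<^sub>R frame (Suc j) t) (at t within J)" by simp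
  then show "(frame j has_vector_derivative speed j t *\<^sub>R frame (Suc j) t) (at t within {a..<b})"
    by (rule has_vector_derivative_within_subset) (use arc_mem in auto)
next
  show "\<exists>c. \<forall>t\<in>{a..<b}. frame (n - 1) t = c" using frame_last by blast
qed

lemma osculating_flag_frame:
  assumes t: "t \<in> {a..<b}" and k: "k \<le> n"
  shows "osculating_flag J c t k = span ((\<lambda>j. frame j t) ` {..<k})"
proof (rule osculating_flag_eqI[OF arc_mem(2)[OF t] frame_0(1)[OF t]])
  fix l :: "real ^ 'n \<Rightarrow> real" assume l: "linear l"
  show "(\<forall>y\<in>(\<lambda>j. frame j t) ` {..<k}. l y = 0) \<longleftrightarrow> vanishes k (\<lambda>s. l (frame 0 s)) t"
  proof (cases k)
    case 0
    then show ?thesis by (simp add: vanishes_0)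
  next
    case (Suc k')
    have "vanishes (k' + 1) (\<lambda>s. l (frame 0 s)) t \<longleftrightarrow> (\<forall>i<k'. l (frame i t) = 0) \<and> vanishes 1 (\<lambda>s. l (frame k' s)) t"
      by (rule vanishes_frame[OF arc_mem(2)[OF t] l]) (use Suc k t smooth_frame speed_nonzero in auto)
    then show ?thesis unfolding Suc by (auto simp: vanishes_Suc vanishes_0 less_Suc_eq)
  qed
qed

lemma u_osculating_flag_end:
  assumes "w \<in> osculating_flag J c b k" "j < n - k"
  shows "u j w = 0"
proof -
  have "\<forall>i<k. u j (D i) = 0" using u_D'[of _ j] assms(2) by auto
  then have "vanishes k (\<lambda>s. u j (lift_at J c b s)) b" unfolding vanishes_at_b[OF linear_u] .
  then show ?thesis
    using annihilates_osculating_flag[OF arc_mem(5) lift_exists[OF arc_mem(5)] linear_u, of k j] assms(1) by blast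
qed

end

section \<open>Counting zeros of chains\<close>

text \<open>
  The zeros of the derivative lie to the left of the largest zero, so the half-open interval is kept.
\<close>
lemma rolle_zeros:
  fixes f :: "real \<Rightarrow> real"
  assumes der: "\<And>t. t \<in> {a..<b} \<Longrightarrow> (f has_real_derivative f' t) (at t within {a..<b})"
  shows "finite Z \<Longrightarrow> Z \<noteq> {} \<Longrightarrow> Z \<subseteq> {a..<b} \<Longrightarrow> (\<And>t. t \<in> Z \<Longrightarrow> f t = 0) \<Longrightarrow>
    \<exists>Z'. finite Z' \<and> Z' \<subseteq> {a..<Max Z} \<and> (\<forall>t\<in>Z'. f' t = 0) \<and> Suc (card Z') = card Z"
proof (induction Z rule: finite_linorder_max_induct)
  case empty
  then show ?case by simp
next
  case (insert z Z)
  have Max: "Max (insert z Z) = z" using insert.hyps by (intro Max_eqI) (auto intro: less_imp_le)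
  have z: "z \<notin> Z" using insert.hyps by auto
  show ?case
  proof (cases "Z = {}")
    case True
    then show ?thesis by (intro exI[of _ "{}"]) auto
  next
    case False
    define y where "y = Max Z"
    have y: "y \<in> Z" "y < z" using insert.hyps False unfolding y_def by auto
    have sub: "{y..z} \<subseteq> {a..<b}" using insert.prems(2) y by auto
    obtain Z' where Z': "finite Z'" "Z' \<subseteq> {a..<y}" "\<forall>t\<in>Z'. f' t = 0" "Suc (card Z') = card Z"
      using insert.IH[OF False] insert.prems unfolding y_def by auto
    have cont: "continuous_on {y..z} f"
      using DERIV_continuous_on[OF der] sub continuous_on_subset by blast
    have d: "(f has_derivative (*) (f' t)) (at t)" if "y < t" "t < z" for t
    proof -
      have "t \<in> {a<..<b}" using insert.prems(2) y that by auto
      then have "(f has_real_derivative f' t) (at t within {a<..<b})"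
        by (intro DERIV_subset[OF der]) auto
      then show ?thesis using \<open>t \<in> {a<..<b}\<close>
        by (simp add: has_field_derivative_def at_within_open[of t "{a<..<b}"])
    qed
    obtain r where r: "y < r" "r < z" "(*) (f' r) = (\<lambda>_. 0)"
      using Rolle_deriv[OF y(2) _ cont d] insert.prems(3) y(1) by auto
    have "f' r = 0" using fun_cong[OF r(3), of 1] by simp
    moreover have "r \<notin> Z'" "a \<le> r" using Z'(2) r(1) insert.prems(2) y(1) by auto
    moreover have "Z' \<subseteq> {a..<z}" using Z'(2) y(2) by auto
    ultimately show ?thesis
      unfolding Max using Z' r z insert.hyps(1) by (intro exI[of _ "insert r Z'"]) auto
  qed
qed

lemma chain_has_real_derivative:
  fixes y :: "nat \<Rightarrow> real \<Rightarrow> real"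
  assumes "chain m \<beta> y S" "j < m" "t \<in> S"
  shows "(y j has_real_derivative \<beta> j t * y (Suc j) t) (at t within S)" "\<beta> j t \<noteq> 0"
  using assms unfolding chain_def has_real_derivative_iff_has_vector_derivative by auto

lemma chain_zeros_shift:
  fixes y :: "nat \<Rightarrow> real \<Rightarrow> real"
  assumes ch: "chain m \<beta> y {a..<b}" and Z: "finite Z" "Z \<subseteq> {a..<b}" "\<And>t. t \<in> Z \<Longrightarrow> y 0 t = 0" and "card Z > m"
  shows "j \<le> m \<Longrightarrow> \<exists>Z'. finite Z' \<and> Z' \<subseteq> {a..<b} \<and> (\<forall>t\<in>Z'. y j t = 0) \<and> card Z' + j = card Z"
proof (induction j)
  case 0
  then show ?case using Z by (intro exI[of _ Z]) auto
next
  case (Suc j)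
  then obtain Z' where Z': "finite Z'" "Z' \<subseteq> {a..<b}" "\<forall>t\<in>Z'. y j t = 0" "card Z' + j = card Z" by auto
  have ne: "Z' \<noteq> {}" using Z'(4) Suc.prems assms(5) by auto
  have j: "j < m" using Suc.prems by simp
  obtain Z'' where Z'': "finite Z''" "Z'' \<subseteq> {a..<Max Z'}" "\<forall>t\<in>Z''. \<beta> j t * y (Suc j) t = 0" "Suc (card Z'') = card Z'"
    using rolle_zeros[OF chain_has_real_derivative(1)[OF ch j] Z'(1) ne Z'(2)] Z'(3) by auto
  have "Max Z' \<in> Z'" using Z'(1) ne by simp
  then have "Max Z' \<in> {a..<b}" using Z'(2) by blast
  then have "{a..<Max Z'} \<subseteq> {a..<b}" by auto
  then have sub: "Z'' \<subseteq> {a..<b}" using Z''(2) by blast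
  have "y (Suc j) t = 0" if "t \<in> Z''" for t
    using Z''(3) that chain_has_real_derivative(2)[OF ch j subsetD[OF sub that]] by auto
  then show ?case
    using Z''(1,4) sub Z'(4) by (intro exI[of _ Z'']) auto
qed

lemma chain_shorten:
  fixes y :: "nat \<Rightarrow> real \<Rightarrow> 'a::real_normed_vector"
  assumes ch: "chain (Suc m) \<beta> y {a..<b}" and z: "\<And>t. t \<in> {a..<b} \<Longrightarrow> y (Suc m) t = 0"
  shows "chain m \<beta> y {a..<b}"
proof -
  have "(y m has_vector_derivative 0) (at t within {a..<b})" if "t \<in> {a..<b}" for t
  proof -
    have "(y m has_vector_derivative \<beta> m t *\<^sub>R y (Suc m) t) (at t within {a..<b})"
      using ch that unfolding chain_def by blast
    then show ?thesis using z[OF that] by simp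
  qed
  from has_vector_derivative_zero_constant[OF convex_real_interval(7) this]
  obtain k where "\<And>t. t \<in> {a..<b} \<Longrightarrow> y m t = k" by blast
  then have "\<exists>k. \<forall>t\<in>{a..<b}. y m t = k" by blast
  then show ?thesis using ch unfolding chain_def by auto
qed

text \<open>
  Rolle's theorem removes at most one zero for each step along the chain, and in the end there is none if the
  constant \<open>y m\<close> is nonzero. If it is zero, the chain is shorter.
\<close>
lemma card_chain_zeros_le:
  fixes y :: "nat \<Rightarrow> real \<Rightarrow> real"
  assumes "chain m \<beta> y {a..<b}" and Z: "finite Z" "Z \<subseteq> {a..<b}" "\<And>t. t \<in> Z \<Longrightarrow> y 0 t = 0"
    and "j \<le> m" "t \<in> {a..<b}" "y j t \<noteq> 0"
  shows "card Z \<le> m"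
  using assms(1,5,7)
proof (induction m)
  case 0
  then obtain k where k: "\<forall>t\<in>{a..<b}. y 0 t = k" unfolding chain_def by blast
  then have "k \<noteq> 0" using 0 assms(6) by auto
  then have "t \<notin> Z" for t using Z(3)[of t] subsetD[OF Z(2), of t] k by auto
  then have "Z = {}" by blast
  then show ?case by simp
next
  case (Suc m)
  obtain k where k: "\<forall>t\<in>{a..<b}. y (Suc m) t = k" using Suc.prems(1) unfolding chain_def by blast
  show ?case
  proof (cases "k = 0")
    case True
    then have "j \<noteq> Suc m" using Suc.prems(3) assms(6) k by auto
    then have "card Z \<le> m"
      using Suc.IH[OF chain_shorten[OF Suc.prems(1)]] k True Suc.prems by simp
    then show ?thesis by simp
  next
    case False
    show ?thesis
    proof (rule ccontr)
      assume "\<not> card Z \<le> Suc m"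
      then obtain Z' where Z': "Z' \<subseteq> {a..<b}" "\<forall>t\<in>Z'. y (Suc m) t = 0" "card Z' + Suc m = card Z"
        using chain_zeros_shift[OF Suc.prems(1) Z, of "Suc m"] by auto
      then have "Z' \<noteq> {}" using \<open>\<not> card Z \<le> Suc m\<close> by auto
      with Z'(1,2) obtain t where "t \<in> {a..<b}" "y (Suc m) t = 0" by blast
      then show False using k False by auto
    qed
  qed
qed

lemma card_chain_zeros_less:
  fixes y :: "nat \<Rightarrow> real \<Rightarrow> real"
  assumes "chain (Suc m) \<beta> y {a..<b}" and Z: "finite Z" "Z \<subseteq> {a..<b}" "\<And>t. t \<in> Z \<Longrightarrow> y 0 t = 0"
    and "j \<le> Suc m" "t \<in> {a..<b}" "y j t \<noteq> 0" "\<And>t. t \<in> {a..<b} \<Longrightarrow> y (Suc m) t = 0"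
  shows "card Z \<le> m"
proof -
  have "j \<le> m" using assms(5-8) by (cases "j = Suc m") auto
  then show ?thesis using card_chain_zeros_le[OF chain_shorten[OF assms(1,8)] Z _ assms(6,7)] by simp
qed

lemma continuous_nonzero_sgn:
  fixes f :: "real \<Rightarrow> real"
  assumes "continuous_on {a..<b} f" "\<And>t. t \<in> {a..<b} \<Longrightarrow> f t \<noteq> 0" "t \<in> {a..<b}"
  shows "0 < sgn (f a) * f t"
proof (rule ccontr)
  assume neg: "\<not> ?thesis"
  have a: "a \<le> t" "a \<in> {a..<b}" using assms(3) by auto
  have c: "continuous_on {a..t} (\<lambda>s. sgn (f a) * f s)"
    using assms(1,3) by (intro continuous_intros) (auto intro: continuous_on_subset)
  have "0 \<le> sgn (f a) * f a" using sgn_mult_pos[OF assms(2)[OF a(2)]] by simp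
  then obtain s where "a \<le> s" "s \<le> t" "sgn (f a) * f s = 0"
    using IVT2'[of "\<lambda>s. sgn (f a) * f s" t 0 a] neg a(1) c by auto
  then show False using assms(2)[of s] assms(2)[OF a(2)] assms(3) by (auto simp: sgn_0_0)
qed

text \<open>
  Each speed has a constant sign, which is absorbed into the components after it.
\<close>
lemma chain_make_positive:
  fixes x :: "nat \<Rightarrow> real \<Rightarrow> 'a::real_normed_vector"
  assumes ch: "chain m \<beta> x {a..<b}" and "a < b"
  shows "\<exists>e. (\<forall>j. e j = 1 \<or> e j = - 1) \<and> positive_chain m (\<lambda>j t. sgn (\<beta> j a) * \<beta> j t) (\<lambda>j t. e j *\<^sub>R x j t) {a..<b}"
proof -
  \<comment> \<open>The sign of a component is the product of the signs of the speeds before it.\<close>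
  define e where "e = rec_nat 1 (\<lambda>j r. r * (if \<beta> j a < 0 then - 1 else 1 :: real))"
  have e0: "e 0 = 1" and eS: "e (Suc j) = e j * (if \<beta> j a < 0 then - 1 else 1)" for j
    unfolding e_def by simp_all
  have e: "e j = 1 \<or> e j = - 1" for j by (induction j) (auto simp: e0 eS)
  have pos: "0 < sgn (\<beta> j a) * \<beta> j t" if "j < m" "t \<in> {a..<b}" for j t
    using ch that unfolding chain_def by (intro continuous_nonzero_sgn[where b = b]) auto
  have "((\<lambda>t. e j *\<^sub>R x j t) has_vector_derivative (sgn (\<beta> j a) * \<beta> j t) *\<^sub>R (e (Suc j) *\<^sub>R x (Suc j) t)) (at t within {a..<b})"
    if "j < m" "t \<in> {a..<b}" for j t
  proof -
    have "(x j has_vector_derivative \<beta> j t *\<^sub>R x (Suc j) t) (at t within {a..<b})"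
      using ch that unfolding chain_def by blast
    from has_vector_derivative_scaleR[OF DERIV_const[of "e j"] this]
    have "((\<lambda>t. e j *\<^sub>R x j t) has_vector_derivative e j *\<^sub>R (\<beta> j t *\<^sub>R x (Suc j) t)) (at t within {a..<b})" by simp
    moreover have "\<beta> j a \<noteq> 0" using ch that assms(2) unfolding chain_def by auto
    then have "e j * \<beta> j t = (sgn (\<beta> j a) * \<beta> j t) * e (Suc j)" by (auto simp: eS sgn_if)
    ultimately show ?thesis by simp
  qed
  moreover have "continuous_on {a..<b} (\<lambda>t. sgn (\<beta> j a) * \<beta> j t)" if "j < m" for j
    using ch that unfolding chain_def by (intro continuous_intros) auto
  moreover obtain k where "\<forall>t\<in>{a..<b}. x m t = k" using ch unfolding chain_def by blast
  then have "\<exists>k. \<forall>t\<in>{a..<b}. e m *\<^sub>R x m t = k" by (intro exI[of _ "e m *\<^sub>R k"]) simp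
  ultimately have "positive_chain m (\<lambda>j t. sgn (\<beta> j a) * \<beta> j t) (\<lambda>j t. e j *\<^sub>R x j t) {a..<b}"
    unfolding positive_chain_def chain_def using pos by fastforce
  then show ?thesis using e by blast
qed

lemma det2_eq_0I: "e \<noteq> 0 \<Longrightarrow> e \<bullet> z = 0 \<Longrightarrow> e \<bullet> w = 0 \<Longrightarrow> det2 z w = 0" for e z w :: complex
proof -
  assume e: "e \<noteq> 0" "e \<bullet> z = 0" "e \<bullet> w = 0"
  have "Re e * det2 z w = (e \<bullet> z) * Im w - (e \<bullet> w) * Im z" "Im e * det2 z w = (e \<bullet> w) * Re z - (e \<bullet> z) * Re w"
    by (simp_all add: inner_complex_def algebra_simps)
  then show ?thesis using e by (auto simp: complex_eq_iff simp del: times_complex.sel)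
qed

text \<open>
  Let \<open>e \<bullet> x 1\<close> vanish identically for some \<open>e \<noteq> 0\<close>; otherwise the chain is a \<open>planar_chain\<close> up to signs.
  Then \<open>e \<bullet> x 0\<close> is a nonzero constant, so that zeros of the determinant are zeros of the component of
  \<open>x 1\<close> orthogonal to \<open>e\<close>. That component belongs to a real chain of length \<open>m - 1\<close>, and \<open>m - 1 \<le> 2 * m - 3\<close>.
\<close>
lemma card_planar_zeros_le:
  fixes x :: "nat \<Rightarrow> real \<Rightarrow> complex"
  assumes ch: "chain m \<beta> x {a..<b}" and ab: "a < b" and m: "3 \<le> m"
    and nd: "\<And>e. e \<noteq> 0 \<Longrightarrow> \<exists>j\<le>m. \<exists>t\<in>{a..<b}. e \<bullet> x j t \<noteq> 0"
    and Z: "finite Z" "Z \<subseteq> {a..<b}" "\<And>t. t \<in> Z \<Longrightarrow> det2 (x 0 t) (x 1 t) = 0"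
    and par: "\<And>t. t \<in> {a..<b} \<Longrightarrow> det2 (x (m - 1) t) (x m t) = 0"
  shows "card Z \<le> 2 * m - 3"
proof (cases "\<forall>e. e \<noteq> 0 \<longrightarrow> (\<exists>t\<in>{a..<b}. e \<bullet> x 1 t \<noteq> 0)")
  case True
  obtain s where s: "\<And>j. s j = 1 \<or> s j = (- 1 :: real)"
    and pos: "positive_chain m (\<lambda>j t. sgn (\<beta> j a) * \<beta> j t) (\<lambda>j t. s j *\<^sub>R x j t) {a..<b}"
    using chain_make_positive[OF ch ab] by blast
  have nz: "s j \<noteq> 0" for j using s[of j] by auto
  have det: "det2 (s i *\<^sub>R z) (s j *\<^sub>R w) = s i * s j * det2 z w" for i j z w by (simp add: algebra_simps)
  interpret planar_chain m "\<lambda>j t. sgn (\<beta> j a) * \<beta> j t" "\<lambda>j t. s j *\<^sub>R x j t" a b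
  proof
    show "\<exists>j\<le>m. \<exists>t\<in>{a..<b}. e \<bullet> s j *\<^sub>R x j t \<noteq> 0" if "e \<noteq> 0" for e
      using nd[OF that] nz by simp
    show "\<exists>t\<in>{a..<b}. e \<bullet> s 1 *\<^sub>R x 1 t \<noteq> 0" if "e \<noteq> 0" for e
      using True that nz by simp
  qed (rule pos m)+
  show ?thesis
    by (rule card_det2_zeros_le[OF Z(1,2)]) (simp_all only: det Z(3) par mult_zero_right)
next
  case False
  then obtain e where e: "e \<noteq> 0" "\<And>t. t \<in> {a..<b} \<Longrightarrow> e \<bullet> x 1 t = 0" by blast
  note che = chain_bounded_linear[OF ch bounded_linear_inner_right]
  have ej: "e \<bullet> x j t = 0" if "1 \<le> j" "j \<le> m" "t \<in> {a..<b}" for j t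
    by (rule chain_unique_continuation[OF che order_refl ab order_refl, of 1 e j t]) (use e m that in auto)
  have c: "\<exists>k. \<forall>t\<in>{a..<b}. x 0 t \<bullet> e = k"
  proof -
    have "chain 0 \<beta> (\<lambda>j t. e \<bullet> x j t) {a..<b}"
    proof (rule chain_shorten)
      have "((\<lambda>t. e \<bullet> x 0 t) has_vector_derivative \<beta> 0 t *\<^sub>R (e \<bullet> x (Suc 0) t)) (at t within {a..<b})" if "t \<in> {a..<b}" for t
        using che[of e] m that unfolding chain_def by auto
      moreover have "\<exists>c. \<forall>t\<in>{a..<b}. e \<bullet> x (Suc 0) t = c" using e(2) by auto
      ultimately show "chain (Suc 0) \<beta> (\<lambda>j t. e \<bullet> x j t) {a..<b}"
        using ch m unfolding chain_def by auto
    qed (use e(2) in simp)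
    then show ?thesis unfolding chain_def by (simp add: inner_commute)
  qed
  then obtain k where k: "\<And>t. t \<in> {a..<b} \<Longrightarrow> x 0 t \<bullet> e = k" by blast
  have "k \<noteq> 0"
  proof
    assume "k = 0"
    then have "e \<bullet> x j t = 0" if "j \<le> m" "t \<in> {a..<b}" for j t
      using ej[of j t] k[of t] that by (cases j) (auto simp: inner_commute)
    then show False using nd[OF e(1)] by blast
  qed
  have x1: "(\<i> * e) \<bullet> x 1 t = 0" if "t \<in> {a..<b}" "det2 (x 0 t) (x 1 t) = 0" for t
  proof -
    have "((\<i> * e) \<bullet> x 1 t) * (x 0 t \<bullet> e) = (e \<bullet> e) * det2 (x 0 t) (x 1 t) + (e \<bullet> x 1 t) * ((\<i> * e) \<bullet> x 0 t)"
      by (simp add: inner_complex_def algebra_simps)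
    then show ?thesis using that e(2) k \<open>k \<noteq> 0\<close> by simp
  qed
  \<comment> \<open>The chain of the components orthogonal to \<open>e\<close>, starting at \<open>x 1\<close>.\<close>
  define y where "y = (\<lambda>j t. (\<i> * e) \<bullet> x (Suc j) t)"
  have chy: "chain (m - 1) (\<lambda>j. \<beta> (Suc j)) y {a..<b}"
    using che[of "\<i> * e"] m unfolding chain_def y_def by auto
  have "\<exists>j\<le>m - 1. \<exists>t\<in>{a..<b}. y j t \<noteq> 0"
  proof (rule ccontr)
    assume no: "\<not> ?thesis"
    have x0: "x j t = 0" if "1 \<le> j" "j \<le> m" "t \<in> {a..<b}" for j t
    proof -
      have "(\<i> * e) \<bullet> x j t = 0" using no that unfolding y_def by (cases j) auto
      moreover have "e \<bullet> x j t = 0" using ej that by blast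
      moreover have "(e \<bullet> e) * Re z = Re e * (e \<bullet> z) - Im e * ((\<i> * e) \<bullet> z)"
        "(e \<bullet> e) * Im z = Im e * (e \<bullet> z) + Re e * ((\<i> * e) \<bullet> z)" for z
        by (simp_all add: inner_complex_def algebra_simps)
      ultimately have "(e \<bullet> e) * Re (x j t) = 0" "(e \<bullet> e) * Im (x j t) = 0" by simp_all
      moreover have "e \<bullet> e \<noteq> 0" using e(1) by simp
      ultimately have "Re (x j t) = 0" "Im (x j t) = 0" by (simp_all only: mult_eq_0_iff simp_thms)
      then show ?thesis by (simp add: complex_eq_iff)
    qed
    have d0: "(x 0 has_vector_derivative 0) (at t within {a..<b})" if "t \<in> {a..<b}" for t
    proof -
      have "0 < m" "x (Suc 0) t = 0" using m x0[of 1 t] that by auto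
      moreover from this have "(x 0 has_vector_derivative \<beta> 0 t *\<^sub>R x (Suc 0) t) (at t within {a..<b})"
        using ch that unfolding chain_def by blast
      ultimately show ?thesis by simp
    qed
    from has_vector_derivative_zero_constant[OF convex_real_interval(7) d0]
    obtain q where q: "\<And>t. t \<in> {a..<b} \<Longrightarrow> x 0 t = q" by blast
    have "q \<noteq> 0" using k[of a] q[of a] ab \<open>k \<noteq> 0\<close> by auto
    then have "\<i> * q \<noteq> 0" by simp
    then obtain j t where "j \<le> m" "t \<in> {a..<b}" "(\<i> * q) \<bullet> x j t \<noteq> 0" using nd by blast
    then show False using x0[of j t] q[of t] by (cases j) (auto simp: inner_complex_def)
  qed
  then obtain j t where "j \<le> m - 1" "t \<in> {a..<b}" "y j t \<noteq> 0" by blast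
  moreover have "y 0 t = 0" if "t \<in> Z" for t
    unfolding y_def using x1[OF subsetD[OF Z(2) that] Z(3)[OF that]] by simp
  ultimately have "card Z \<le> m - 1" by (intro card_chain_zeros_le[OF chy Z(1,2)])
  then show ?thesis using m by simp
qed

section \<open>Coordinates with respect to the frame\<close>

context arc_frame
begin

lemma u_sum_frame:
  assumes t: "t \<in> {a..<b}" and k: "k < n"
  shows "u k (\<Sum>j<n. q j *\<^sub>R frame j t) = q k + (\<Sum>j<k. q j * u k (frame j t))"
proof -
  have "u k (\<Sum>j<n. q j *\<^sub>R frame j t) = (\<Sum>j<n. q j * u k (frame j t))"
    unfolding linear_sum[OF linear_u] linear_scale[OF linear_u] by simp
  also have "\<dots> = (\<Sum>j\<in>insert k {..<k}. q j * u k (frame j t))"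
  proof (rule sum.mono_neutral_right)
    show "\<forall>i\<in>{..<n} - insert k {..<k}. q i * u k (frame i t) = 0"
      using u_frame_less[OF _ t] by auto
  qed (use k in auto)
  also have "\<dots> = q k * u k (frame k t) + (\<Sum>j<k. q j * u k (frame j t))" by simp
  finally show ?thesis using u_frame_eq[OF k t] by simp
qed

lemma frame_unique:
  assumes t: "t \<in> {a..<b}" and z: "(\<Sum>j<n. q j *\<^sub>R frame j t) = 0" and k: "k < n"
  shows "q k = 0"
  using k
proof (induction k rule: less_induct)
  case (less k)
  have "q k + (\<Sum>j<k. q j * u k (frame j t)) = 0"
    using u_sum_frame[OF t less.prems, of q] unfolding z linear_0[OF linear_u] by simp
  moreover have "(\<Sum>j<k. q j * u k (frame j t)) = 0"
    using less by (intro sum.neutral) auto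
  ultimately show ?case by simp
qed

lemma frame_expansion:
  assumes t: "t \<in> {a..<b}"
  shows "\<exists>q. w = (\<Sum>j<n. q j *\<^sub>R frame j t)"
proof -
  have "\<exists>q. \<forall>k<m. u k w = q k + (\<Sum>j<k. q j * u k (frame j t))" for m
  proof (induction m)
    case (Suc m)
    then obtain q where q: "\<forall>k<m. u k w = q k + (\<Sum>j<k. q j * u k (frame j t))" by blast
    define r where "r = q(m := u m w - (\<Sum>j<m. q j * u m (frame j t)))"
    have "u k w = r k + (\<Sum>j<k. r j * u k (frame j t))" if "k < Suc m" for k
    proof -
      have "(\<Sum>j<k. r j * u k (frame j t)) = (\<Sum>j<k. q j * u k (frame j t))"
        unfolding r_def using that by (intro sum.cong) auto
      then show ?thesis using q that by (cases "k = m") (auto simp: r_def)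
    qed
    then show ?case by blast
  qed simp
  then obtain q where q: "\<And>k. k < n \<Longrightarrow> u k w = q k + (\<Sum>j<k. q j * u k (frame j t))" by blast
  have "u k (w - (\<Sum>j<n. q j *\<^sub>R frame j t)) = 0" if "k < n" for k
    unfolding linear_diff[OF linear_u] u_sum_frame[OF t that] using q[OF that] by simp
  then have "w - (\<Sum>j<n. q j *\<^sub>R frame j t) = 0" using eq_0_iff_u by blast
  then show ?thesis by (intro exI[of _ q]) simp
qed

definition coord :: "real ^ 'n \<Rightarrow> nat \<Rightarrow> real \<Rightarrow> real" where
  "coord w j t = (SOME q. w = (\<Sum>j<n. q j *\<^sub>R frame j t)) j"

lemma coord_sum: "t \<in> {a..<b} \<Longrightarrow> w = (\<Sum>j<n. coord w j t *\<^sub>R frame j t)"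
  unfolding coord_def using someI_ex[OF frame_expansion] .

lemma coord_unique:
  assumes t: "t \<in> {a..<b}" and w: "w = (\<Sum>j<n. q j *\<^sub>R frame j t)" and k: "k < n"
  shows "coord w k t = q k"
proof -
  have "(\<Sum>j<n. coord w j t *\<^sub>R frame j t) = (\<Sum>j<n. q j *\<^sub>R frame j t)"
    using coord_sum[OF t, of w] w by simp
  then have "(\<Sum>j<n. (coord w j t - q j) *\<^sub>R frame j t) = 0"
    unfolding scaleR_diff_left sum_subtractf by simp
  from frame_unique[OF t this k] show ?thesis by simp
qed

lemma coord_combination:
  assumes t: "t \<in> {a..<b}" and k: "k < n"
  shows "coord (r *\<^sub>R w + r' *\<^sub>R w') k t = r * coord w k t + r' * coord w' k t"
proof (rule coord_unique[OF t _ k])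
  have "r *\<^sub>R w + r' *\<^sub>R w' = r *\<^sub>R (\<Sum>j<n. coord w j t *\<^sub>R frame j t) + r' *\<^sub>R (\<Sum>j<n. coord w' j t *\<^sub>R frame j t)"
    using coord_sum[OF t, of w] coord_sum[OF t, of w'] by simp
  also have "\<dots> = (\<Sum>j<n. (r * coord w j t + r' * coord w' j t) *\<^sub>R frame j t)"
    by (simp add: scaleR_sum_right scaleR_add_left sum.distrib)
  finally show "r *\<^sub>R w + r' *\<^sub>R w' = (\<Sum>j<n. (r * coord w j t + r' * coord w' j t) *\<^sub>R frame j t)" .
qed

text \<open>
  Because \<open>u k (frame j t)\<close> is a unitriangular matrix, the coordinates are computed from those with smaller index, and this
  recursion can be differentiated.
\<close>
lemma coord_rec:
  assumes t: "t \<in> {a..<b}" and k: "k < n"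
  shows "coord w k t = u k w - (\<Sum>j<k. coord w j t * u k (frame j t))"
  using u_sum_frame[OF t k, of "\<lambda>j. coord w j t"] coord_sum[OF t, of w, symmetric] by simp

lemma coord_0: "t \<in> {a..<b} \<Longrightarrow> coord w 0 t = u 0 w"
  using coord_rec[of t 0 w] n_pos by simp

text \<open>
  The vector \<open>w\<close> is constant, so its coordinates with respect to the moving frame satisfy the adjoint system.
\<close>
lemma coord_derivative:
  assumes t: "t \<in> {a..<b}" and k: "k < n"
  shows "(coord w k has_real_derivative (if k = 0 then 0 else - (speed (k - 1) t * coord w (k - 1) t))) (at t within {a..<b})"
  using k
proof (induction k rule: less_induct)
  case (less k)
  define d where "d = (\<lambda>j. if j = 0 then 0 else - (speed (j - 1) t * coord w (j - 1) t))"
  have f: "((\<lambda>t. u k (frame j t)) has_real_derivative speed j t * u k (frame (Suc j) t)) (at t within {a..<b})" if "j < k" for j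
  proof -
    have "(frame j has_vector_derivative speed j t *\<^sub>R frame (Suc j) t) (at t within {a..<b})"
      using chain_frame that less.prems t unfolding chain_def by auto
    from bounded_linear.has_vector_derivative[OF linear_u[unfolded linear_conv_bounded_linear] this]
    have "((\<lambda>t. u k (frame j t)) has_vector_derivative u k (speed j t *\<^sub>R frame (Suc j) t)) (at t within {a..<b})" .
    then show ?thesis unfolding has_real_derivative_iff_has_vector_derivative linear_scale[OF linear_u] by simp
  qed
  have q: "(coord w j has_real_derivative d j) (at t within {a..<b})" if "j < k" for j
    using less.IH[OF that] that less.prems unfolding d_def by auto
  have "((\<lambda>t. u k w - (\<Sum>j<k. coord w j t * u k (frame j t))) has_real_derivative
      0 - (\<Sum>j<k. d j * u k (frame j t) + speed j t * u k (frame (Suc j) t) * coord w j t)) (at t within {a..<b})"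
  proof (rule DERIV_diff[OF DERIV_const DERIV_sum])
    fix j assume "j \<in> {..<k}"
    then have "j < k" by simp
    from DERIV_mult[OF q[OF this] f[OF this]]
    show "((\<lambda>t. coord w j t * u k (frame j t)) has_real_derivative
      d j * u k (frame j t) + speed j t * u k (frame (Suc j) t) * coord w j t) (at t within {a..<b})" .
  qed
  moreover have "(\<Sum>j<k. d j * u k (frame j t) + speed j t * u k (frame (Suc j) t) * coord w j t) = - d k"
  proof -
    define g where "g = (\<lambda>j. - d j * u k (frame j t))"
    have "d j * u k (frame j t) + speed j t * u k (frame (Suc j) t) * coord w j t = g (Suc j) - g j" for j
      unfolding g_def d_def by (simp add: algebra_simps)
    then have "(\<Sum>j<k. d j * u k (frame j t) + speed j t * u k (frame (Suc j) t) * coord w j t) = g k - g 0"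
      by (simp add: sum_lessThan_telescope)
    also have "\<dots> = - d k" unfolding g_def using u_frame_eq[OF less.prems t] by (simp add: d_def)
    finally show ?thesis .
  qed
  ultimately have der: "((\<lambda>t. u k w - (\<Sum>j<k. coord w j t * u k (frame j t))) has_real_derivative d k) (at t within {a..<b})"
    by simp
  have "(coord w k has_real_derivative d k) (at t within {a..<b})"
    by (rule has_field_derivative_transform_within[OF der zero_less_one t]) (use coord_rec[OF _ less.prems] in simp)
  then show ?case unfolding d_def .
qed

text \<open>
  Reversal of the order and alternating signs turn the adjoint system into a chain.
\<close>
definition dual :: "real ^ 'n \<Rightarrow> nat \<Rightarrow> real \<Rightarrow> real" where
  "dual w i t = (- 1) ^ i * coord w (n - 1 - i) t"

lemma chain_dual: "chain (n - 1) (\<lambda>i. speed (n - 2 - i)) (dual w) {a..<b}"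
  unfolding chain_def
proof (intro conjI allI impI ballI)
  fix i assume i: "i < n - 1"
  have s: "n - 2 - i < n - 1" "n - 1 - i - 1 = n - 2 - i" "n - 1 - Suc i = n - 2 - i" "n - 1 - i \<noteq> 0" "n - 1 - i < n"
    using i by auto
  show "continuous_on {a..<b} (speed (n - 2 - i))" using chain_frame s(1) unfolding chain_def by blast
  fix t assume t: "t \<in> {a..<b}"
  show "speed (n - 2 - i) t \<noteq> 0" using chain_frame s(1) t unfolding chain_def by blast
  have "((\<lambda>t. (- 1) ^ i * coord w (n - 1 - i) t) has_real_derivative (- 1) ^ i * (- (speed (n - 2 - i) t * coord w (n - 2 - i) t))) (at t within {a..<b})"
    using coord_derivative[OF t s(5), of w] unfolding s(2) using s(4) by (intro DERIV_cmult) simp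
  moreover have "(- 1) ^ i * (- (speed (n - 2 - i) t * coord w (n - 2 - i) t)) = speed (n - 2 - i) t *\<^sub>R dual w (Suc i) t"
    unfolding dual_def s(3) by simp
  moreover have "(\<lambda>t. (- 1) ^ i * coord w (n - 1 - i) t) = dual w i" by (simp add: dual_def fun_eq_iff)
  ultimately show "(dual w i has_vector_derivative speed (n - 2 - i) t *\<^sub>R dual w (Suc i) t) (at t within {a..<b})"
    unfolding has_real_derivative_iff_has_vector_derivative by simp
next
  show "\<exists>c. \<forall>t\<in>{a..<b}. dual w (n - 1) t = c"
    by (intro exI[of _ "(- 1) ^ (n - 1) * u 0 w"] ballI) (simp add: dual_def coord_0)
qed

lemma coord_eq_0_osculating:
  assumes t: "t \<in> {a..<b}" and w: "w \<in> osculating_flag J c t k" and k: "k \<le> j" "j < n"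
  shows "coord w j t = 0"
proof -
  have kn: "k \<le> n" using k by simp
  have "w \<in> span ((\<lambda>j. frame j t) ` {..<k})" using w unfolding osculating_flag_frame[OF t kn] .
  moreover have "subspace {w. coord w j t = 0}"
    unfolding subspace_def
  proof (intro conjI allI ballI)
    have 0: "coord (0 *\<^sub>R 0 + 0 *\<^sub>R 0) j t = 0" unfolding coord_combination[OF t k(2)] by simp
    then show "0 \<in> {w. coord w j t = 0}" by simp
    fix x assume x: "x \<in> {w. coord w j t = 0}"
    show "r *\<^sub>R x \<in> {w. coord w j t = 0}" for r using coord_combination[OF t k(2), of r x 0 0] x by simp
    fix y assume y: "y \<in> {w. coord w j t = 0}"
    show "x + y \<in> {w. coord w j t = 0}" using coord_combination[OF t k(2), of 1 x 1 y] x y by simp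
  qed
  moreover have "(\<lambda>j. frame j t) ` {..<k} \<subseteq> {w. coord w j t = 0}"
  proof safe
    fix i assume i: "i < k"
    have "frame i t = (\<Sum>m<n. (if m = i then 1 else 0) *\<^sub>R frame m t)"
      using i kn by (simp add: if_distrib[of "\<lambda>r. r *\<^sub>R _"] cong: if_cong)
    from coord_unique[OF t this k(2)] show "coord (frame i t) j t = 0" using i k by simp
  qed
  ultimately show ?thesis using span_minimal[of "(\<lambda>j. frame j t) ` {..<k}" "{w. coord w j t = 0}"] by blast
qed

lemma osculating_flagI:
  assumes t: "t \<in> {a..<b}" and "k \<le> n" "\<And>j. k \<le> j \<Longrightarrow> j < n \<Longrightarrow> coord w j t = 0"
  shows "w \<in> osculating_flag J c t k"
proof -
  have "w = (\<Sum>j<n. coord w j t *\<^sub>R frame j t)" by (rule coord_sum[OF t])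
  also have "\<dots> = (\<Sum>j<k. coord w j t *\<^sub>R frame j t)"
    using assms by (intro sum.mono_neutral_right) auto
  also have "\<dots> \<in> span ((\<lambda>j. frame j t) ` {..<k})"
    by (intro span_sum span_scale span_base) auto
  finally show ?thesis unfolding osculating_flag_frame[OF t assms(2)] .
qed

lemma coord_eq_0_osculating_end:
  assumes t: "t \<in> {a..<b}" and w: "w \<in> osculating_flag J c b k" and j: "j < n - k"
  shows "coord w j t = 0"
  using j
proof (induction j rule: less_induct)
  case (less j)
  have jn: "j < n" using less.prems by simp
  have "(\<Sum>i<j. coord w i t * u j (frame i t)) = 0"
    using less by (intro sum.neutral) auto
  then show ?case
    using coord_rec[OF t jn, of w] u_osculating_flag_end[OF w less.prems] by simp
qed

end

section \<open>The upper bound\<close>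

text \<open>
  By convexity no nonzero form vanishes to order \<open>CARD('n)\<close> at \<open>b\<close>, so that the jet at \<open>b\<close> is a basis.
\<close>
lemma (in thick) arc_frame_exists:
  fixes c :: "real \<Rightarrow> (real ^ 'n) set"
  assumes "convex_curve J T c" "T \<subseteq> J" "a < b" "{a..b} \<subseteq> T"
  shows "\<exists>u. arc_frame J T c a b u CARD('n)"
proof -
  let ?D = "\<lambda>i. nderiv J i (lift_at J c b) b"
  have bT: "b \<in> T" using assms by auto
  then have bJ: "b \<in> J" using assms(2) by blast
  have "\<exists>v. local_lift J c b v" using assms(1) bJ unfolding convex_curve_def smooth_curve_def by blast
  then have lift: "local_lift J c b (lift_at J c b)" using local_lift_lift_at by blast
  have "l = (\<lambda>_. 0)" if l: "linear l" "\<And>i. i < CARD('n) \<Longrightarrow> l (?D i) = 0" for l :: "real ^ 'n \<Rightarrow> real"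
  proof (rule ccontr)
    assume nz: "l \<noteq> (\<lambda>_. 0)"
    have "vanishes CARD('n) (\<lambda>s. l (lift_at J c b s)) b"
      unfolding vanishes_def nderiv_linear[OF l(1) bJ local_liftD(1)[OF lift]] using l(2) by blast
    from convex_curve_vanishing(1)[OF assms(1,2) l(1) nz bT lift this] show False by simp
  qed
  then obtain u :: "nat \<Rightarrow> real ^ 'n \<Rightarrow> real" where u: "\<And>j. linear (u j)"
    "\<And>i j. i < CARD('n) \<Longrightarrow> j < CARD('n) \<Longrightarrow> u j (?D i) = (if i = j then 1 else 0)"
    "\<And>w. w = (\<Sum>i<CARD('n). u i w *\<^sub>R ?D i)"
    using exists_dual_basis[of ?D] by blast
  define u' where "u' = (\<lambda>j. u (CARD('n) - 1 - j))"
  have "arc_frame J T c a b u' CARD('n)"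
    unfolding arc_frame_def arc_frame_axioms_def
  proof (intro conjI allI impI)
    show "thick J" by (rule thick_axioms)
    show "linear (u' j)" for j unfolding u'_def by (rule u(1))
    show "u' j (?D i) = (if i + j = CARD('n) - 1 then 1 else 0)" if "i < CARD('n)" "j < CARD('n)" for i j
      unfolding u'_def using u(2)[of i "CARD('n) - 1 - j"] that by auto
    fix w
    have "w = (\<Sum>i<CARD('n). u i w *\<^sub>R ?D i)" by (rule u(3))
    also have "\<dots> = (\<Sum>j<CARD('n). u (CARD('n) - Suc j) w *\<^sub>R ?D (CARD('n) - Suc j))"
      by (rule sum.nat_diff_reindex[symmetric])
    finally show "w = (\<Sum>j<CARD('n). u' j w *\<^sub>R ?D (CARD('n) - 1 - j))" unfolding u'_def by simp
  qed (rule assms refl)+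
  then show ?thesis by blast
qed

definition meets :: "'a::zero set \<Rightarrow> 'a set \<Rightarrow> bool" where
  "meets A B \<longleftrightarrow> (\<exists>w\<in>A \<inter> B. w \<noteq> 0)"

context arc_frame
begin

lemma coord_nonzero: "t \<in> {a..<b} \<Longrightarrow> w \<noteq> 0 \<Longrightarrow> \<exists>j<n. coord w j t \<noteq> 0"
proof (rule ccontr)
  assume t: "t \<in> {a..<b}" and w: "w \<noteq> 0" and no: "\<not> (\<exists>j<n. coord w j t \<noteq> 0)"
  have "(\<Sum>j<n. coord w j t *\<^sub>R frame j t) = 0" using no by (intro sum.neutral) auto
  then show False using coord_sum[OF t, of w] w by simp
qed

lemma linear_form_frame_nonzero:
  assumes t: "t \<in> {a..<b}" and l: "linear (l :: real ^ 'n \<Rightarrow> real)" "l x \<noteq> 0"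
  shows "\<exists>j<n. l (frame j t) \<noteq> 0"
proof (rule ccontr)
  assume no: "\<not> ?thesis"
  have "l x = l (\<Sum>j<n. coord x j t *\<^sub>R frame j t)" using coord_sum[OF t, of x] by simp
  also have "\<dots> = (\<Sum>j<n. coord x j t * l (frame j t))"
    unfolding linear_sum[OF l(1)] linear_scale[OF l(1)] by simp
  also have "\<dots> = 0" using no by (intro sum.neutral) auto
  finally show False using l(2) by simp
qed

lemma coord_sum_pair:
  assumes t: "t \<in> {a..<b}" and ij: "i < n" "j < n" "i \<noteq> j" and z: "\<And>k. k < n \<Longrightarrow> k \<noteq> i \<Longrightarrow> k \<noteq> j \<Longrightarrow> coord w k t = 0"
  shows "w = coord w i t *\<^sub>R frame i t + coord w j t *\<^sub>R frame j t"
proof -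
  have "w = (\<Sum>k<n. coord w k t *\<^sub>R frame k t)" by (rule coord_sum[OF t])
  also have "\<dots> = (\<Sum>k\<in>{i, j}. coord w k t *\<^sub>R frame k t)"
    using ij z by (intro sum.mono_neutral_right) auto
  finally show ?thesis using ij by simp
qed

lemma form_at_single_frame:
  assumes t: "t \<in> {a..<b}" and l: "linear (l :: real ^ 'n \<Rightarrow> real)" "l w = 0" and w: "w \<noteq> 0"
    and i: "i < n" and z: "\<And>k. k < n \<Longrightarrow> k \<noteq> i \<Longrightarrow> coord w k t = 0"
  shows "l (frame i t) = 0"
proof -
  have "w = (\<Sum>k<n. coord w k t *\<^sub>R frame k t)" by (rule coord_sum[OF t])
  also have "\<dots> = (\<Sum>k\<in>{i}. coord w k t *\<^sub>R frame k t)"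
    using i z by (intro sum.mono_neutral_right) auto
  finally have "w = coord w i t *\<^sub>R frame i t" by simp
  then have "coord w i t * l (frame i t) = 0" "coord w i t \<noteq> 0"
    using l linear_scale[OF l(1), of "coord w i t" "frame i t"] w by auto
  then show ?thesis by simp
qed

text \<open>
  The parameters are zeros of \<open>l (frame 0 t)\<close> for a form \<open>l\<close> that vanishes on \<open>M\<close>. The condition at \<open>b\<close>
  says that \<open>l\<close> vanishes on \<open>frame (n - 1)\<close> as well, and this shortens the chain by one.
\<close>
lemma card_meets_hyperplane:
  assumes n2: "2 \<le> n" and M: "subspace M" "dim M < n"
    and Z: "finite Z" "Z \<subseteq> {a..<b}" "\<And>t. t \<in> Z \<Longrightarrow> meets (osculating_flag J c t 1) M"
    and b: "meets (osculating_flag J c b 1) M"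
  shows "card Z \<le> n - 2"
proof -
  have "M \<noteq> UNIV" using M(2) unfolding n by (auto simp: dim_UNIV)
  then obtain x where "x \<notin> M" by blast
  then obtain l :: "real ^ 'n \<Rightarrow> real" where l: "linear l" "\<forall>y\<in>M. l y = 0" "l x \<noteq> 0"
    using linear_form_separates[OF M(1)] by blast
  have ch: "chain (Suc (n - 2)) speed (\<lambda>j t. l (frame j t)) {a..<b}"
    using chain_bounded_linear[OF chain_frame l(1)[unfolded linear_conv_bounded_linear]] n2
    by (simp add: numeral_2_eq_2 Suc_diff_Suc)
  have aS: "a \<in> {a..<b}" using ab by simp
  obtain j where j: "j < n" "l (frame j a) \<noteq> 0" using linear_form_frame_nonzero[OF aS l(1,3)] by blast
  have "l (frame 0 t) = 0" if t: "t \<in> Z" for t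
  proof -
    have tS: "t \<in> {a..<b}" using Z(2) t by blast
    obtain w where w: "w \<in> osculating_flag J c t 1" "w \<in> M" "w \<noteq> 0" using Z(3)[OF t] unfolding meets_def by blast
    show ?thesis
      by (rule form_at_single_frame[OF tS l(1) _ w(3) n_pos]) (use l(2) w coord_eq_0_osculating[OF tS w(1)] in auto)
  qed
  moreover have "l (frame (Suc (n - 2)) t) = 0" if tS: "t \<in> {a..<b}" for t
  proof -
    obtain w where w: "w \<in> osculating_flag J c b 1" "w \<in> M" "w \<noteq> 0" using b unfolding meets_def by blast
    show ?thesis
      by (rule form_at_single_frame[OF tS l(1) _ w(3)]) (use n2 l(2) w coord_eq_0_osculating_end[OF tS w(1)] in auto)
  qed
  ultimately show ?thesis
    using card_chain_zeros_less[OF ch Z(1,2) _ _ aS j(2)] j(1) n2 by simp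
qed

lemma chain_Complex:
  fixes x y :: "nat \<Rightarrow> real \<Rightarrow> real"
  assumes "chain m \<beta> x S" "chain m \<beta> y S"
  shows "chain m \<beta> (\<lambda>j t. Complex (x j t) (y j t)) S"
proof -
  have "((\<lambda>t. Complex (x j t) (y j t)) has_vector_derivative \<beta> j t *\<^sub>R Complex (x (Suc j) t) (y (Suc j) t)) (at t within S)"
    if "j < m" "t \<in> S" for j t
  proof -
    have "(x j has_vector_derivative \<beta> j t *\<^sub>R x (Suc j) t) (at t within S)"
      "(y j has_vector_derivative \<beta> j t *\<^sub>R y (Suc j) t) (at t within S)"
      using assms that unfolding chain_def by blast+
    then show ?thesis unfolding has_vector_derivative_complex_iff has_real_derivative_iff_has_vector_derivative by simp
  qed
  moreover obtain k k' where "\<forall>t\<in>S. x m t = k" "\<forall>t\<in>S. y m t = k'" using assms unfolding chain_def by blast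
  then have "\<exists>k. \<forall>t\<in>S. Complex (x m t) (y m t) = k" by (intro exI[of _ "Complex k k'"]) simp
  ultimately show ?thesis using assms(1) unfolding chain_def by blast
qed

lemma inner_Complex: "e \<bullet> Complex r r' = Re e * r + Im e * r'"
  by (simp add: inner_complex_def)

lemma det2_zero_of_relation:
  assumes "q *\<^sub>R z + q' *\<^sub>R w = 0" "q \<noteq> 0 \<or> q' \<noteq> 0"
  shows "det2 z w = 0"
proof -
  have "q * det2 z w = 0" "q' * det2 z w = 0"
    using arg_cong[OF assms(1), of "\<lambda>y. det2 y w"] arg_cong[OF assms(1), of "\<lambda>y. det2 z y"]
    by (simp_all add: algebra_simps)
  then show ?thesis using assms(2) by (simp only: mult_eq_0_iff) blast
qed

lemma forms_at_frame_pair: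
  assumes t: "t \<in> {a..<b}" and l: "linear (l :: real ^ 'n \<Rightarrow> real)" "linear (l' :: real ^ 'n \<Rightarrow> real)" "l w = 0" "l' w = 0" and w: "w \<noteq> 0"
    and ij: "i < n" "j < n" "i \<noteq> j" and z: "\<And>k. k < n \<Longrightarrow> k \<noteq> i \<Longrightarrow> k \<noteq> j \<Longrightarrow> coord w k t = 0"
  shows "det2 (Complex (l (frame i t)) (l' (frame i t))) (Complex (l (frame j t)) (l' (frame j t))) = 0"
proof (rule det2_zero_of_relation)
  have eq: "w = coord w i t *\<^sub>R frame i t + coord w j t *\<^sub>R frame j t" by (rule coord_sum_pair[OF t ij z])
  then have "coord w i t * l (frame i t) + coord w j t * l (frame j t) = 0"
    "coord w i t * l' (frame i t) + coord w j t * l' (frame j t) = 0"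
    using l(3,4) linear_add[OF l(1)] linear_add[OF l(2)] linear_scale[OF l(1)] linear_scale[OF l(2)] by (metis real_scaleR_def)+
  then show "coord w i t *\<^sub>R Complex (l (frame i t)) (l' (frame i t)) + coord w j t *\<^sub>R Complex (l (frame j t)) (l' (frame j t)) = 0"
    by (simp add: complex_eq_iff)
  show "coord w i t \<noteq> 0 \<or> coord w j t \<noteq> 0" using eq w by auto
qed

text \<open>
  Two independent forms that vanish on \<open>M\<close> map the frame to a planar chain. The osculating plane at \<open>t\<close> meets \<open>M\<close> only
  if the images of \<open>frame 0 t\<close> and \<open>frame 1 t\<close> are parallel; the condition at \<open>b\<close> makes the last two images parallel.
\<close>
lemma card_meets_codim2:
  assumes n4: "4 \<le> n" and M: "subspace M" "dim M + 2 \<le> n"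
    and Z: "finite Z" "Z \<subseteq> {a..<b}" "\<And>t. t \<in> Z \<Longrightarrow> meets (osculating_flag J c t 2) M"
    and b: "meets (osculating_flag J c b 2) M"
  shows "card Z \<le> 2 * n - 5"
proof -
  have "M \<noteq> UNIV" using M(2) unfolding n by (auto simp: dim_UNIV)
  then obtain x where x: "x \<notin> M" by blast
  then obtain l :: "real ^ 'n \<Rightarrow> real" where l: "linear l" "\<forall>y\<in>M. l y = 0" "l x \<noteq> 0"
    using linear_form_separates[OF M(1)] by blast
  \<comment> \<open>Enlarging \<open>M\<close> by a vector outside the kernel of \<open>l\<close> gives a second form that is independent of \<open>l\<close>.\<close>
  define M' where "M' = span (insert x M)"
  have "dim M' \<le> Suc (dim M)" unfolding M'_def dim_span by (simp add: dim_insert)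
  then have "M' \<noteq> UNIV" using M(2) unfolding n by (auto simp: dim_UNIV)
  then obtain x' where x': "x' \<notin> M'" by blast
  then obtain l' :: "real ^ 'n \<Rightarrow> real" where l': "linear l'" "\<forall>y\<in>M'. l' y = 0" "l' x' \<noteq> 0"
    using linear_form_separates[of M'] unfolding M'_def by blast
  have l'M: "l' y = 0" if "y \<in> M" for y using l'(2) that unfolding M'_def by (auto intro: span_base)
  have l'x: "l' x = 0" using l'(2) unfolding M'_def by (auto intro: span_base)
  define X where "X = (\<lambda>j t. Complex (l (frame j t)) (l' (frame j t)))"
  have ch: "chain (n - 1) speed X {a..<b}"
    unfolding X_def
    by (intro chain_Complex chain_bounded_linear[OF chain_frame] l(1)[unfolded linear_conv_bounded_linear] l'(1)[unfolded linear_conv_bounded_linear])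
  have aS: "a \<in> {a..<b}" using ab by simp
  have nd: "\<exists>j\<le>n - 1. \<exists>t\<in>{a..<b}. e \<bullet> X j t \<noteq> 0" if "e \<noteq> 0" for e
  proof -
    define p where "p = (\<lambda>y. Re e * l y + Im e * l' y)"
    have p: "linear p"
      unfolding p_def by (rule linearI)
        (simp_all add: linear_add[OF l(1)] linear_scale[OF l(1)] linear_add[OF l'(1)] linear_scale[OF l'(1)] algebra_simps)
    have "p x \<noteq> 0 \<or> p x' \<noteq> 0"
    proof (cases "Re e = 0")
      case True
      then have "Im e \<noteq> 0" using that by (simp add: complex_eq_iff)
      then show ?thesis unfolding p_def using True l'(3) by simp
    next
      case False
      then show ?thesis unfolding p_def using l'x l(3) by simp
    qed
    then obtain j where "j < n" "p (frame j a) \<noteq> 0" using linear_form_frame_nonzero[OF aS p] by blast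
    then have "j \<le> n - 1" "e \<bullet> X j a \<noteq> 0" unfolding X_def inner_Complex p_def by auto
    then show ?thesis using aS by blast
  qed
  have "card Z \<le> 2 * (n - 1) - 3"
  proof (rule card_planar_zeros_le[OF ch ab(1) _ nd Z(1,2)])
    show "3 \<le> n - 1" using n4 by simp
    show "det2 (X 0 t) (X 1 t) = 0" if t: "t \<in> Z" for t
    proof -
      have tS: "t \<in> {a..<b}" using Z(2) t by blast
      obtain w where w: "w \<in> osculating_flag J c t 2" "w \<in> M" "w \<noteq> 0" using Z(3)[OF t] unfolding meets_def by blast
      have lw: "l w = 0" "l' w = 0" using l(2) l'M w(2) by auto
      show ?thesis unfolding X_def
        by (rule forms_at_frame_pair[OF tS l(1) l'(1) lw w(3)]) (use n4 coord_eq_0_osculating[OF tS w(1)] in auto)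
    qed
    show "det2 (X (n - 1 - 1) t) (X (n - 1) t) = 0" if tS: "t \<in> {a..<b}" for t
    proof -
      obtain w where w: "w \<in> osculating_flag J c b 2" "w \<in> M" "w \<noteq> 0" using b unfolding meets_def by blast
      have lw: "l w = 0" "l' w = 0" using l(2) l'M w(2) by auto
      show ?thesis unfolding X_def
        by (rule forms_at_frame_pair[OF tS l(1) l'(1) lw w(3)]) (use n4 coord_eq_0_osculating_end[OF tS w(1)] in auto)
    qed
  qed
  then show ?thesis by simp
qed

text \<open>
  This is the dual of the case of a hyperplane: the chain consists of the coordinates of a vector.
\<close>
lemma card_meets_line:
  assumes n2: "2 \<le> n" and M: "M = span {w0}" "w0 \<noteq> 0"
    and Z: "finite Z" "Z \<subseteq> {a..<b}" "\<And>t. t \<in> Z \<Longrightarrow> meets (osculating_flag J c t (n - 1)) M"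
    and b: "meets (osculating_flag J c b (n - 1)) M"
  shows "card Z \<le> n - 2"
proof -
  have *: "w0 \<in> V" if V: "subspace V" "meets V M" for V
  proof -
    obtain w where w: "w \<in> V" "w \<in> span {w0}" "w \<noteq> 0" using V(2) unfolding meets_def M by blast
    then obtain r where r: "w = r *\<^sub>R w0" by (auto simp: span_singleton)
    then have "w0 = inverse r *\<^sub>R w" using w(3) by auto
    then show ?thesis using subspace_scale[OF V(1) w(1), of "inverse r"] by simp
  qed
  have sub: "subspace (osculating_flag J c t k)" for t k unfolding osculating_flag_def by (rule subspace_span)
  have ch: "chain (Suc (n - 2)) (\<lambda>i. speed (n - 2 - i)) (dual w0) {a..<b}"
    using chain_dual[of w0] n2 by (simp add: numeral_2_eq_2 Suc_diff_Suc)
  have aS: "a \<in> {a..<b}" using ab by simp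
  obtain j where j: "j < n" "coord w0 j a \<noteq> 0" using coord_nonzero[OF aS M(2)] by blast
  then have j': "n - 1 - j \<le> Suc (n - 2)" "dual w0 (n - 1 - j) a \<noteq> 0" unfolding dual_def by auto
  show ?thesis
  proof (rule card_chain_zeros_less[OF ch Z(1,2) _ j'(1) aS j'(2)])
    show "dual w0 0 t = 0" if "t \<in> Z" for t
      unfolding dual_def
      using coord_eq_0_osculating[OF subsetD[OF Z(2) that] *[OF sub Z(3)[OF that]], of "n - 1"] n_pos by simp
    show "dual w0 (Suc (n - 2)) t = 0" if "t \<in> {a..<b}" for t
      unfolding dual_def using coord_eq_0_osculating_end[OF that *[OF sub b], of 0] n2 by simp
  qed
qed

text \<open>
  This is the dual of the case of codimension two: the planar chain consists of the coordinates of two vectors.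
\<close>
lemma card_meets_plane:
  assumes n4: "4 \<le> n" and M: "M = span {w1, w2}" "w1 \<noteq> w2" "independent {w1, w2}"
    and Z: "finite Z" "Z \<subseteq> {a..<b}" "\<And>t. t \<in> Z \<Longrightarrow> meets (osculating_flag J c t (n - 2)) M"
    and b: "meets (osculating_flag J c b (n - 2)) M"
  shows "card Z \<le> 2 * n - 5"
proof -
  have *: "\<exists>e. e \<noteq> 0 \<and> Re e *\<^sub>R w1 + Im e *\<^sub>R w2 \<in> V" if V: "meets V M" for V
  proof -
    obtain w where w: "w \<in> V" "w \<in> span {w1, w2}" "w \<noteq> 0" using V unfolding meets_def M by blast
    then obtain r where "w - r *\<^sub>R w1 \<in> span {w2}" by (auto simp: span_insert)
    then obtain r' where "w - r *\<^sub>R w1 = r' *\<^sub>R w2" by (auto simp: span_singleton)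
    then have eq: "w = Re (Complex r r') *\<^sub>R w1 + Im (Complex r r') *\<^sub>R w2" by (simp add: diff_eq_eq add.commute)
    then have "Complex r r' \<noteq> 0" using w(3) by (auto simp: complex_eq_iff)
    then show ?thesis using w(1) eq by metis
  qed
  have indep: "Re e *\<^sub>R w1 + Im e *\<^sub>R w2 \<noteq> 0" if "e \<noteq> 0" for e
  proof
    assume z: "Re e *\<^sub>R w1 + Im e *\<^sub>R w2 = 0"
    have "(\<Sum>v\<in>{w1, w2}. (if v = w1 then Re e else Im e) *\<^sub>R v) = 0" using z M(2) by simp
    then have "(if v = w1 then Re e else Im e) = 0" if "v \<in> {w1, w2}" for v
      using independentD[OF M(3) _ subset_refl, of "\<lambda>v. if v = w1 then Re e else Im e" v] that by simp
    from this[of w1] this[of w2] have "Re e = 0" "Im e = 0" using M(2) by auto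
    then show False using \<open>e \<noteq> 0\<close> by (simp add: complex_eq_iff)
  qed
  define X where "X = (\<lambda>j t. Complex (dual w1 j t) (dual w2 j t))"
  have ch: "chain (n - 1) (\<lambda>i. speed (n - 2 - i)) X {a..<b}"
    unfolding X_def by (intro chain_Complex chain_dual)
  have eX: "e \<bullet> X j t = dual (Re e *\<^sub>R w1 + Im e *\<^sub>R w2) j t" if "t \<in> {a..<b}" for e j t
    unfolding X_def inner_Complex dual_def using coord_combination[OF that, of "n - 1 - j"] n_pos by (simp add: algebra_simps)
  have aS: "a \<in> {a..<b}" using ab by simp
  have nd: "\<exists>j\<le>n - 1. \<exists>t\<in>{a..<b}. e \<bullet> X j t \<noteq> 0" if e: "e \<noteq> 0" for e
  proof -
    obtain j where j: "j < n" "coord (Re e *\<^sub>R w1 + Im e *\<^sub>R w2) j a \<noteq> 0" using coord_nonzero[OF aS indep[OF e]] by blast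
    then have "e \<bullet> X (n - 1 - j) a \<noteq> 0" unfolding eX[OF aS] dual_def by auto
    then show ?thesis using aS j(1) by (intro exI[of _ "n - 1 - j"]) auto
  qed
  have "card Z \<le> 2 * (n - 1) - 3"
  proof (rule card_planar_zeros_le[OF ch ab(1) _ nd Z(1,2)])
    show "3 \<le> n - 1" using n4 by simp
    show "det2 (X 0 t) (X 1 t) = 0" if t: "t \<in> Z" for t
    proof -
      have tS: "t \<in> {a..<b}" using Z(2) t by blast
      obtain e where e: "e \<noteq> 0" "Re e *\<^sub>R w1 + Im e *\<^sub>R w2 \<in> osculating_flag J c t (n - 2)" using *[OF Z(3)[OF t]] by blast
      have "e \<bullet> X j t = 0" if "j \<le> 1" for j
        unfolding eX[OF tS] dual_def using coord_eq_0_osculating[OF tS e(2), of "n - 1 - j"] that n4 by simp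
      then show ?thesis by (intro det2_eq_0I[OF e(1)]) simp_all
    qed
    show "det2 (X (n - 1 - 1) t) (X (n - 1) t) = 0" if tS: "t \<in> {a..<b}" for t
    proof -
      obtain e where e: "e \<noteq> 0" "Re e *\<^sub>R w1 + Im e *\<^sub>R w2 \<in> osculating_flag J c b (n - 2)" using *[OF b] by blast
      have "e \<bullet> X j t = 0" if "n - 2 \<le> j" "j < n" for j
        unfolding eX[OF tS] dual_def using coord_eq_0_osculating_end[OF tS e(2), of "n - 1 - j"] that n4 by simp
      then show ?thesis using n4 by (intro det2_eq_0I[OF e(1)]) simp_all
    qed
  qed
  then show ?thesis by simp
qed

end

text \<open>
  The largest element of \<open>F\<close> plays the role of \<open>b\<close>. The incidence there lowers the bounds for the remaining
  elements of \<open>F\<close> by one.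
\<close>
lemma (in thick) card_meets_flag_le:
  fixes c :: "real \<Rightarrow> (real ^ 'n) set"
  assumes conv: "convex_curve J T c" and TJ: "T \<subseteq> J" and T: "\<And>a b. a \<in> T \<Longrightarrow> b \<in> T \<Longrightarrow> {a..b} \<subseteq> T"
    and f: "f \<in> complete_flags" and n45: "CARD('n) = 4 \<or> CARD('n) = 5" and k: "1 \<le> k" "k < CARD('n)"
    and F: "finite F" "F \<subseteq> {t \<in> T. meets (osculating_flag J c t k) (f (CARD('n) - k))}"
  shows "card F \<le> k * (CARD('n) - k)"
proof (cases "card F \<le> 1")
  case True
  have "1 \<le> k * (CARD('n) - k)" using k by simp
  then show ?thesis using True by linarith
next
  case False
  define b where "b = Max F"
  define a where "a = Min F"
  define Z where "Z = F - {b}"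
  have ne: "F \<noteq> {}" using False by auto
  have mm: "a \<in> F" "b \<in> F" "\<And>t. t \<in> F \<Longrightarrow> a \<le> t \<and> t \<le> b" unfolding a_def b_def using F(1) ne by auto
  have "a \<noteq> b"
  proof
    assume "a = b"
    then have "F \<subseteq> {a}" using mm by force
    then have "card F \<le> card {a}" by (intro card_mono) auto
    then show False using False by simp
  qed
  then have lt: "a < b" using mm by force
  have sub: "{a..b} \<subseteq> T" using T mm F(2) by blast
  obtain u where "arc_frame J T c a b u CARD('n)" using arc_frame_exists[OF conv TJ lt sub] by blast
  then interpret arc_frame J T c a b u "CARD('n)" .
  have Z: "finite Z" "Z \<subseteq> {a..<b}" "\<And>t. t \<in> Z \<Longrightarrow> meets (osculating_flag J c t k) (f (CARD('n) - k))"
  proof -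
    show "finite Z" unfolding Z_def using F(1) by simp
    show "Z \<subseteq> {a..<b}"
    proof
      fix t assume "t \<in> Z"
      then show "t \<in> {a..<b}" using mm(3)[of t] unfolding Z_def by auto
    qed
    show "meets (osculating_flag J c t k) (f (CARD('n) - k))" if "t \<in> Z" for t
      using F(2) that unfolding Z_def by blast
  qed
  have b: "meets (osculating_flag J c b k) (f (CARD('n) - k))" using F(2) mm(2) by blast
  have card: "card F = Suc (card Z)" unfolding Z_def using card.remove[OF F(1) mm(2)] .
  have flag: "subspace (f i)" "dim (f i) = min i CARD('n)" for i using f unfolding complete_flags_def by auto
  consider "k = 1" | "k = 2" | "k = CARD('n) - 1" | "k = CARD('n) - 2" "CARD('n) = 5"
    using n45 k by linarith
  then show ?thesis
  proof cases
    case 1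
    have "card Z \<le> CARD('n) - 2"
      by (rule card_meets_hyperplane[OF _ flag(1) _ Z(1,2)]) (use n45 Z(3) b flag(2) 1 in auto)
    then show ?thesis unfolding card using 1 n45 by auto
  next
    case 2
    have "card Z \<le> 2 * CARD('n) - 5"
      by (rule card_meets_codim2[OF _ flag(1) _ Z(1,2)]) (use n45 Z(3) b flag(2) 2 in auto)
    then show ?thesis unfolding card using 2 n45 by auto
  next
    case 3
    then have i: "CARD('n) - k = 1" using k by simp
    obtain B where B: "B \<subseteq> f 1" "independent B" "f 1 \<subseteq> span B" "card B = dim (f 1)" using basis_exists by blast
    then have "card B = 1" using flag(2)[of 1] n45 by auto
    then obtain w0 where w0: "B = {w0}" by (metis One_nat_def card_1_singletonE)
    have M: "f 1 = span {w0}" using B flag(1) w0 by (metis span_minimal subset_antisym)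
    have "w0 \<noteq> 0" using B(2) w0 dependent_zero by auto
    then have "card Z \<le> CARD('n) - 2"
      using card_meets_line[OF _ M _ Z(1,2)] n45 Z(3) b unfolding i 3 by auto
    then show ?thesis unfolding card using 3 n45 by auto
  next
    case 4
    then have i: "CARD('n) - k = 2" using k by simp
    obtain B where B: "B \<subseteq> f 2" "independent B" "f 2 \<subseteq> span B" "card B = dim (f 2)" using basis_exists by blast
    then have "card B = 2" using flag(2)[of 2] n45 by auto
    then obtain w1 w2 where w: "B = {w1, w2}" "w1 \<noteq> w2" by (auto simp: card_2_iff)
    have M: "f 2 = span {w1, w2}" using B flag(1) w(1) by (metis span_minimal subset_antisym)
    have ind: "independent {w1, w2}" using B(2) w(1) by simp
    have "card Z \<le> 2 * CARD('n) - 5"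
      using card_meets_plane[OF _ M w(2) ind Z(1,2)] n45 Z(3) b unfolding i 4(1) by auto
    then show ?thesis unfolding card using 4 n45 by auto
  qed
qed

text \<open>
  The bounds \<open>k * (n - k)\<close> for the single dimensions \<open>k\<close> add up to \<open>(n ^ 3 - n) / 6\<close>.
\<close>
lemma (in thick) sharp_le:
  fixes c :: "real \<Rightarrow> (real ^ 'n) set"
  assumes conv: "convex_curve J T c" and TJ: "T \<subseteq> J" and T: "\<And>a b. a \<in> T \<Longrightarrow> b \<in> T \<Longrightarrow> {a..b} \<subseteq> T"
    and n: "CARD('n) = 4 \<or> CARD('n) = 5"
  shows "sharp J T c \<le> enat ((CARD('n) ^ 3 - CARD('n)) div 6)"
  unfolding sharp_def
proof (rule SUP_least)
  fix f :: "nat \<Rightarrow> (real ^ 'n) set" assume f: "f \<in> complete_flags"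
  let ?N = "\<lambda>k. {t \<in> T. meets (osculating_flag J c t k) (f (CARD('n) - k))}"
  have N: "finite (?N k) \<and> card (?N k) \<le> k * (CARD('n) - k)" if "k \<in> {1..CARD('n) - 1}" for k
  proof (rule finite_if_finite_subsets_card_bdd)
    fix G assume G: "G \<subseteq> ?N k" "finite G"
    show "card G \<le> k * (CARD('n) - k)"
      by (rule card_meets_flag_le[OF conv TJ T f n _ _ G(2,1)]) (use that in auto)
  qed
  have sub: "{t \<in> T. \<not> transversal (osculating_flag J c t) f} \<subseteq> (\<Union>k\<in>{1..CARD('n) - 1}. ?N k)"
  proof
    fix t assume t: "t \<in> {t \<in> T. \<not> transversal (osculating_flag J c t) f}"
    then obtain k where k: "k \<in> {1..CARD('n) - 1}" "osculating_flag J c t k \<inter> f (CARD('n) - k) \<noteq> {0}"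
      unfolding transversal_def by blast
    have "0 \<in> osculating_flag J c t k" unfolding osculating_flag_def by (rule span_zero)
    moreover have "0 \<in> f (CARD('n) - k)" using f unfolding complete_flags_def by (auto intro: subspace_0)
    ultimately have "meets (osculating_flag J c t k) (f (CARD('n) - k))" unfolding meets_def using k(2) by blast
    then show "t \<in> (\<Union>k\<in>{1..CARD('n) - 1}. ?N k)" using k(1) t by blast
  qed
  have fin: "finite (\<Union>k\<in>{1..CARD('n) - 1}. ?N k)" using N by blast
  have "card {t \<in> T. \<not> transversal (osculating_flag J c t) f} \<le> card (\<Union>k\<in>{1..CARD('n) - 1}. ?N k)"
    by (rule card_mono[OF fin sub])
  also have "\<dots> \<le> (\<Sum>k\<in>{1..CARD('n) - 1}. card (?N k))" by (rule card_UN_le) simp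
  also have "\<dots> \<le> (\<Sum>k\<in>{1..CARD('n) - 1}. k * (CARD('n) - k))" using N by (intro sum_mono) blast
  also have "\<dots> = (CARD('n) ^ 3 - CARD('n)) div 6"
  proof -
    have "{1..4 - 1 :: nat} = {1, 2, 3}" "{1..5 - 1 :: nat} = {1, 2, 3, 4}" by auto
    then show ?thesis using n by (elim disjE) simp_all
  qed
  finally show "nontransversal_count J T c f \<le> enat ((CARD('n) ^ 3 - CARD('n)) div 6)"
    unfolding nontransversal_count_def ecard_def using finite_subset[OF sub fin] by simp
qed

section \<open>Magnification of a chain at a point\<close>

lemma degree_funpow_pderiv: "degree ((pderiv ^^ k) p) = degree p - k" for p :: "real poly"
  by (induction k) (auto simp: degree_pderiv)

lemma chain_poly:
  fixes p :: "real poly"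
  assumes "degree p \<le> m"
  shows "chain m (\<lambda>_ _. 1) (\<lambda>j. poly ((pderiv ^^ j) p)) S"
  unfolding chain_def
proof (intro conjI allI impI ballI)
  fix j t
  show "(poly ((pderiv ^^ j) p) has_vector_derivative 1 *\<^sub>R poly ((pderiv ^^ Suc j) p) t) (at t within S)"
    using has_field_derivative_at_within[OF poly_DERIV[of "(pderiv ^^ j) p" t]]
    by (simp add: has_real_derivative_iff_has_vector_derivative)
next
  have "degree ((pderiv ^^ m) p) = 0" using assms by (simp add: degree_funpow_pderiv)
  then obtain r where "(pderiv ^^ m) p = [:r:]" by (rule degree_eq_zeroE)
  then show "\<exists>r. \<forall>t\<in>S. poly ((pderiv ^^ m) p) t = r" by simp
qed auto

text \<open>
  To leading order at \<open>a\<close>, this times \<open>x j (a + \<epsilon> * s)\<close> is the derivative of order \<open>j\<close> of \<open>x 0 (a + \<epsilon> * s)\<close> with respect to \<open>s\<close>.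
\<close>
definition scale_factor :: "(nat \<Rightarrow> real \<Rightarrow> real) \<Rightarrow> real \<Rightarrow> real \<Rightarrow> nat \<Rightarrow> real" where
  "scale_factor \<beta> a \<epsilon> j = \<epsilon> ^ j * (\<Prod>i<j. \<beta> i a)"

text \<open>
  The derivative of the rescaled component \<open>j\<close> is the rescaled component \<open>Suc j\<close>, multiplied by
  \<open>\<beta> j (a + \<epsilon> * s) / \<beta> j a\<close>, which tends to 1 uniformly. The claim follows from the last component,
  which is constant, downwards by integration.
\<close>
lemma scaled_chain_limit:
  fixes x :: "real \<Rightarrow> nat \<Rightarrow> real \<Rightarrow> real"
  assumes chain: "\<And>\<epsilon>. 0 < \<epsilon> \<Longrightarrow> chain m \<beta> (x \<epsilon>) {a..<b}" and ab: "a < b" and M: "0 < M"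
    and y: "chain m (\<lambda>_ _. 1) y {0..M}"
    and init: "\<And>\<epsilon> j. 0 < \<epsilon> \<Longrightarrow> j \<le> m \<Longrightarrow> scale_factor \<beta> a \<epsilon> j * x \<epsilon> j a = y j 0"
    and j: "j \<le> m"
  shows "\<forall>\<delta>>0. \<forall>\<^sub>F \<epsilon> in at_right 0. \<forall>s\<in>{0..M}. \<bar>scale_factor \<beta> a \<epsilon> j * x \<epsilon> j (a + \<epsilon> * s) - y j s\<bar> < \<delta>"
  using j
proof (induction j rule: inc_induct)
  case base
  have small: "\<forall>\<^sub>F \<epsilon> in at_right 0. 0 < \<epsilon> \<and> \<epsilon> * M < b - a"
    by (rule eventually_at_rightI[of 0 "(b - a) / M"]) (use ab M in \<open>auto simp: field_simps\<close>)
  show ?case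
  proof (intro allI impI, rule eventually_mono[OF small], intro ballI)
    fix \<delta> \<epsilon> s :: real assume \<delta>: "0 < \<delta>" and \<epsilon>: "0 < \<epsilon> \<and> \<epsilon> * M < b - a" and s: "s \<in> {0..M}"
    have "\<epsilon> * s \<le> \<epsilon> * M" using s \<epsilon> by (intro mult_left_mono) auto
    moreover have "0 \<le> \<epsilon> * s" using s \<epsilon> by simp
    ultimately have "a + \<epsilon> * s < b" "a \<le> a + \<epsilon> * s" using \<epsilon> by linarith+
    then have in_S: "a + \<epsilon> * s \<in> {a..<b}" "a \<in> {a..<b}" using ab by auto
    obtain r where r: "\<forall>t\<in>{a..<b}. x \<epsilon> m t = r" using chain \<epsilon> unfolding chain_def by blast
    obtain q where q: "\<forall>t\<in>{0..M}. y m t = q" using y unfolding chain_def by blast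
    have "x \<epsilon> m (a + \<epsilon> * s) = x \<epsilon> m a" using r in_S by simp
    moreover have "y m s = y m 0" using q s M by simp
    ultimately show "\<bar>scale_factor \<beta> a \<epsilon> m * x \<epsilon> m (a + \<epsilon> * s) - y m s\<bar> < \<delta>" using init \<epsilon> \<delta> by simp
  qed
next
  case (step j)
  have jm: "j < m" using step by simp
  show ?case
  proof (intro allI impI)
    fix \<delta> :: real assume \<delta>: "0 < \<delta>"
    define e where "e = \<delta> / (3 * M)"
    have e: "0 < e" "2 * e * M < \<delta>" using \<delta> M by (auto simp: e_def field_simps)
    have "continuous_on {0..M} (y (Suc j))" using chain_continuous_on[OF y] jm by simp
    then have "bounded (y (Suc j) ` {0..M})" by (intro compact_imp_bounded compact_continuous_image) auto
    then obtain B where B: "0 < B" "\<And>s. s \<in> {0..M} \<Longrightarrow> \<bar>y (Suc j) s\<bar> \<le> B" unfolding bounded_pos by auto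
    \<comment> \<open>The bound for the deviation of the quotient of speeds from 1, chosen against the size of the next component.\<close>
    define \<eta> where "\<eta> = min 1 (e / (B + e))"
    have \<eta>: "0 < \<eta>" "\<eta> * (B + e) \<le> e"
    proof -
      show "0 < \<eta>" using e B by (simp add: \<eta>_def)
      have "\<eta> * (B + e) \<le> e / (B + e) * (B + e)" using e B by (intro mult_right_mono) (auto simp: \<eta>_def)
      then show "\<eta> * (B + e) \<le> e" using e B by simp
    qed
    have \<beta>: "continuous_on {a..<b} (\<beta> j)" "\<And>t. t \<in> {a..<b} \<Longrightarrow> \<beta> j t \<noteq> 0"
      using chain[of 1] jm unfolding chain_def by auto
    have "continuous_on {a..<b} (\<lambda>t. \<beta> j t / \<beta> j a)"
      using \<beta> ab by (intro continuous_on_divide continuous_on_const) auto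
    moreover have "a \<in> {a..<b}" using ab by simp
    ultimately obtain d where d: "0 < d" "\<And>t. t \<in> {a..<b} \<Longrightarrow> dist t a < d \<Longrightarrow> dist (\<beta> j t / \<beta> j a) (\<beta> j a / \<beta> j a) < \<eta>"
      unfolding continuous_on_iff using \<eta>(1) by meson
    have small: "\<forall>\<^sub>F \<epsilon> in at_right 0. 0 < \<epsilon> \<and> \<epsilon> * M < min d (b - a)"
      by (rule eventually_at_rightI[of 0 "min d (b - a) / M"]) (use ab M d in \<open>auto simp: field_simps\<close>)
    have IH: "\<forall>\<^sub>F \<epsilon> in at_right 0. \<forall>s\<in>{0..M}. \<bar>scale_factor \<beta> a \<epsilon> (Suc j) * x \<epsilon> (Suc j) (a + \<epsilon> * s) - y (Suc j) s\<bar> < e"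
      using step.IH e by blast
    show "\<forall>\<^sub>F \<epsilon> in at_right 0. \<forall>s\<in>{0..M}. \<bar>scale_factor \<beta> a \<epsilon> j * x \<epsilon> j (a + \<epsilon> * s) - y j s\<bar> < \<delta>"
    proof (rule eventually_mono[OF eventually_conj[OF small IH]], elim conjE)
      fix \<epsilon> :: real assume \<epsilon>: "0 < \<epsilon>" "\<epsilon> * M < min d (b - a)"
        and near: "\<forall>s\<in>{0..M}. \<bar>scale_factor \<beta> a \<epsilon> (Suc j) * x \<epsilon> (Suc j) (a + \<epsilon> * s) - y (Suc j) s\<bar> < e"
      have in_S: "a + \<epsilon> * s \<in> {a..<b}" "\<epsilon> * s < d" if "s \<in> {0..M}" for s
      proof -
        have "\<epsilon> * s \<le> \<epsilon> * M" "0 \<le> \<epsilon> * s" using that \<epsilon> by (auto intro: mult_left_mono)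
        then have "\<epsilon> * s < d" "a + \<epsilon> * s < b" "a \<le> a + \<epsilon> * s" using \<epsilon>(2) by linarith+
        then show "a + \<epsilon> * s \<in> {a..<b}" "\<epsilon> * s < d" by simp_all
      qed
      define f where "f s = scale_factor \<beta> a \<epsilon> j * x \<epsilon> j (a + \<epsilon> * s) - y j s" for s
      define f' where "f' s = \<beta> j (a + \<epsilon> * s) / \<beta> j a * (scale_factor \<beta> a \<epsilon> (Suc j) * x \<epsilon> (Suc j) (a + \<epsilon> * s)) - y (Suc j) s" for s
      have der: "(f has_field_derivative f' s) (at s within {0..M})" if s: "s \<in> {0..M}" for s
      proof -
        have "(x \<epsilon> j has_field_derivative \<beta> j (a + \<epsilon> * s) * x \<epsilon> (Suc j) (a + \<epsilon> * s)) (at (a + \<epsilon> * s) within {a..<b})"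
          using chain[OF \<epsilon>(1)] jm in_S(1)[OF s] unfolding chain_def
          by (simp add: has_real_derivative_iff_has_vector_derivative)
        then have "(x \<epsilon> j has_field_derivative \<beta> j (a + \<epsilon> * s) * x \<epsilon> (Suc j) (a + \<epsilon> * s)) (at (a + \<epsilon> * s) within (\<lambda>s. a + \<epsilon> * s) ` {0..M})"
          by (rule DERIV_subset) (use in_S in auto)
        moreover have "((\<lambda>s. a + \<epsilon> * s) has_field_derivative \<epsilon>) (at s within {0..M})"
          by (auto intro!: derivative_eq_intros)
        ultimately have "((\<lambda>s. x \<epsilon> j (a + \<epsilon> * s)) has_field_derivative \<beta> j (a + \<epsilon> * s) * x \<epsilon> (Suc j) (a + \<epsilon> * s) * \<epsilon>) (at s within {0..M})"
          using DERIV_image_chain[of "x \<epsilon> j" _ "\<lambda>s. a + \<epsilon> * s" s "{0..M}"] by (simp add: o_def)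
        moreover have "(y j has_field_derivative y (Suc j) s) (at s within {0..M})"
          using y jm s unfolding chain_def by (simp add: has_real_derivative_iff_has_vector_derivative)
        ultimately have "(f has_field_derivative scale_factor \<beta> a \<epsilon> j * (\<beta> j (a + \<epsilon> * s) * x \<epsilon> (Suc j) (a + \<epsilon> * s) * \<epsilon>) - y (Suc j) s) (at s within {0..M})"
          unfolding f_def by (intro DERIV_diff DERIV_cmult)
        moreover have "scale_factor \<beta> a \<epsilon> j * (\<beta> j (a + \<epsilon> * s) * x \<epsilon> (Suc j) (a + \<epsilon> * s) * \<epsilon>) - y (Suc j) s = f' s"
          unfolding f'_def scale_factor_def using \<beta>(2)[of a] ab by (simp add: field_simps)
        ultimately show ?thesis by simp
      qed
      have bound: "norm (f' s) \<le> 2 * e" if s: "s \<in> {0..M}" for s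
      proof -
        define v where "v = scale_factor \<beta> a \<epsilon> (Suc j) * x \<epsilon> (Suc j) (a + \<epsilon> * s)"
        define q where "q = \<beta> j (a + \<epsilon> * s) / \<beta> j a"
        have "0 \<le> \<epsilon> * s" using s \<epsilon> by simp
        then have "dist (a + \<epsilon> * s) a < d" using in_S(2)[OF s] by (simp add: dist_real_def)
        then have "\<bar>q - 1\<bar> \<le> \<eta>" using d(2)[OF in_S(1)[OF s]] \<beta>(2)[of a] ab unfolding q_def by (simp add: dist_real_def)
        moreover have v: "\<bar>v - y (Suc j) s\<bar> < e" using near s unfolding v_def by blast
        moreover have "\<bar>v\<bar> \<le> B + e" using v B(2)[OF s] by linarith
        ultimately have "\<bar>q - 1\<bar> * \<bar>v\<bar> \<le> \<eta> * (B + e)" using \<eta> by (intro mult_mono) auto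
        then have "\<bar>(q - 1) * v\<bar> \<le> e" using \<eta>(2) by (simp add: abs_mult)
        moreover have "f' s = (q - 1) * v + (v - y (Suc j) s)" unfolding f'_def q_def v_def by (simp add: algebra_simps)
        ultimately show ?thesis using v by simp
      qed
      have "f 0 = 0" unfolding f_def using init[OF \<epsilon>(1)] jm by simp
      show "\<forall>s\<in>{0..M}. \<bar>scale_factor \<beta> a \<epsilon> j * x \<epsilon> j (a + \<epsilon> * s) - y j s\<bar> < \<delta>"
      proof
        fix s assume s: "s \<in> {0..M}"
        have "norm (f s - f 0) \<le> 2 * e * norm (s - 0)"
          by (rule field_differentiable_bound[where S="{0..M}" and f'=f']) (use der bound s M in auto)
        also have "\<dots> \<le> 2 * e * M" using s e by (intro mult_left_mono) auto
        also have "\<dots> < \<delta>" by (rule e)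
        finally show "\<bar>scale_factor \<beta> a \<epsilon> j * x \<epsilon> j (a + \<epsilon> * s) - y j s\<bar> < \<delta>" using \<open>f 0 = 0\<close> by (simp add: f_def)
      qed
    qed
  qed
qed

text \<open>
  Under magnification at \<open>a\<close> every chain looks like a polynomial with its derivatives, and each polynomial
  arises from suitable initial values.
\<close>
lemma scaled_chain_tendsto:
  fixes x :: "real \<Rightarrow> nat \<Rightarrow> real \<Rightarrow> real"
  assumes chain: "\<And>\<epsilon>. 0 < \<epsilon> \<Longrightarrow> chain m \<beta> (x \<epsilon>) {a..<b}" and ab: "a < b"
    and p: "degree p \<le> m"
    and init: "\<And>\<epsilon> j. 0 < \<epsilon> \<Longrightarrow> j \<le> m \<Longrightarrow> scale_factor \<beta> a \<epsilon> j * x \<epsilon> j a = poly ((pderiv ^^ j) p) 0"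
    and j: "j \<le> m" and s: "0 \<le> s"
  shows "((\<lambda>\<epsilon>. scale_factor \<beta> a \<epsilon> j * x \<epsilon> j (a + \<epsilon> * s)) \<longlongrightarrow> poly ((pderiv ^^ j) p) s) (at_right 0)"
  unfolding tendsto_iff dist_real_def
proof (intro allI impI)
  fix \<delta> :: real assume "0 < \<delta>"
  moreover have "0 < s + 1" using s by simp
  ultimately have "\<forall>\<^sub>F \<epsilon> in at_right 0. \<forall>r\<in>{0..s + 1}. \<bar>scale_factor \<beta> a \<epsilon> j * x \<epsilon> j (a + \<epsilon> * r) - poly ((pderiv ^^ j) p) r\<bar> < \<delta>"
    using scaled_chain_limit[OF chain ab _ chain_poly[OF p] init j, of "s + 1"] by blast
  then show "\<forall>\<^sub>F \<epsilon> in at_right 0. \<bar>scale_factor \<beta> a \<epsilon> j * x \<epsilon> j (a + \<epsilon> * s) - poly ((pderiv ^^ j) p) s\<bar> < \<delta>"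
    by (rule eventually_mono) (use s in auto)
qed

text \<open>
  The factor \<open>k \<epsilon>\<close> enters the product of the two values as a square, so its sign is immaterial.
\<close>
lemma eventually_zero_of_sign_change:
  fixes \<Phi> :: "real \<Rightarrow> real \<Rightarrow> real"
  assumes cont: "\<And>\<epsilon>. 0 < \<epsilon> \<Longrightarrow> continuous_on {a..<b} (\<Phi> \<epsilon>)" and ab: "a < b"
    and lim: "\<And>s. 0 \<le> s \<Longrightarrow> ((\<lambda>\<epsilon>. k \<epsilon> * \<Phi> \<epsilon> (a + \<epsilon> * s)) \<longlongrightarrow> q s) (at_right 0)"
    and s: "0 \<le> s" "s < s'" and q: "q s * q s' < 0"
  shows "\<forall>\<^sub>F \<epsilon> in at_right 0. \<exists>t\<in>{a..<b}. a + \<epsilon> * s < t \<and> t < a + \<epsilon> * s' \<and> \<Phi> \<epsilon> t = 0"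
proof -
  have "((\<lambda>\<epsilon>. (k \<epsilon> * \<Phi> \<epsilon> (a + \<epsilon> * s)) * (k \<epsilon> * \<Phi> \<epsilon> (a + \<epsilon> * s'))) \<longlongrightarrow> q s * q s') (at_right 0)"
    using s by (intro tendsto_mult lim) auto
  then have neg: "\<forall>\<^sub>F \<epsilon> in at_right 0. (k \<epsilon> * \<Phi> \<epsilon> (a + \<epsilon> * s)) * (k \<epsilon> * \<Phi> \<epsilon> (a + \<epsilon> * s')) < 0"
    using q by (rule order_tendstoD)
  have small: "\<forall>\<^sub>F \<epsilon> in at_right 0. 0 < \<epsilon> \<and> \<epsilon> * s' < b - a"
    by (rule eventually_at_rightI[of 0 "(b - a) / s'"]) (use ab s in \<open>auto simp: field_simps\<close>)
  show ?thesis
  proof (rule eventually_mono[OF eventually_conj[OF small neg]], elim conjE)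
    fix \<epsilon> assume \<epsilon>: "0 < \<epsilon>" "\<epsilon> * s' < b - a" and "(k \<epsilon> * \<Phi> \<epsilon> (a + \<epsilon> * s)) * (k \<epsilon> * \<Phi> \<epsilon> (a + \<epsilon> * s')) < 0"
    then have "(k \<epsilon>)\<^sup>2 * (\<Phi> \<epsilon> (a + \<epsilon> * s) * \<Phi> \<epsilon> (a + \<epsilon> * s')) < 0" by (simp add: power2_eq_square mult_ac)
    then have prod: "\<Phi> \<epsilon> (a + \<epsilon> * s) * \<Phi> \<epsilon> (a + \<epsilon> * s') < 0" using zero_le_power2[of "k \<epsilon>"] by (simp add: mult_less_0_iff)
    have le: "\<epsilon> * s < \<epsilon> * s'" "0 \<le> \<epsilon> * s" using \<epsilon> s by auto
    then have sub: "{a + \<epsilon> * s..a + \<epsilon> * s'} \<subseteq> {a..<b}" using \<epsilon> by auto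
    have c: "continuous_on {a + \<epsilon> * s..a + \<epsilon> * s'} (\<Phi> \<epsilon>)" by (rule continuous_on_subset[OF cont[OF \<epsilon>(1)] sub])
    have "\<exists>t\<ge>a + \<epsilon> * s. t \<le> a + \<epsilon> * s' \<and> \<Phi> \<epsilon> t = 0"
    proof (cases "\<Phi> \<epsilon> (a + \<epsilon> * s) < 0")
      case True
      then have "0 \<le> \<Phi> \<epsilon> (a + \<epsilon> * s')" using prod by (auto simp: mult_less_0_iff)
      then show ?thesis using True le c by (intro IVT') auto
    next
      case False
      then have "0 \<le> \<Phi> \<epsilon> (a + \<epsilon> * s)" "\<Phi> \<epsilon> (a + \<epsilon> * s') \<le> 0" using prod by (auto simp: mult_less_0_iff)
      then show ?thesis using le c by (intro IVT2') auto
    qed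
    then obtain t where t: "a + \<epsilon> * s \<le> t" "t \<le> a + \<epsilon> * s'" "\<Phi> \<epsilon> t = 0" by blast
    then have "t \<noteq> a + \<epsilon> * s" "t \<noteq> a + \<epsilon> * s'" using prod by auto
    then show "\<exists>t\<in>{a..<b}. a + \<epsilon> * s < t \<and> t < a + \<epsilon> * s' \<and> \<Phi> \<epsilon> t = 0" using t sub by (intro bexI[of _ t]) auto
  qed
qed

lemma length_le_ecard_of_disjoint_intervals:
  fixes ps :: "(nat \<times> real \<times> real) list"
  assumes "0 < \<epsilon>" "sorted_wrt (\<lambda>(_, _, s) (_, s', _). s \<le> s') ps"
    and "\<And>k s s'. (k, s, s') \<in> set ps \<Longrightarrow> \<exists>t\<in>A. a + \<epsilon> * s < t \<and> t < a + \<epsilon> * s'"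
  shows "enat (length ps) \<le> ecard A"
proof -
  have "\<exists>B\<subseteq>A. finite B \<and> card B = length ps \<and> (\<forall>t\<in>B. \<exists>(k, s, s')\<in>set ps. a + \<epsilon> * s < t)"
    using assms(2,3)
  proof (induction ps)
    case (Cons p ps)
    obtain k r r' where p: "p = (k, r, r')" by (metis prod_cases3)
    have "\<exists>B\<subseteq>A. finite B \<and> card B = length ps \<and> (\<forall>t\<in>B. \<exists>(k, s, s')\<in>set ps. a + \<epsilon> * s < t)"
      by (rule Cons.IH) (use Cons.prems in auto)
    then obtain B where B: "B \<subseteq> A" "finite B" "card B = length ps" "\<forall>t\<in>B. \<exists>(k, s, s')\<in>set ps. a + \<epsilon> * s < t"
      by blast
    obtain t where t: "t \<in> A" "a + \<epsilon> * r < t" "t < a + \<epsilon> * r'" using Cons.prems(2)[of k r r'] p by auto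
    have "t \<notin> B"
    proof
      assume "t \<in> B"
      then obtain k' s s' where s: "(k', s, s') \<in> set ps" "a + \<epsilon> * s < t" using B(4) by blast
      have "r' \<le> s" using Cons.prems(1) s(1) p by auto
      then have "\<epsilon> * r' \<le> \<epsilon> * s" using assms(1) by (intro mult_left_mono) auto
      then show False using s(2) t(3) by simp
    qed
    then show ?case using B t p by (intro exI[of _ "insert t B"]) auto
  qed simp
  then obtain B where "B \<subseteq> A" "finite B" "card B = length ps" by blast
  then show ?thesis unfolding ecard_def using card_mono[of A B] by auto
qed

section \<open>Forms and vectors with prescribed limit polynomials\<close>

lemma nontrivial_combination_of_singular:
  fixes x y x' y' :: real
  assumes "x * y' - y * x' = 0"
  shows "\<exists>r r'. (r \<noteq> 0 \<or> r' \<noteq> 0) \<and> r * x + r' * x' = 0 \<and> r * y + r' * y' = 0"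
proof -
  consider "x' \<noteq> 0 \<or> x \<noteq> 0" | "y' \<noteq> 0 \<or> y \<noteq> 0" | "x = 0 \<and> x' = 0 \<and> y = 0 \<and> y' = 0" by blast
  then show ?thesis
  proof cases
    case 1
    then show ?thesis using assms by (intro exI[of _ x'] exI[of _ "- x"]) (auto simp: algebra_simps)
  next
    case 2
    then show ?thesis using assms by (intro exI[of _ y'] exI[of _ "- y"]) (auto simp: algebra_simps)
  next
    case 3
    then show ?thesis by (intro exI[of _ 1]) auto
  qed
qed

lemma regular_combination_zero:
  fixes x y x' y' :: real
  assumes "x * y' - y * x' \<noteq> 0" "r * x + r' * x' = 0" "r * y + r' * y' = 0"
  shows "r = 0" "r' = 0"
proof -
  have "r * (x * y' - y * x') = (r * x + r' * x') * y' - (r * y + r' * y') * x'"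
    "r' * (x * y' - y * x') = (r * y + r' * y') * x - (r * x + r' * x') * y" by (simp_all add: algebra_simps)
  then have "r * (x * y' - y * x') = 0" "r' * (x * y' - y * x') = 0" unfolding assms(2,3) by simp_all
  then show "r = 0" "r' = 0" using assms by simp_all
qed

text \<open>
  With \<open>x\<close> added, the kernel of \<open>l\<close> in \<open>S\<close> spans \<open>S\<close>.
\<close>
lemma dim_kernel:
  fixes l :: "real ^ 'n \<Rightarrow> real"
  assumes S: "subspace S" and l: "linear l" and x: "x \<in> S" "l x \<noteq> 0"
  shows "subspace (S \<inter> {y. l y = 0})" "dim S = dim (S \<inter> {y. l y = 0}) + 1"
proof -
  let ?K = "S \<inter> {y. l y = 0}"
  show K: "subspace ?K" using S l by (simp add: subspace_inter linear_subspace_kernel)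
  have "S \<subseteq> span (insert x ?K)"
  proof
    fix y assume y: "y \<in> S"
    define r where "r = l y / l x"
    have "y - r *\<^sub>R x \<in> S" using S x y by (simp add: subspace_diff subspace_scale)
    moreover have "l (y - r *\<^sub>R x) = 0" unfolding r_def linear_diff[OF l] linear_scale[OF l] using x by simp
    ultimately have "y - r *\<^sub>R x \<in> span ?K" by (simp add: span_base)
    then show "y \<in> span (insert x ?K)" by (auto simp: span_insert)
  qed
  moreover have "insert x ?K \<subseteq> S" using x by blast
  ultimately have "dim S = dim (insert x ?K)" by (metis dim_span dim_subset order_antisym)
  moreover have "x \<notin> span ?K" using K x by (simp add: span_eq_iff[THEN iffD2])
  ultimately show "dim S = dim ?K + 1" by (simp add: dim_insert)
qed

definition jet :: "real poly \<Rightarrow> nat \<Rightarrow> real" where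
  "jet p j = poly ((pderiv ^^ j) p) 0"

text \<open>
  The leading coefficient in the value of a form with jet \<open>p\<close> at a vector with jet \<open>g\<close>, see \<open>scaled_form_scaled_vector\<close> below.
\<close>
definition pairing :: "nat \<Rightarrow> real poly \<Rightarrow> real poly \<Rightarrow> real" where
  "pairing n p g = (\<Sum>j<n. (- 1) ^ (n - 1 - j) * jet p j * jet g (n - 1 - j))"

definition wronskian :: "real poly \<Rightarrow> real poly \<Rightarrow> real poly" where
  "wronskian p q = p * pderiv q - pderiv p * q"

context arc_frame
begin

lemma a_in: "a \<in> {a..<b}" using ab by simp

abbreviation dual_speed :: "nat \<Rightarrow> real \<Rightarrow> real" where
  "dual_speed i \<equiv> speed (n - 2 - i)"

text \<open>
  Its values on \<open>frame 0 a, frame 1 a, \<dots>\<close> are the initial values for which magnification at \<open>a\<close> gives \<open>p\<close>.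
\<close>
definition scaled_form :: "real poly \<Rightarrow> real \<Rightarrow> real ^ 'n \<Rightarrow> real" where
  "scaled_form p \<epsilon> x = (\<Sum>j<n. jet p j / scale_factor speed a \<epsilon> j * coord x j a)"

text \<open>
  The vector for which \<open>dual\<close> has the initial values that give \<open>g\<close> under magnification at \<open>a\<close>.
\<close>
definition scaled_vector :: "real poly \<Rightarrow> real \<Rightarrow> real ^ 'n" where
  "scaled_vector g \<epsilon> = (\<Sum>j<n. ((- 1) ^ (n - 1 - j) * (jet g (n - 1 - j) / scale_factor dual_speed a \<epsilon> (n - 1 - j))) *\<^sub>R frame j a)"

lemma scale_factor_speed_nonzero: "0 < \<epsilon> \<Longrightarrow> j < n \<Longrightarrow> scale_factor speed a \<epsilon> j \<noteq> 0"
  unfolding scale_factor_def using speed_nonzero[OF _ a_in] by auto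

lemma scale_factor_dual_speed_nonzero: "0 < \<epsilon> \<Longrightarrow> j < n \<Longrightarrow> scale_factor dual_speed a \<epsilon> j \<noteq> 0"
  unfolding scale_factor_def using speed_nonzero[OF _ a_in] by auto

lemma linear_coord: "t \<in> {a..<b} \<Longrightarrow> j < n \<Longrightarrow> linear (\<lambda>x. coord x j t)"
  using coord_combination[of t j 1 _ 1] coord_combination[of t j _ _ 0 0]
  by (intro linearI) auto

lemma coord_frame: "t \<in> {a..<b} \<Longrightarrow> i < n \<Longrightarrow> j < n \<Longrightarrow> coord (frame i t) j t = (if j = i then 1 else 0)"
  by (rule coord_unique) (auto simp: if_distrib[of "\<lambda>r. r *\<^sub>R _"] cong: if_cong)

lemma linear_scaled_form: "linear (scaled_form p \<epsilon>)"
  unfolding scaled_form_def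
proof (intro linear_compose_sum ballI)
  fix j assume "j \<in> {..<n}"
  then have "linear (\<lambda>x. coord x j a)" using linear_coord[OF a_in] by simp
  then show "linear (\<lambda>x. jet p j / scale_factor speed a \<epsilon> j * coord x j a)"
    using linear_compose_scale_right[of "\<lambda>x. coord x j a" "jet p j / scale_factor speed a \<epsilon> j"] by simp
qed

lemma scaled_form_frame:
  assumes "j < n"
  shows "scaled_form p \<epsilon> (frame j a) = jet p j / scale_factor speed a \<epsilon> j"
  unfolding scaled_form_def using assms by (simp add: coord_frame[OF a_in] if_distrib cong: if_cong)

lemma coord_scaled_vector:
  assumes "j < n"
  shows "coord (scaled_vector g \<epsilon>) j a = (- 1) ^ (n - 1 - j) * (jet g (n - 1 - j) / scale_factor dual_speed a \<epsilon> (n - 1 - j))"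
  by (rule coord_unique[OF a_in scaled_vector_def assms])

lemma dual_scaled_vector:
  assumes "i < n"
  shows "dual (scaled_vector g \<epsilon>) i a = jet g i / scale_factor dual_speed a \<epsilon> i"
proof -
  have i: "n - 1 - i < n" "n - 1 - (n - 1 - i) = i" using assms by auto
  show ?thesis unfolding dual_def coord_scaled_vector[OF i(1)] i(2) by (simp add: power_mult_distrib[symmetric])
qed

lemma chain_scaled_form: "chain (n - 1) speed (\<lambda>j t. scaled_form p \<epsilon> (frame j t)) {a..<b}"
  by (rule chain_bounded_linear[OF chain_frame]) (simp add: linear_conv_bounded_linear[symmetric] linear_scaled_form)

text \<open>
  The product of the scale factors of index \<open>j\<close> for \<open>speed\<close> and \<open>n - 1 - j\<close> for \<open>dual_speed\<close> does not depend on \<open>j\<close>,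
  so it factors out of the sum.
\<close>
lemma scaled_form_scaled_vector:
  assumes \<epsilon>: "0 < \<epsilon>" and 0: "pairing n p g = 0"
  shows "scaled_form p \<epsilon> (scaled_vector g \<epsilon>) = 0"
proof -
  define q where "q = \<epsilon> ^ (n - 1) * (\<Prod>i<n - 1. speed i a)"
  have split: "scale_factor speed a \<epsilon> j * scale_factor dual_speed a \<epsilon> (n - 1 - j) = q" if j: "j < n" for j
  proof -
    have "(\<Prod>i<n - 1. speed i a) = (\<Prod>i<j. speed i a) * (\<Prod>i\<in>{j..<n - 1}. speed i a)"
      using j by (intro prod.atLeastLessThan_concat[symmetric, of 0 j "n - 1", unfolded atLeast0LessThan]) auto
    also have "(\<Prod>i\<in>{j..<n - 1}. speed i a) = (\<Prod>i<n - 1 - j. dual_speed i a)"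
    proof (rule prod.reindex_bij_witness[of _ "\<lambda>i. n - 2 - i" "\<lambda>i. n - 2 - i"])
      fix i assume "i \<in> {j..<n - 1}"
      then have "n - 2 - (n - 2 - i) = i" "n - 2 - i < n - 1 - j" by auto
      then show "n - 2 - (n - 2 - i) = i" "n - 2 - i \<in> {..<n - 1 - j}"
        "speed (n - 2 - (n - 2 - i)) a = speed i a" by simp_all
    qed auto
    finally have "(\<Prod>i<n - 1. speed i a) = (\<Prod>i<j. speed i a) * (\<Prod>i<n - 1 - j. dual_speed i a)" .
    moreover have "\<epsilon> ^ (n - 1) = \<epsilon> ^ j * \<epsilon> ^ (n - 1 - j)" using j by (simp flip: power_add)
    ultimately show ?thesis unfolding q_def scale_factor_def by simp
  qed
  have "scaled_form p \<epsilon> (scaled_vector g \<epsilon>) = (\<Sum>j<n. (- 1) ^ (n - 1 - j) * jet p j * jet g (n - 1 - j) / q)"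
    unfolding scaled_form_def
  proof (rule sum.cong)
    fix j assume "j \<in> {..<n}"
    then have j: "j < n" by simp
    show "jet p j / scale_factor speed a \<epsilon> j * coord (scaled_vector g \<epsilon>) j a = (- 1) ^ (n - 1 - j) * jet p j * jet g (n - 1 - j) / q"
      unfolding coord_scaled_vector[OF j] split[OF j, symmetric] by simp
  qed simp
  also have "\<dots> = 0" using 0 unfolding pairing_def sum_divide_distrib[symmetric] by simp
  finally show ?thesis .
qed

lemma scaled_form_tendsto:
  assumes "degree p < n" "j < n" "0 \<le> s"
  shows "((\<lambda>\<epsilon>. scale_factor speed a \<epsilon> j * scaled_form p \<epsilon> (frame j (a + \<epsilon> * s))) \<longlongrightarrow> poly ((pderiv ^^ j) p) s) (at_right 0)"
proof (rule scaled_chain_tendsto[where x = "\<lambda>\<epsilon> j t. scaled_form p \<epsilon> (frame j t)", OF chain_scaled_form ab(1)])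
  fix \<epsilon> :: real and j assume "0 < \<epsilon>" "j \<le> n - 1"
  then show "scale_factor speed a \<epsilon> j * scaled_form p \<epsilon> (frame j a) = poly ((pderiv ^^ j) p) 0"
    using scaled_form_frame[of j p \<epsilon>] scale_factor_speed_nonzero[of \<epsilon> j] n_pos by (simp add: jet_def)
qed (use assms in auto)

lemma dual_scaled_vector_tendsto:
  assumes "degree g < n" "j < n" "0 \<le> s"
  shows "((\<lambda>\<epsilon>. scale_factor dual_speed a \<epsilon> j * dual (scaled_vector g \<epsilon>) j (a + \<epsilon> * s)) \<longlongrightarrow> poly ((pderiv ^^ j) g) s) (at_right 0)"
proof (rule scaled_chain_tendsto[where x = "\<lambda>\<epsilon>. dual (scaled_vector g \<epsilon>)", OF chain_dual ab(1)])
  fix \<epsilon> :: real and j assume "0 < \<epsilon>" "j \<le> n - 1"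
  then show "scale_factor dual_speed a \<epsilon> j * dual (scaled_vector g \<epsilon>) j a = poly ((pderiv ^^ j) g) 0"
    using dual_scaled_vector[of j g \<epsilon>] scale_factor_dual_speed_nonzero[of \<epsilon> j] n_pos by (simp add: jet_def)
qed (use assms in auto)

end

lemma wronskian_tendsto:
  fixes x y :: "real \<Rightarrow> nat \<Rightarrow> real"
  assumes "\<And>j. j < 2 \<Longrightarrow> ((\<lambda>\<epsilon>. \<sigma> \<epsilon> j * x \<epsilon> j) \<longlongrightarrow> poly ((pderiv ^^ j) p) s) F"
    and "\<And>j. j < 2 \<Longrightarrow> ((\<lambda>\<epsilon>. \<sigma> \<epsilon> j * y \<epsilon> j) \<longlongrightarrow> poly ((pderiv ^^ j) q) s) F"
  shows "((\<lambda>\<epsilon>. (\<sigma> \<epsilon> 0 * \<sigma> \<epsilon> 1) * (x \<epsilon> 0 * y \<epsilon> 1 - x \<epsilon> 1 * y \<epsilon> 0)) \<longlongrightarrow> poly (wronskian p q) s) F"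
proof -
  have "((\<lambda>\<epsilon>. (\<sigma> \<epsilon> 0 * x \<epsilon> 0) * (\<sigma> \<epsilon> 1 * y \<epsilon> 1) - (\<sigma> \<epsilon> 1 * x \<epsilon> 1) * (\<sigma> \<epsilon> 0 * y \<epsilon> 0)) \<longlongrightarrow>
      poly p s * poly (pderiv q) s - poly (pderiv p) s * poly q s) F"
    using assms(1)[of 0] assms(1)[of 1] assms(2)[of 0] assms(2)[of 1] by (auto intro!: tendsto_intros)
  then show ?thesis by (simp add: wronskian_def algebra_simps)
qed

section \<open>The lower bound\<close>

text \<open>
  The index \<open>k\<close> is the dimension of the osculating space. If \<open>n = 4\<close>, the planes are treated through vectors, that is,
  \<open>k = 2\<close> is subsumed under \<open>n - 2\<close>.
\<close>
definition limit_poly ::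
    "nat \<Rightarrow> real poly \<Rightarrow> real poly \<Rightarrow> real poly \<Rightarrow> real poly \<Rightarrow> nat \<Rightarrow> real poly" where
  "limit_poly n p p' g g' k =
     (if k = 1 then p else if k = n - 1 then g else if k = n - 2 then wronskian g g' else wronskian p p')"

context arc_frame
begin

declare frame.simps [simp del]

text \<open>
  The kernel of both forms occurs in dimension 3 if \<open>n = 5\<close>; if \<open>n = 4\<close>, the plane is already taken by \<open>span {w, w'}\<close>.
\<close>
definition nested_flag :: "real ^ 'n \<Rightarrow> real ^ 'n \<Rightarrow> (real ^ 'n \<Rightarrow> real) \<Rightarrow> (real ^ 'n \<Rightarrow> real) \<Rightarrow> nat \<Rightarrow> (real ^ 'n) set" where
  "nested_flag w w' l l' i =
     (if i = 0 then {0} else if i = 1 then span {w} else if i = 2 then span {w, w'}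
      else if n \<le> i then UNIV else if i = n - 1 then {x. l x = 0} else {x. l x = 0} \<inter> {x. l' x = 0})"

lemma nested_flag_complete:
  assumes n45: "n = 4 \<or> n = 5" and l: "linear l" "linear l'"
    and lw: "l w = 0" "l w' = 0" "l' w = 0" "l' w' = 0"
    and w: "\<And>r r'. r *\<^sub>R w + r' *\<^sub>R w' = 0 \<Longrightarrow> r = 0 \<and> r' = 0"
    and x: "l x \<noteq> 0" and x': "l x' = 0" "l' x' \<noteq> 0"
  shows "nested_flag w w' l l' \<in> complete_flags"
proof -
  have UNIV: "dim (UNIV :: (real ^ 'n) set) = n" by (simp add: n)
  have K: "subspace {y. l y = 0}" "dim {y. l y = 0} + 1 = n"
    using dim_kernel[OF subspace_UNIV l(1) UNIV_I x] UNIV by simp_all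
  have K': "subspace ({y. l y = 0} \<inter> {y. l' y = 0})" "dim ({y. l y = 0} \<inter> {y. l' y = 0}) + 2 = n"
    using dim_kernel[OF K(1) l(2) _ x'(2)] x'(1) K(2) by simp_all
  have w_nz: "w \<noteq> 0" "w' \<notin> span {w}"
  proof -
    show "w \<noteq> 0" using w[of 1 0] by auto
    show "w' \<notin> span {w}"
    proof
      assume "w' \<in> span {w}"
      then obtain r where "w' = r *\<^sub>R w" by (auto simp: span_singleton)
      then show False using w[of "- r" 1] by simp
    qed
  qed
  have dims: "dim {w} = 1" "dim {w, w'} = 2"
    using w_nz by (simp_all add: dim_insert insert_commute[of w])
  have in_K: "span {w, w'} \<subseteq> {y. l y = 0} \<inter> {y. l' y = 0}"
    using lw K' by (intro span_minimal) auto
  have step: "nested_flag w w' l l' i \<subseteq> nested_flag w w' l l' (Suc i)" for i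
  proof -
    consider "i = 0" | "i = 1" | "i = 2" | "i = 3" | "4 \<le> i" by linarith
    then show ?thesis
    proof cases
      case 1
      then show ?thesis by (simp add: nested_flag_def span_zero)
    next
      case 2
      have "span {w} \<subseteq> span {w, w'}" by (rule span_mono) auto
      then show ?thesis using 2 by (simp add: nested_flag_def numeral_2_eq_2)
    next
      case 3
      then show ?thesis using in_K n45 by (auto simp: nested_flag_def)
    next
      case 4
      then show ?thesis using n45 by (auto simp: nested_flag_def)
    next
      case 5
      then show ?thesis using n45 by (auto simp: nested_flag_def)
    qed
  qed
  have "subspace (nested_flag w w' l l' i)" for i
    using K K' by (simp add: nested_flag_def subspace_single_0)
  moreover have "dim (nested_flag w w' l l' i) = min i CARD('n)" for i
    using n45 K(2) K'(2) dims UNIV unfolding nested_flag_def n[symmetric] by (auto simp: dim_span)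
  moreover have "mono (nested_flag w w' l l')" using step by (simp add: mono_iff_le_Suc)
  ultimately show ?thesis unfolding complete_flags_def by blast
qed

lemma not_transversalI:
  assumes "1 \<le> k" "k < n" "x \<in> osculating_flag J c t k" "x \<in> f (n - k)" "x \<noteq> 0"
  shows "\<not> transversal (osculating_flag J c t) f"
  using assms unfolding transversal_def n by force

lemma frame_in_osculating_flag:
  assumes "t \<in> {a..<b}" "k \<le> n" "j < k"
  shows "frame j t \<in> osculating_flag J c t k"
  unfolding osculating_flag_frame[OF assms(1,2)] using assms(3) by (intro span_base) auto

lemma frame_pair_nonzero:
  assumes t: "t \<in> {a..<b}" and n: "2 \<le> n" and r: "r \<noteq> 0 \<or> r' \<noteq> 0"
  shows "r *\<^sub>R frame 0 t + r' *\<^sub>R frame 1 t \<noteq> 0"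
proof
  assume z: "r *\<^sub>R frame 0 t + r' *\<^sub>R frame 1 t = 0"
  have "r = coord (r *\<^sub>R frame 0 t + r' *\<^sub>R frame 1 t) 0 t" "r' = coord (r *\<^sub>R frame 0 t + r' *\<^sub>R frame 1 t) 1 t"
    using n by (simp_all add: coord_combination[OF t] coord_frame[OF t])
  moreover have "coord 0 0 t = 0" "coord 0 1 t = 0"
    using linear_0[OF linear_coord[OF t]] n by simp_all
  ultimately show False using r unfolding z by simp
qed

context
  fixes w w' :: "real ^ 'n" and l l' :: "real ^ 'n \<Rightarrow> real" and t :: real
  assumes n45: "n = 4 \<or> n = 5" and l: "linear l" "linear l'"
    and w: "\<And>r r'. r *\<^sub>R w + r' *\<^sub>R w' = 0 \<Longrightarrow> r = 0 \<and> r' = 0" and t: "t \<in> {a..<b}"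
begin

lemma not_transversal_1:
  assumes "l (frame 0 t) = 0"
  shows "\<not> transversal (osculating_flag J c t) (nested_flag w w' l l')"
proof (rule not_transversalI[where k = 1])
  show "frame 0 t \<in> osculating_flag J c t 1" by (rule frame_in_osculating_flag[OF t]) (use n45 in auto)
  show "frame 0 t \<in> nested_flag w w' l l' (n - 1)" using n45 assms by (auto simp: nested_flag_def)
  show "frame 0 t \<noteq> 0" using frame_pair_nonzero[OF t, of 1 0] n45 by auto
qed (use n45 in auto)

lemma not_transversal_2:
  assumes "n = 5" and z: "l (frame 0 t) * l' (frame 1 t) - l (frame 1 t) * l' (frame 0 t) = 0"
  shows "\<not> transversal (osculating_flag J c t) (nested_flag w w' l l')"
proof -
  have "l (frame 0 t) * l' (frame 1 t) - l' (frame 0 t) * l (frame 1 t) = 0" using z by (simp add: mult.commute)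
  from nontrivial_combination_of_singular[OF this] obtain r r' where r: "r \<noteq> 0 \<or> r' \<noteq> 0"
      "r * l (frame 0 t) + r' * l (frame 1 t) = 0" "r * l' (frame 0 t) + r' * l' (frame 1 t) = 0"
    by blast
  define x where "x = r *\<^sub>R frame 0 t + r' *\<^sub>R frame 1 t"
  show ?thesis
  proof (rule not_transversalI[where k = 2])
    have "frame j t \<in> osculating_flag J c t 2" if "j < 2" for j
      by (rule frame_in_osculating_flag[OF t _ that]) (use assms in simp)
    from this[of 0] this[of 1] show "x \<in> osculating_flag J c t 2"
      unfolding x_def osculating_flag_def by (simp add: span_add span_scale)
    have "l x = 0" "l' x = 0"
      unfolding x_def linear_add[OF l(1)] linear_add[OF l(2)] linear_scale[OF l(1)] linear_scale[OF l(2)]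
      using r by simp_all
    then show "x \<in> nested_flag w w' l l' (n - 2)" using assms(1) unfolding nested_flag_def by simp
    show "x \<noteq> 0" unfolding x_def by (rule frame_pair_nonzero[OF t _ r(1)]) (use assms in simp)
  qed (use assms in auto)
qed

lemma not_transversal_n_1:
  assumes "dual w 0 t = 0"
  shows "\<not> transversal (osculating_flag J c t) (nested_flag w w' l l')"
proof (rule not_transversalI[where k = "n - 1"])
  show "w \<in> osculating_flag J c t (n - 1)"
  proof (rule osculating_flagI[OF t])
    fix j assume "n - 1 \<le> j" "j < n"
    then have "j = n - 1" by simp
    then show "coord w j t = 0" using assms by (simp add: dual_def)
  qed simp
  show "w \<in> nested_flag w w' l l' (n - (n - 1))" using n45 by (auto simp: nested_flag_def span_base)
  show "w \<noteq> 0" using w[of 1 0] by auto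
qed (use n45 in auto)

lemma not_transversal_n_2:
  assumes z: "dual w 0 t * dual w' 1 t - dual w 1 t * dual w' 0 t = 0"
  shows "\<not> transversal (osculating_flag J c t) (nested_flag w w' l l')"
proof -
  from nontrivial_combination_of_singular[OF z] obtain r r' where r: "r \<noteq> 0 \<or> r' \<noteq> 0"
      "r * dual w 0 t + r' * dual w' 0 t = 0" "r * dual w 1 t + r' * dual w' 1 t = 0"
    by blast
  define x where "x = r *\<^sub>R w + r' *\<^sub>R w'"
  show ?thesis
  proof (rule not_transversalI[where k = "n - 2"])
    show "x \<in> osculating_flag J c t (n - 2)"
    proof (rule osculating_flagI[OF t])
      fix j assume j: "n - 2 \<le> j" "j < n"
      then have "n - 1 - j = 0 \<or> n - 1 - j = 1" "j = n - 1 - (n - 1 - j)" by auto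
      then consider "j = n - 1" | "j = n - 2" by fastforce
      then show "coord x j t = 0"
        unfolding x_def coord_combination[OF t j(2)]
      proof cases
        case 2
        then have "j = n - 1 - 1" by simp
        then show "r * coord w j t + r' * coord w' j t = 0" using r(3) by (simp add: dual_def)
      qed (use r(2) in \<open>simp add: dual_def\<close>)
    qed simp
    have "x \<in> span {w, w'}" unfolding x_def by (intro span_add span_scale span_base) auto
    then show "x \<in> nested_flag w w' l l' (n - (n - 2))" using n45 by (auto simp: nested_flag_def)
    show "x \<noteq> 0" unfolding x_def using w r(1) by blast
  qed (use n45 in auto)
qed

end

text \<open>
  At its zeros the osculating space of dimension \<open>k\<close> meets the space of dimension \<open>n - k\<close> of \<open>nested_flag w w' l l'\<close>.
\<close>
definition meeting_function :: "(real ^ 'n \<Rightarrow> real) \<Rightarrow> (real ^ 'n \<Rightarrow> real) \<Rightarrow> real ^ 'n \<Rightarrow> real ^ 'n \<Rightarrow> nat \<Rightarrow> real \<Rightarrow> real" where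
  "meeting_function l l' w w' k t =
     (if k = 1 then l (frame 0 t) else if k = n - 1 then dual w 0 t
      else if k = n - 2 then dual w 0 t * dual w' 1 t - dual w 1 t * dual w' 0 t
      else l (frame 0 t) * l' (frame 1 t) - l (frame 1 t) * l' (frame 0 t))"

text \<open>
  Each triple \<open>(k, s, s')\<close> records a change of sign of a limit polynomial between \<open>s\<close> and \<open>s'\<close>. For small
  \<open>\<epsilon>\<close> the corresponding meeting function has a zero between \<open>a + \<epsilon> * s\<close> and \<open>a + \<epsilon> * s'\<close>, and these
  intervals are disjoint. The conditions on the pairing make \<open>w\<close> and \<open>w'\<close> lie in the kernels of the forms, and the Wronskians
  make \<open>w\<close>, \<open>w'\<close> and the two forms independent.
\<close>
lemma length_le_sharp:
  assumes n45: "n = 4 \<or> n = 5"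
    and deg: "degree p < n" "degree p' < n" "degree g < n" "degree g' < n"
    and pair: "pairing n p g = 0" "pairing n p g' = 0" "pairing n p' g = 0" "pairing n p' g' = 0"
    and W: "poly (wronskian p p') 0 \<noteq> 0" "poly (wronskian g g') 0 \<noteq> 0"
    and sorted: "sorted_wrt (\<lambda>(_, _, s) (_, s', _). s \<le> s') ps"
    and ps: "\<forall>(k, s, s')\<in>set ps. 1 \<le> k \<and> k < n \<and> 0 \<le> s \<and> s < s' \<and>
      poly (limit_poly n p p' g g' k) s * poly (limit_poly n p p' g g' k) s' < 0"
  shows "enat (length ps) \<le> sharp J T c"
proof -
  define \<Phi> where "\<Phi> k \<epsilon> = meeting_function (scaled_form p \<epsilon>) (scaled_form p' \<epsilon>) (scaled_vector g \<epsilon>) (scaled_vector g' \<epsilon>) k" for k \<epsilon>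
  define \<kappa> where "\<kappa> k \<epsilon> = (if k = 1 then scale_factor speed a \<epsilon> 0 else if k = n - 1 then scale_factor dual_speed a \<epsilon> 0
      else if k = n - 2 then scale_factor dual_speed a \<epsilon> 0 * scale_factor dual_speed a \<epsilon> 1
      else scale_factor speed a \<epsilon> 0 * scale_factor speed a \<epsilon> 1)" for k :: nat and \<epsilon>
  have lim: "((\<lambda>\<epsilon>. \<kappa> k \<epsilon> * \<Phi> k \<epsilon> (a + \<epsilon> * s)) \<longlongrightarrow> poly (limit_poly n p p' g g' k) s) (at_right 0)" if s: "0 \<le> s" for k s
  proof -
    have n2: "j < n" if "j < 2" for j using that n45 by auto
    have f: "((\<lambda>\<epsilon>. scale_factor speed a \<epsilon> j * scaled_form q \<epsilon> (frame j (a + \<epsilon> * s))) \<longlongrightarrow> poly ((pderiv ^^ j) q) s) (at_right 0)"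
      if "degree q < n" "j < 2" for q j by (rule scaled_form_tendsto[OF that(1) n2[OF that(2)] s])
    have d: "((\<lambda>\<epsilon>. scale_factor dual_speed a \<epsilon> j * dual (scaled_vector q \<epsilon>) j (a + \<epsilon> * s)) \<longlongrightarrow> poly ((pderiv ^^ j) q) s) (at_right 0)"
      if "degree q < n" "j < 2" for q j by (rule dual_scaled_vector_tendsto[OF that(1) n2[OF that(2)] s])
    have WP: "((\<lambda>\<epsilon>. (scale_factor speed a \<epsilon> 0 * scale_factor speed a \<epsilon> 1) *
        (scaled_form p \<epsilon> (frame 0 (a + \<epsilon> * s)) * scaled_form p' \<epsilon> (frame 1 (a + \<epsilon> * s)) -
         scaled_form p \<epsilon> (frame 1 (a + \<epsilon> * s)) * scaled_form p' \<epsilon> (frame 0 (a + \<epsilon> * s)))) \<longlongrightarrow> poly (wronskian p p') s) (at_right 0)"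
      by (rule wronskian_tendsto[where x = "\<lambda>\<epsilon> j. scaled_form p \<epsilon> (frame j (a + \<epsilon> * s))" and y = "\<lambda>\<epsilon> j. scaled_form p' \<epsilon> (frame j (a + \<epsilon> * s))"];
          rule f[OF deg(1)] f[OF deg(2)])
    have WG: "((\<lambda>\<epsilon>. (scale_factor dual_speed a \<epsilon> 0 * scale_factor dual_speed a \<epsilon> 1) *
        (dual (scaled_vector g \<epsilon>) 0 (a + \<epsilon> * s) * dual (scaled_vector g' \<epsilon>) 1 (a + \<epsilon> * s) -
         dual (scaled_vector g \<epsilon>) 1 (a + \<epsilon> * s) * dual (scaled_vector g' \<epsilon>) 0 (a + \<epsilon> * s))) \<longlongrightarrow> poly (wronskian g g') s) (at_right 0)"
      by (rule wronskian_tendsto[where x = "\<lambda>\<epsilon> j. dual (scaled_vector g \<epsilon>) j (a + \<epsilon> * s)" and y = "\<lambda>\<epsilon> j. dual (scaled_vector g' \<epsilon>) j (a + \<epsilon> * s)"];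
          rule d[OF deg(3)] d[OF deg(4)])
    have P: "((\<lambda>\<epsilon>. scale_factor speed a \<epsilon> 0 * scaled_form p \<epsilon> (frame 0 (a + \<epsilon> * s))) \<longlongrightarrow> poly p s) (at_right 0)"
      using f[OF deg(1), of 0] by simp
    have G: "((\<lambda>\<epsilon>. scale_factor dual_speed a \<epsilon> 0 * dual (scaled_vector g \<epsilon>) 0 (a + \<epsilon> * s)) \<longlongrightarrow> poly g s) (at_right 0)"
      using d[OF deg(3), of 0] by simp
    note defs = \<kappa>_def \<Phi>_def meeting_function_def limit_poly_def
    consider "k = 1" | "k \<noteq> 1" "k = n - 1" | "k \<noteq> 1" "k \<noteq> n - 1" "k = n - 2"
      | "k \<noteq> 1" "k \<noteq> n - 1" "k \<noteq> n - 2" by blast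
    then show ?thesis
    proof cases
      case 1
      show ?thesis using P unfolding defs if_P[OF 1] .
    next
      case 2
      show ?thesis using G unfolding defs if_not_P[OF 2(1)] if_P[OF 2(2)] .
    next
      case 3
      show ?thesis using WG unfolding defs if_not_P[OF 3(1)] if_not_P[OF 3(2)] if_P[OF 3(3)] .
    next
      case 4
      show ?thesis using WP unfolding defs if_not_P[OF 4(1)] if_not_P[OF 4(2)] if_not_P[OF 4(3)] .
    qed
  qed
  have cont: "continuous_on {a..<b} (\<Phi> k \<epsilon>)" for k \<epsilon>
  proof -
    have f: "continuous_on {a..<b} (\<lambda>t. scaled_form q \<epsilon> (frame j t))" if "j < 2" for q j
      by (rule chain_continuous_on[OF chain_scaled_form]) (use that n45 in auto)
    have d: "continuous_on {a..<b} (\<lambda>t. dual v j t)" if "j < 2" for v j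
      by (rule chain_continuous_on[OF chain_dual]) (use that n45 in auto)
    show ?thesis unfolding \<Phi>_def meeting_function_def
      using f[of 0] f[of 1] d[of 0] d[of 1]
      by (cases "k = 1"; cases "k = n - 1"; cases "k = n - 2") (auto intro!: continuous_intros)
  qed
  have "\<forall>\<^sub>F \<epsilon> in at_right 0. \<forall>e\<in>set ps. case e of (k, s, s') \<Rightarrow> \<exists>t\<in>{a..<b}. a + \<epsilon> * s < t \<and> t < a + \<epsilon> * s' \<and> \<Phi> k \<epsilon> t = 0"
  proof (rule eventually_ball_finite[OF finite_set], rule ballI)
    fix e assume "e \<in> set ps"
    then obtain k s s' where e: "e = (k, s, s')" "0 \<le> s" "s < s'"
        "poly (limit_poly n p p' g g' k) s * poly (limit_poly n p p' g g' k) s' < 0" using ps by (cases e) auto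
    from eventually_zero_of_sign_change[of a b "\<Phi> k", OF cont ab(1) lim e(2-4)]
    show "\<forall>\<^sub>F \<epsilon> in at_right 0. case e of (k, s, s') \<Rightarrow> \<exists>t\<in>{a..<b}. a + \<epsilon> * s < t \<and> t < a + \<epsilon> * s' \<and> \<Phi> k \<epsilon> t = 0"
      unfolding e(1) prod.case .
  qed
  from eventually_happens[OF eventually_conj[OF eventually_at_right_less this]]
  obtain \<epsilon> where \<epsilon>: "0 < \<epsilon>"
    and *: "\<forall>e\<in>set ps. case e of (k, s, s') \<Rightarrow> \<exists>t\<in>{a..<b}. a + \<epsilon> * s < t \<and> t < a + \<epsilon> * s' \<and> \<Phi> k \<epsilon> t = 0"
    by auto
  have zeros: "\<exists>t\<in>{a..<b}. a + \<epsilon> * s < t \<and> t < a + \<epsilon> * s' \<and> \<Phi> k \<epsilon> t = 0" if "(k, s, s') \<in> set ps" for k s s'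
    using bspec[OF * that] by simp
  let ?w = "scaled_vector g \<epsilon>" and ?w' = "scaled_vector g' \<epsilon>" and ?l = "scaled_form p \<epsilon>" and ?l' = "scaled_form p' \<epsilon>"
  have n2: "0 < n" "1 < n" using n45 by auto
  have jets: "jet q 0 = poly q 0" "jet q 1 = poly (pderiv q) 0" for q by (simp_all add: jet_def)
  have indep: "r = 0 \<and> r' = 0" if z: "r *\<^sub>R ?w + r' *\<^sub>R ?w' = 0" for r r'
  proof -
    have *: "r * jet g i + r' * jet g' i = 0" if i: "i < n" for i
    proof -
      have i': "n - 1 - i < n" using i by simp
      have "coord 0 (n - 1 - i) a = 0" using linear_0[OF linear_coord[OF a_in i']] .
      then have "(- 1) ^ i * (r * coord ?w (n - 1 - i) a + r' * coord ?w' (n - 1 - i) a) = 0"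
        unfolding coord_combination[OF a_in i', symmetric] z by simp
      then have "r * dual ?w i a + r' * dual ?w' i a = 0" unfolding dual_def by (simp add: algebra_simps)
      then have "(r * jet g i + r' * jet g' i) / scale_factor dual_speed a \<epsilon> i = 0"
        unfolding dual_scaled_vector[OF i] by (simp add: add_divide_distrib)
      then show ?thesis using scale_factor_dual_speed_nonzero[OF \<epsilon> i] by simp
    qed
    have "poly g 0 * poly (pderiv g') 0 - poly (pderiv g) 0 * poly g' 0 \<noteq> 0" using W(2) by (simp add: wronskian_def)
    from regular_combination_zero[OF this] show ?thesis using *[OF n2(1)] *[OF n2(2)] unfolding jets by blast
  qed
  have lw: "?l ?w = 0" "?l ?w' = 0" "?l' ?w = 0" "?l' ?w' = 0"
    using scaled_form_scaled_vector[OF \<epsilon>] pair by blast+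
  have f: "nested_flag ?w ?w' ?l ?l' \<in> complete_flags"
  proof -
    \<comment> \<open>A vector in the kernel of the first form at which the second form is a multiple of the value at 0 of the Wronskian.\<close>
    define x' where "x' = ?l (frame 1 a) *\<^sub>R frame 0 a + (- ?l (frame 0 a)) *\<^sub>R frame 1 a"
    have "?l x' = 0" "?l' x' = ?l (frame 1 a) * ?l' (frame 0 a) - ?l (frame 0 a) * ?l' (frame 1 a)"
      unfolding x'_def linear_add[OF linear_scaled_form] linear_scale[OF linear_scaled_form] by simp_all
    moreover have "?l (frame 1 a) * ?l' (frame 0 a) - ?l (frame 0 a) * ?l' (frame 1 a) =
        - poly (wronskian p p') 0 / (scale_factor speed a \<epsilon> 0 * scale_factor speed a \<epsilon> 1)"
      unfolding scaled_form_frame[OF n2(1)] scaled_form_frame[OF n2(2)] jets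
      using scale_factor_speed_nonzero[OF \<epsilon> n2(1)] scale_factor_speed_nonzero[OF \<epsilon> n2(2)]
      by (simp add: wronskian_def field_simps)
    ultimately have x': "?l x' = 0" "?l' x' \<noteq> 0"
      using W(1) scale_factor_speed_nonzero[OF \<epsilon> n2(1)] scale_factor_speed_nonzero[OF \<epsilon> n2(2)] by simp_all
    have "\<exists>x. ?l x \<noteq> 0"
    proof (rule ccontr)
      assume "\<not> (\<exists>x. ?l x \<noteq> 0)"
      then have "jet p 0 / scale_factor speed a \<epsilon> 0 = 0" "jet p 1 / scale_factor speed a \<epsilon> 1 = 0"
        using scaled_form_frame[OF n2(1), of p \<epsilon>] scaled_form_frame[OF n2(2), of p \<epsilon>] by simp_all
      then have "poly p 0 = 0" "poly (pderiv p) 0 = 0"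
        using scale_factor_speed_nonzero[OF \<epsilon> n2(1)] scale_factor_speed_nonzero[OF \<epsilon> n2(2)] unfolding jets by simp_all
      then show False using W(1) by (simp add: wronskian_def)
    qed
    then obtain x where "?l x \<noteq> 0" by blast
    from nested_flag_complete[OF n45 linear_scaled_form linear_scaled_form lw indep this x'] show ?thesis by blast
  qed
  have not_transversal: "\<not> transversal (osculating_flag J c t) (nested_flag ?w ?w' ?l ?l')"
    if k: "1 \<le> k" "k < n" and t: "t \<in> {a..<b}" and z: "\<Phi> k \<epsilon> t = 0" for k t
  proof -
    note facts = n45 linear_scaled_form linear_scaled_form indep t
    consider "k = 1" | "k \<noteq> 1" "k = n - 1" | "k \<noteq> 1" "k \<noteq> n - 1" "k = n - 2"
      | "k \<noteq> 1" "k \<noteq> n - 1" "k \<noteq> n - 2" by blast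
    then show ?thesis
    proof cases
      case 1
      show ?thesis by (rule not_transversal_1[OF facts]) (use z 1 in \<open>auto simp: \<Phi>_def meeting_function_def\<close>)
    next
      case 2
      show ?thesis by (rule not_transversal_n_1[OF facts]) (use z 2 in \<open>auto simp: \<Phi>_def meeting_function_def\<close>)
    next
      case 3
      show ?thesis by (rule not_transversal_n_2[OF facts]) (use z 3 in \<open>auto simp: \<Phi>_def meeting_function_def\<close>)
    next
      case 4
      then have n5: "n = 5" using k n45 by auto
      show ?thesis by (rule not_transversal_2[OF facts n5]) (use z 4 in \<open>auto simp: \<Phi>_def meeting_function_def\<close>)
    qed
  qed
  have "enat (length ps) \<le> ecard {t \<in> T. \<not> transversal (osculating_flag J c t) (nested_flag ?w ?w' ?l ?l')}"
  proof (rule length_le_ecard_of_disjoint_intervals[OF \<epsilon> sorted])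
    fix k s s' assume e: "(k, s, s') \<in> set ps"
    then have k: "1 \<le> k" "k < n" using ps by auto
    obtain t where t: "t \<in> {a..<b}" "a + \<epsilon> * s < t" "t < a + \<epsilon> * s'" "\<Phi> k \<epsilon> t = 0" using zeros[OF e] by blast
    show "\<exists>t\<in>{t \<in> T. \<not> transversal (osculating_flag J c t) (nested_flag ?w ?w' ?l ?l')}. a + \<epsilon> * s < t \<and> t < a + \<epsilon> * s'"
      using not_transversal[OF k t(1,4)] t arc_mem(1)[OF t(1)] by blast
  qed
  also have "\<dots> \<le> sharp J T c" unfolding sharp_def nontransversal_count_def[symmetric] by (rule SUP_upper[OF f])
  finally show ?thesis .
qed

text \<open>
  The polynomials \<open>g\<close> and \<open>g'\<close> are a basis of the space orthogonal to \<open>p\<close> and \<open>p'\<close> for the pairing. They were found by computer, in such a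
  way that all zeros of \<open>p\<close> (3), \<open>g\<close> (3) and the Wronskian of \<open>g\<close> and \<open>g'\<close> (4) are real, positive and well separated.
  The list has one triple, with integer end points, for each of these zeros.
\<close>
lemma ten_le_sharp:
  assumes n4: "n = 4"
  shows "enat 10 \<le> sharp J T c"
proof -
  define p p' g g' :: "real poly" where "p = [:-4158, 807, -50, 1:]" and "p' = [:2067117, -399926, 20957:]"
    and "g = [:39137, -15564, 1839, -66:]" and "g' = [:-134845, 52413, -2607, -9:]"
  define ps :: "(nat \<times> real \<times> real) list" where "ps = [(2, 0, 2), (3, 2, 5), (2, 5, 8), (3, 8, 10), (1, 10, 12),
    (2, 12, 13), (3, 13, 16), (1, 16, 19), (2, 19, 20), (1, 20, 22)]"
  have "enat (length ps) \<le> sharp J T c"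
  proof (rule length_le_sharp)
    show "pairing n p g = 0" "pairing n p g' = 0" "pairing n p' g = 0" "pairing n p' g' = 0"
      unfolding n4 p_def p'_def g_def g'_def
      by (simp_all add: pairing_def jet_def pderiv_pCons eval_nat_numeral)
    show "poly (wronskian p p') 0 \<noteq> 0" "poly (wronskian g g') 0 \<noteq> 0"
      unfolding p_def p'_def g_def g'_def by (simp_all add: wronskian_def pderiv_pCons)
    show "sorted_wrt (\<lambda>(_, _, s) (_, s', _). s \<le> s') ps" by (simp add: ps_def)
    show "\<forall>(k, s, s')\<in>set ps. 1 \<le> k \<and> k < n \<and> 0 \<le> s \<and> s < s' \<and>
      poly (limit_poly n p p' g g' k) s * poly (limit_poly n p p' g g' k) s' < 0"
      unfolding ps_def p_def p'_def g_def g'_def limit_poly_def n4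
      by (simp add: wronskian_def pderiv_pCons)
  qed (auto simp: n4 p_def p'_def g_def g'_def)
  moreover have "length ps = 10" by (simp add: ps_def)
  ultimately show ?thesis by (simp only:)
qed

text \<open>
  As for \<open>n = 4\<close>, but now the space orthogonal to \<open>p\<close> and \<open>p'\<close> has dimension 3, and \<open>p\<close>, the two Wronskians and \<open>g\<close> contribute
  4, 6, 6 and 4 zeros.
\<close>
lemma twenty_le_sharp:
  assumes n5: "n = 5"
  shows "enat 20 \<le> sharp J T c"
proof -
  define p p' g g' :: "real poly" where "p = [:10730880, -766584, 20241, -234, 1:]"
    and "p' = [:62915616, -2831787, 47727, -357, 1:]"
    and "g = [:-221960835, 29716200, -915366, 10496, -41:]"
    and "g' = [:-289373579433, 39166240392, -1352748834, 17958000, -82000:]"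
  define ps :: "(nat \<times> real \<times> real) list" where "ps = [(3, 0, 6), (4, 6, 14), (3, 14, 31), (1, 31, 46), (2, 46, 47),
    (1, 47, 50), (3, 50, 56), (4, 56, 62), (2, 62, 65), (3, 65, 68), (1, 68, 70), (2, 70, 71), (1, 71, 77),
    (2, 77, 84), (3, 84, 87), (2, 87, 90), (4, 90, 92), (3, 92, 93), (4, 93, 94), (2, 94, 96)]"
  have "enat (length ps) \<le> sharp J T c"
  proof (rule length_le_sharp)
    show "pairing n p g = 0" "pairing n p g' = 0" "pairing n p' g = 0" "pairing n p' g' = 0"
      unfolding n5 p_def p'_def g_def g'_def
      by (simp_all add: pairing_def jet_def pderiv_pCons eval_nat_numeral)
    show "poly (wronskian p p') 0 \<noteq> 0" "poly (wronskian g g') 0 \<noteq> 0"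
      unfolding p_def p'_def g_def g'_def by (simp_all add: wronskian_def pderiv_pCons)
    show "sorted_wrt (\<lambda>(_, _, s) (_, s', _). s \<le> s') ps" by (simp add: ps_def)
    show "\<forall>(k, s, s')\<in>set ps. 1 \<le> k \<and> k < n \<and> 0 \<le> s \<and> s < s' \<and>
      poly (limit_poly n p p' g g' k) s * poly (limit_poly n p p' g g' k) s' < 0"
      unfolding ps_def p_def p'_def g_def g'_def limit_poly_def n5
      by (simp add: wronskian_def pderiv_pCons)
  qed (auto simp: n5 p_def p'_def g_def g'_def)
  moreover have "length ps = 20" by (simp add: ps_def)
  ultimately show ?thesis by (simp only:)
qed

end

text \<open>
  Every arc of the curve already carries enough parameters for the lower bound.
\<close>
lemma (in thick) sharp_eq:
  fixes c :: "real \<Rightarrow> (real ^ 'n) set"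
  assumes conv: "convex_curve J T c" and TJ: "T \<subseteq> J" and T: "\<And>a b. a \<in> T \<Longrightarrow> b \<in> T \<Longrightarrow> {a..b} \<subseteq> T"
    and ab: "a \<in> T" "b \<in> T" "a < b" and dim: "CARD('n) = 4 \<or> CARD('n) = 5"
  shows "sharp J T c = enat ((CARD('n) ^ 3 - CARD('n)) div 6)"
proof (rule order_antisym[OF sharp_le[OF conv TJ T dim]])
  obtain u where "arc_frame J T c a b u CARD('n)" using arc_frame_exists[OF conv TJ ab(3) T[OF ab(1,2)]] by blast
  then interpret arc_frame J T c a b u "CARD('n)" .
  show "enat ((CARD('n) ^ 3 - CARD('n)) div 6) \<le> sharp J T c" using dim
  proof
    assume "CARD('n) = 4"
    then show ?thesis using ten_le_sharp by simp
  next
    assume "CARD('n) = 5"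
    then show ?thesis using twenty_le_sharp by simp
  qed
qed

theorem corollary2p17:
  assumes "CARD('n::finite) = 4 \<or> CARD('n) = 5"
  shows "(\<forall>\<gamma> :: complex \<Rightarrow> (real ^ 'n) set.
            convex_on_circle \<gamma> \<longrightarrow>
            sharp_on_circle \<gamma> = enat ((CARD('n) ^ 3 - CARD('n)) div 6)) \<and>
         (\<forall>I. \<forall>\<gamma> :: real \<Rightarrow> (real ^ 'n) set.
            nondegenerate_interval I \<and> convex_on_interval I \<gamma> \<longrightarrow>
            sharp_on_interval I \<gamma> = enat ((CARD('n) ^ 3 - CARD('n)) div 6))"
  proof (intro conjI allI impI)
  fix \<gamma> :: "complex \<Rightarrow> (real ^ 'n) set" assume "convex_on_circle \<gamma>"
  then have conv: "convex_curve UNIV {0..<2 * pi} (\<gamma> \<circ> cis)" unfolding convex_on_circle_def .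
  interpret thick UNIV by standard simp
  have T: "{a..b} \<subseteq> {0..<2 * pi}" if "a \<in> {0..<2 * pi}" "b \<in> {0..<2 * pi}" for a b using that by auto
  have "1 < 2 * pi" using pi_gt3 by simp
  then show "sharp_on_circle \<gamma> = enat ((CARD('n) ^ 3 - CARD('n)) div 6)"
    unfolding sharp_on_circle_def by (intro sharp_eq[OF conv subset_UNIV T _ _ _ assms, of 0 1]) auto
next
  fix I and \<gamma> :: "real \<Rightarrow> (real ^ 'n) set" assume *: "nondegenerate_interval I \<and> convex_on_interval I \<gamma>"
  then have conv: "convex_curve I I \<gamma>" unfolding convex_on_interval_def by blast
  have int: "is_interval I" using * unfolding nondegenerate_interval_def by blast
  obtain a b where ab: "a \<in> I" "b \<in> I" "a < b" using * unfolding nondegenerate_interval_def by blast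
  have T: "{a..b} \<subseteq> I" if "a \<in> I" "b \<in> I" for a b
    using mem_is_interval_1_I[OF int that] by auto
  interpret thick I
  proof
    fix s assume s: "s \<in> I"
    have "I \<noteq> {s}" using ab by auto
    moreover have "connected I" using int by (rule is_interval_connected)
    ultimately show "at s within I \<noteq> bot"
      using connected_imp_perfect[of I s] s unfolding trivial_limit_within by blast
  qed
  show "sharp_on_interval I \<gamma> = enat ((CARD('n) ^ 3 - CARD('n)) div 6)"
    unfolding sharp_on_interval_def by (rule sharp_eq[OF conv subset_refl T ab assms])
qed

end
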